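(* Let $w$ be a dominant permutation whose Lehmer code, viewed as a partition, is a nonempty balanced shape $\lambda$ with $r$ rows and $c$ columns, and let $\ell=\ell(w)$. Then $$\frac{FK(w,\ell+1)}{FK(w,\ell)}=\binom{\ell+1}{2}\left(\frac{2xrc}{\ell(r+c)}+1\right)$$ as an identity of rational functions in $x$.
   Context: For a permutation $w=w_1\cdots w_n$ of $\{1,\dots,n\}$, $\ell(w)=|\{(i,j):i<j,\ w_i>w_j\}|$ is its length, and its Lehmer code is $(c_1(w),\dots,c_n(w))$ with $c_i(w)=|\{j>i: w_i>w_j\}|$. $w$ is dominant if it is 132-avoiding, equivalently its Lehmer code is weakly decreasing; then the nonzero entries of the code form a partition $\lambda$ (with $|\lambda|=\ell(w)$). Let $s_i$ be the simple transposition swapping $i$ and $i+1$. For a sequence $S=(s_{i_1},\dots,s_{i_m})$ define $H(S)$ recursively: $H((s_{i_1}))=s_{i_1}$, and for $m>1$ with $S'=(s_{i_1},\dots,s_{i_{m-1}})$, $H(S)=H(S')$ if $\ell(H(S')s_{i_m})<\ell(H(S'))$ and $H(S)=H(S')s_{i_m}$ otherwise. $S$ is a 0-Hecke word of $w$ of length $m$ if $H(S)=w$. Define $FK(w,m)=\sum (x+i_1)(x+i_2)\cdots(x+i_m)$, summed over all 0-Hecke words $(s_{i_1},\dots,s_{i_m})$ of $w$ of length $m$. Balanced shape: for a partition $\lambda$ with $r$ nonzero parts and $\lambda_1=c$, draw its Young diagram with bottom-left corner at $(0,0)$ and top-right at $(c,r)$ (row $i$ occupies $[0,\lambda_i]\times[r-i,r-i+1]$).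 The turning points of the outward corners (north step followed by east step on the southeast boundary) are the points $(\lambda_{i+1},r-i)$ for $1\le i\le r-1$ with $\lambda_i>\lambda_{i+1}$; $\lambda$ is balanced if all of them lie on the segment from $(0,0)$ to $(c,r)$, i.e. $r\lambda_{i+1}=c(r-i)$ whenever $1\le i\le r-1$ and $\lambda_i>\lambda_{i+1}$. *)

theory Defs
  imports
    "HOL-Analysis.Analysis"
    "HOL-Combinatorics.Permutations"
    "HOL-Computational_Algebra.Polynomial_Factorial"
begin

(* A permutation of {1..n} is a function w with w permutes {1..n}; so w fixes every
   natural number outside {1..n}. *)

definition perm_length :: "nat \<Rightarrow> (nat \<Rightarrow> nat) \<Rightarrow> nat" where
  "perm_length n w = card {(i, j). 1 \<le> i \<and> i < j \<and> j \<le> n \<and> w i > w j}"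

definition lehmer_code :: "nat \<Rightarrow> (nat \<Rightarrow> nat) \<Rightarrow> nat \<Rightarrow> nat" where
  "lehmer_code n w i = card {j. i < j \<and> j \<le> n \<and> w i > w j}"

text \<open>132-avoidance.\<close>
definition dominant :: "nat \<Rightarrow> (nat \<Rightarrow> nat) \<Rightarrow> bool" where
  "dominant n w \<longleftrightarrow>
    \<not> (\<exists>i j k. 1 \<le> i \<and> i < j \<and> j < k \<and> k \<le> n \<and> w i < w k \<and> w k < w j)"

(* The nonzero entries of the Lehmer code, in order of position; for dominant w this list
   is weakly decreasing, i.e. a partition. *)
definition lehmer_shape :: "nat \<Rightarrow> (nat \<Rightarrow> nat) \<Rightarrow> nat list" where
  "lehmer_shape n w = filter (\<lambda>c. c \<noteq> 0) (map (lehmer_code n w) [1..<Suc n])"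

definition simple_transposition :: "nat \<Rightarrow> nat \<Rightarrow> nat" where
  "simple_transposition i = Transposition.transpose i (Suc i)"

(* w s_i is the composite w \<circ> s_i, which swaps the entries of w in positions i and i+1. *)
definition hecke_step :: "nat \<Rightarrow> (nat \<Rightarrow> nat) \<Rightarrow> nat \<Rightarrow> (nat \<Rightarrow> nat)" where
  "hecke_step n v i =
    (if perm_length n (v \<circ> simple_transposition i) < perm_length n v
     then v else v \<circ> simple_transposition i)"

(* A sequence (s_{i_1}, ..., s_{i_m}) is represented by the list of its indices. The fold
   starts from the identity; the lemmas hecke_product_singleton and hecke_product_snoc
   below are the usual recursion starting from a sequence of length one. *)
definition hecke_product :: "nat \<Rightarrow> nat list \<Rightarrow> (nat \<Rightarrow> nat)" where
  "hecke_product n S = foldl (hecke_step n) id S"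

definition hecke_words :: "nat \<Rightarrow> (nat \<Rightarrow> nat) \<Rightarrow> nat \<Rightarrow> nat list set" where
  "hecke_words n w m =
    {S. length S = m \<and> set S \<subseteq> {1..<n} \<and> hecke_product n S = w}"

text \<open>The factor \<^term>\<open>[:of_nat i, 1:]\<close> is the linear polynomial $x + i$.\<close>
definition FK :: "nat \<Rightarrow> (nat \<Rightarrow> nat) \<Rightarrow> nat \<Rightarrow> rat poly" where
  "FK n w m = (\<Sum>S\<in>hecke_words n w m. \<Prod>i\<leftarrow>S. [:of_nat i, 1:])"

(* The part \<lambda>_i is the list entry lam ! (i - 1). *)
definition turning_points :: "nat list \<Rightarrow> (real \<times> real) set" where
  "turning_points lam =
    {(real (lam ! i), real (length lam - i)) | i.
      1 \<le> i \<and> i \<le> length lam - 1 \<and> lam ! (i - 1) > lam ! i}"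

definition balanced :: "nat list \<Rightarrow> bool" where
  "balanced lam \<longleftrightarrow>
    turning_points lam \<subseteq> closed_segment (0, 0) (real (hd lam), real (length lam))"

lemma hecke_product_singleton: "hecke_product n [i] = simple_transposition i"
proof -
  have "perm_length n id = 0"
    unfolding perm_length_def by (rule card_eq_0_iff[THEN iffD2]) auto
  then show ?thesis
    by (simp add: hecke_product_def hecke_step_def)
qed

lemma hecke_product_snoc:
  "hecke_product n (S @ [i]) =
    (if perm_length n (hecke_product n S \<circ> simple_transposition i)
          < perm_length n (hecke_product n S)
     then hecke_product n S else hecke_product n S \<circ> simple_transposition i)"
  by (simp add: hecke_product_def hecke_step_def)

lemma turning_point_on_segment_iff:
  fixes a b c r :: nat
  assumes "r > 0" "b \<le> r"
  shows "(real a, real b) \<in> closed_segment (0, 0) (real c, real r) \<longleftrightarrow> r * a = c * b"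
proof
  assume "(real a, real b) \<in> closed_segment (0, 0) (real c, real r)"
  then obtain u where "real a = u * real c" "real b = u * real r"
    by (auto simp: closed_segment_def)
  then have "real (r * a) = real (c * b)"
    by simp
  then show "r * a = c * b"
    by (simp only: of_nat_eq_iff)
next
  assume "r * a = c * b"
  then have "real r * real a = real c * real b"
    by (metis of_nat_mult)
  then have "real a = (real b / real r) * real c" "real b = (real b / real r) * real r"
    using assms by (auto simp: field_simps)
  moreover have "0 \<le> real b / real r" "real b / real r \<le> 1"
    using assms by auto
  ultimately show "(real a, real b) \<in> closed_segment (0, 0) (real c, real r)"
    unfolding closed_segment_def
    by (auto intro!: exI[of _ "real b / real r"])
qed

lemma balanced_iff:
  assumes "lam \<noteq> []"
  shows "balanced lam \<longleftrightarrow>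
    (\<forall>i. 1 \<le> i \<and> i \<le> length lam - 1 \<and> lam ! (i - 1) > lam ! i \<longrightarrow>
      length lam * lam ! i = hd lam * (length lam - i))"
proof -
  have *: "(real (lam ! i), real (length lam - i))
        \<in> closed_segment (0, 0) (real (hd lam), real (length lam)) \<longleftrightarrow>
      length lam * lam ! i = hd lam * (length lam - i)" for i
    using assms by (intro turning_point_on_segment_iff) auto
  show ?thesis
    unfolding balanced_def turning_points_def using * by blast
qed

end

theory Submission
  imports Defs
begin

text \<open>
  Evaluate at natural numbers $x$. Then $FK(w,m)$ counts, with weight $i_1 \cdots i_m$, the 0-Hecke
  words of $1^x \times w$, and $\sum_m FK(w,m)\, t^m/m! = N_0 (e^t-1)^\ell + N_1 (e^t-1)^{\ell+1} + \dots$,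
  so that $FK(w,\ell+1)/FK(w,\ell) = (\ell+1)(N_1/N_0 + \ell/2)$. A numerical version of the
  $K$-theoretic Monk formula, obtained by commuting chain operators with the recursion on the first
  letter, yields transition equations for $N_0$ and $N_1$. Along these, $N_0$ counts the chains
  $\lambda \supseteq \nu^1 \supseteq \dots \supseteq \nu^x$ of Young diagrams (plane partitions), and $N_1$ counts
  them with the total number of corners of the $\nu^k$ as weight. For balanced $\lambda$ the
  number of corners of $\nu \subseteq \lambda$ is $rc/(r+c)$ plus a linear combination over the cells of
  $\lambda$ of the differences "addable minus removable", and these differences have total zero because
  toggling a cell is an involution on plane partitions. Hence $N_1/N_0 = x\, rc/(r+c)$.
\<close>

section \<open>Operators summing over chains of covers\<close>

text \<open>Why powers of \<open>e^t - 1\<close>: let \<open>F_v\<close> be the exponential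
  generating function of the weighted word counts of \<open>v\<close>, and \<open>H\<close> the
  recursion on the first letter. The chain operators to the right and to the left of a position
  \<open>r\<close> both commute with \<open>H\<close> up to a scalar depending on \<open>v\<close>.
  For letters weighted by their index the two scalars differ by exactly 1, and iterating
  \<open>1 + H\<close> instead of \<open>H\<close> costs the factor \<open>e^t\<close>: the right
  chain sum of \<open>F\<close> is \<open>e^t\<close> times the left one. In general both sums have
  many terms. The work on Lehmer codes serves to find \<open>v\<close> with a single cover
  \<open>w\<close> on the right and at most one cover \<open>w'\<close> on the left, for then
  \<open>F_w = (e^t - 1) F_v + e^t F_w'\<close>. Writing \<open>e^t = 1 + (e^t - 1)\<close>, the
  last summand enters \<open>N_1(w)\<close> as \<open>N_1(w') + N_0(w')\<close>, and this extra
  \<open>N_0\<close> is what produces the corner count. The constant \<open>l/2\<close> is the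
  linear coefficient of \<open>((e^t - 1)/t)^l\<close>.\<close>

abbreviation tr :: "nat \<Rightarrow> nat \<Rightarrow> nat \<Rightarrow> nat" where
  "tr \<equiv> Transposition.transpose"

text \<open>The relation \<open>lt\<close> is \<open><\<close> or \<open>>\<close>, used for positions and values alike, and
\<open>e 0, e 1, \<dots>\<close> are consecutive positions. One locale thus serves both sides of a position
\<open>r\<close>: reversing positions and values together preserves covers and left descents. The operator
\<open>chains d f u\<close> sums \<open>f\<close> over all permutations reached from \<open>u\<close> by swapping \<open>e 0\<close> with
\<open>e i\<close> for decreasing \<open>i \<le> d\<close>, each swap being a cover of the Bruhat order.\<close>

locale chain_operator =
  fixes lt :: "nat \<Rightarrow> nat \<Rightarrow> bool" and e :: "nat \<Rightarrow> nat" and D :: nat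
  assumes irrefl: "\<not> lt x x"
    and trans: "lt x y \<Longrightarrow> lt y z \<Longrightarrow> lt x z"
    and total: "x \<noteq> y \<Longrightarrow> lt x y \<or> lt y x"
    and e_mono: "i < j \<Longrightarrow> j \<le> D \<Longrightarrow> lt (e i) (e j)"
    and e_convex: "lt (e 0) p \<Longrightarrow> lt p (e i) \<Longrightarrow> i \<le> D \<Longrightarrow> \<exists>c<i. p = e c"
begin

definition cov :: "(nat \<Rightarrow> nat) \<Rightarrow> nat \<Rightarrow> bool" where
  "cov u d \<longleftrightarrow> lt (u (e 0)) (u (e d)) \<and>
     (\<forall>c. 0 < c \<and> c < d \<longrightarrow> \<not> (lt (u (e 0)) (u (e c)) \<and> lt (u (e c)) (u (e d))))"

primrec chains :: "nat \<Rightarrow> ((nat \<Rightarrow> nat) \<Rightarrow> rat) \<Rightarrow> (nat \<Rightarrow> nat) \<Rightarrow> rat" where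
  "chains 0 f u = f u"
| "chains (Suc d) f u = chains d f u +
     (if cov u (Suc d) then chains d f (u \<circ> tr (e 0) (e (Suc d))) else 0)"

definition adj :: "nat \<Rightarrow> nat \<Rightarrow> bool" where
  "adj a b \<longleftrightarrow> lt a b \<and> (\<forall>c. \<not> (lt a c \<and> lt c b))"

definition desc :: "nat \<Rightarrow> nat \<Rightarrow> (nat \<Rightarrow> nat) \<Rightarrow> bool" where
  "desc a b u \<longleftrightarrow> (\<exists>p q. u p = b \<and> u q = a \<and> lt p q)"

definition dem :: "nat \<Rightarrow> nat \<Rightarrow> ((nat \<Rightarrow> nat) \<Rightarrow> rat) \<Rightarrow> (nat \<Rightarrow> nat) \<Rightarrow> rat" where
  "dem a b f u = (if desc a b u then f u + f (tr a b \<circ> u) else 0)"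

lemma asym: "lt x y \<Longrightarrow> \<not> lt y x"
  using irrefl trans by blast

lemma e_inj: "i \<le> D \<Longrightarrow> j \<le> D \<Longrightarrow> e i = e j \<longleftrightarrow> i = j"
  by (metis e_mono irrefl linorder_neqE_nat)

lemma desc_iff: "inj u \<Longrightarrow> u p = a \<Longrightarrow> u q = b \<Longrightarrow> desc a b u \<longleftrightarrow> lt q p"
  unfolding desc_def by (metis injD)

lemma adj_lt_iff:
  assumes "adj a b" "y \<noteq> a" "y \<noteq> b"
  shows "lt a y \<longleftrightarrow> lt b y" "lt y a \<longleftrightarrow> lt y b"
  using assms total trans asym unfolding adj_def by metis+

lemma lt_transpose_iff:
  assumes "adj a b" "\<not> (x = a \<and> y = b)" "\<not> (x = b \<and> y = a)"
  shows "lt (tr a b x) (tr a b y) \<longleftrightarrow> lt x y"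
proof -
  consider "x = y" | "x \<noteq> y" "y \<noteq> a" "y \<noteq> b" | "x \<noteq> y" "x \<noteq> a" "x \<noteq> b"
    using assms by blast
  then show ?thesis
  proof cases
    case 2
    then show ?thesis
      using adj_lt_iff(1)[OF assms(1), of y] by (auto simp: Transposition.transpose_def)
  next
    case 3
    then show ?thesis
      using adj_lt_iff(2)[OF assms(1), of x] by (auto simp: Transposition.transpose_def)
  qed (simp add: irrefl)
qed

text \<open>Exchanging adjacent values alters a comparison only if it compares these two with each
  other. \<open>cov\<close> compares values only with those at \<open>e 0\<close> and
  \<open>e d\<close>, so just these pairs are excluded.\<close>

lemma cov_transpose_iff:
  assumes "adj a b"
    and "\<And>c. c \<le> d \<Longrightarrow> \<not> (u (e 0) = a \<and> u (e c) = b)"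
    and "\<And>c. c \<le> d \<Longrightarrow> \<not> (u (e 0) = b \<and> u (e c) = a)"
    and "\<And>c. c \<le> d \<Longrightarrow> \<not> (u (e c) = a \<and> u (e d) = b)"
    and "\<And>c. c \<le> d \<Longrightarrow> \<not> (u (e c) = b \<and> u (e d) = a)"
  shows "cov (tr a b \<circ> u) d \<longleftrightarrow> cov u d"
proof -
  have "lt (tr a b (u (e 0))) (tr a b (u (e c))) \<longleftrightarrow> lt (u (e 0)) (u (e c))" if "c \<le> d" for c
    using assms(2,3)[OF that] by (intro lt_transpose_iff[OF assms(1)])
  moreover have "lt (tr a b (u (e c))) (tr a b (u (e d))) \<longleftrightarrow> lt (u (e c)) (u (e d))" if "c \<le> d" for c
    using assms(4,5)[OF that] by (intro lt_transpose_iff[OF assms(1)])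
  ultimately show ?thesis
    unfolding cov_def o_apply by auto
qed

text \<open>The window \<open>e 0, ..., e d\<close> consists of consecutive positions, so a position
  outside it lies before all of them or after all of them.\<close>

lemma outside_lt_iff:
  assumes "p \<notin> e ` {..d}" "i \<le> d" "j \<le> d" "d \<le> D"
  shows "lt p (e i) \<longleftrightarrow> lt p (e j)" "lt (e i) p \<longleftrightarrow> lt (e j) p"
proof -
  have *: "lt p (e j)" if "lt p (e i)" "i \<le> d" "j \<le> d" for i j
  proof (rule ccontr)
    assume "\<not> lt p (e j)"
    then have "lt (e j) p" using total[of p "e j"] assms(1) that by auto
    then have "lt (e 0) p"
      using e_mono[of 0 j] trans[of "e 0" "e j" p] that assms(4) by (cases "j = 0") auto
    from e_convex[OF this that(1)] show False using that assms by auto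
  qed
  then show 1: "lt p (e i) \<longleftrightarrow> lt p (e j)" using assms by blast
  show "lt (e i) p \<longleftrightarrow> lt (e j) p"
    using 1 total asym assms by (metis atMost_iff image_eqI)
qed

text \<open>A chain moves values only inside the window \<open>e 0, ..., e d\<close>. If
  \<open>a\<close> and \<open>b\<close> do not both sit there, no swap changes which of them comes
  first, so the descent condition is the same at every term of the sum.\<close>

lemma chains_dem_outside:
  assumes "adj a b" "inj u" "u p = a" "u q = b" "d \<le> D"
    and "\<not> (p \<in> e ` {..d} \<and> q \<in> e ` {..d})"
  shows "chains d (dem a b f) u = (if lt q p then chains d f u + chains d f (tr a b \<circ> u) else 0)"
  using assms
proof (induction d arbitrary: u p q)
  case 0
  then show ?case by (simp add: dem_def desc_iff[of u p a q b])
next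
  case (Suc d)
  let ?t = "tr (e 0) (e (Suc d))"
  have I: "?t x \<in> e ` {..Suc d} \<longleftrightarrow> x \<in> e ` {..Suc d}" for x
    by (cases "x = e 0"; cases "x = e (Suc d)") auto
  have sub: "e ` {..d} \<subseteq> e ` {..Suc d}" by auto
  have t_id: "?t x = x" if "x \<notin> e ` {..Suc d}" for x
    using that by (intro transpose_apply_other) auto
  have lt_t: "lt (?t q) (?t p) \<longleftrightarrow> lt q p"
  proof (cases "q \<in> e ` {..Suc d}")
    case True
    then have p: "p \<notin> e ` {..Suc d}" using Suc.prems by blast
    from True I[of q] obtain i j where "q = e i" "?t q = e j" "i \<le> Suc d" "j \<le> Suc d"
      by auto
    then show ?thesis using outside_lt_iff[OF p _ _ Suc.prems(5)] t_id[OF p] by metis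
  next
    case q: False
    show ?thesis
    proof (cases "p \<in> e ` {..Suc d}")
      case True
      from True I[of p] obtain i j where "p = e i" "?t p = e j" "i \<le> Suc d" "j \<le> Suc d"
        by auto
      then show ?thesis using outside_lt_iff[OF q _ _ Suc.prems(5)] t_id[OF q] by metis
    qed (simp add: t_id q)
  qed
  have cov_eq: "cov (tr a b \<circ> u) (Suc d) \<longleftrightarrow> cov u (Suc d)"
  proof (rule cov_transpose_iff[OF Suc.prems(1)])
  qed (use Suc.prems in \<open>auto dest: injD\<close>)
  have A: "chains d (dem a b f) u = (if lt q p then chains d f u + chains d f (tr a b \<circ> u) else 0)"
    using Suc.prems sub by (intro Suc.IH) auto
  have B: "chains d (dem a b f) (u \<circ> ?t) =
     (if lt q p then chains d f (u \<circ> ?t) + chains d f (tr a b \<circ> (u \<circ> ?t)) else 0)"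
    unfolding lt_t[symmetric]
  proof (rule Suc.IH)
    show "inj (u \<circ> ?t)" using Suc.prems(2) by (simp add: inj_compose)
    show "\<not> (?t p \<in> e ` {..d} \<and> ?t q \<in> e ` {..d})"
      using Suc.prems(6) I[of p] I[of q] sub by blast
  qed (use Suc.prems in auto)
  show ?case unfolding chains.simps cov_eq A B comp_assoc by simp
qed

text \<open>With \<open>a\<close> at the root, no cover occurs beyond the position of
  \<open>b\<close>, because \<open>b\<close> lies between \<open>a\<close> and any larger value. The
  swap with \<open>b\<close> is a cover that creates the descent: the branch without it contributes
  0, the branch with it contributes both \<open>u\<close> and \<open>tr a b \<circ> u\<close>, and
  these are the two branches of \<open>chains d f u\<close>.\<close>

lemma chains_dem_root_lower:
  assumes "adj a b" "inj u" "u (e 0) = a" "u (e i) = b" "0 < i" "i \<le> d" "d \<le> D"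
  shows "chains d (dem a b f) u = chains d f u"
  using assms
proof (induction d)
  case 0
  then show ?case by simp
next
  case (Suc d)
  let ?t = "tr (e 0) (e (Suc d))"
  show ?case
  proof (cases "i = Suc d")
    case True
    have ut: "u \<circ> ?t = tr a b \<circ> u"
      using Suc.prems True by (auto simp: fun_eq_iff Transposition.transpose_def dest: injD)
    have lt: "lt (e 0) (e (Suc d))" using e_mono Suc.prems by auto
    have out: "e (Suc d) \<notin> e ` {..d}" using e_inj Suc.prems by auto
    have c: "cov u (Suc d)" using Suc.prems True unfolding cov_def adj_def by auto
    have 1: "chains d (dem a b f) u = 0"
      using chains_dem_outside[of a b u "e 0" "e (Suc d)" d f] Suc.prems True out asym[OF lt] by auto
    have 2: "chains d (dem a b f) (tr a b \<circ> u) =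
        chains d f (tr a b \<circ> u) + chains d f (tr a b \<circ> (tr a b \<circ> u))"
      using chains_dem_outside[of a b "tr a b \<circ> u" "e (Suc d)" "e 0" d f] Suc.prems True out lt
      by (auto simp: inj_compose)
    show ?thesis using 1 2 c ut by (simp add: o_assoc)
  next
    case False
    then have i: "i \<le> d" using Suc.prems by auto
    have c: "\<not> cov u (Suc d)"
    proof
      assume c: "cov u (Suc d)"
      have "e (Suc d) \<noteq> e i" "e (Suc d) \<noteq> e 0"
        using Suc.prems False e_inj by auto
      then have "u (e (Suc d)) \<noteq> b" "u (e (Suc d)) \<noteq> a"
        using Suc.prems(2-4) by (auto dest: injD)
      then show False using c Suc.prems i adj_lt_iff(1)[OF Suc.prems(1)] unfolding cov_def adj_def
        by (metis le_imp_less_Suc)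
    qed
    then show ?thesis using Suc.IH Suc.prems i by simp
  qed
qed

text \<open>At the position of \<open>a\<close> the cover now exists for
  \<open>tr a b \<circ> u\<close> and not for \<open>u\<close>. Beyond that position, a cover of
  \<open>u\<close> leaves \<open>a\<close> before \<open>b\<close> with neither at the root, so its
  branch vanishes; for \<open>tr a b \<circ> u\<close> such covers are blocked by the value
  \<open>b\<close>.\<close>

lemma chains_dem_root_upper:
  assumes "adj a b" "inj u" "u (e 0) = b" "u (e i) = a" "0 < i" "i \<le> d" "d \<le> D"
  shows "chains d (dem a b f) u = chains d f (tr a b \<circ> u)"
  using assms
proof (induction d)
  case 0
  then show ?case by simp
next
  case (Suc d)
  let ?t = "tr (e 0) (e (Suc d))"
  have lab: "lt a b" using Suc.prems(1) by (simp add: adj_def)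
  show ?case
  proof (cases "i = Suc d")
    case True
    have lt: "lt (e 0) (e (Suc d))" using e_mono Suc.prems by auto
    have out: "e (Suc d) \<notin> e ` {..d}" using e_inj Suc.prems by auto
    have c: "\<not> cov u (Suc d)" using Suc.prems True asym[OF lab] unfolding cov_def by auto
    have c': "cov (tr a b \<circ> u) (Suc d)" using Suc.prems True unfolding cov_def adj_def by auto
    have ut: "(tr a b \<circ> u) \<circ> ?t = u"
      using Suc.prems True by (auto simp: fun_eq_iff Transposition.transpose_def dest: injD)
    have "chains d (dem a b f) u = chains d f u + chains d f (tr a b \<circ> u)"
      using chains_dem_outside[of a b u "e (Suc d)" "e 0" d f] Suc.prems True out lt by auto
    then show ?thesis unfolding chains.simps ut using c c' by simp
  next
    case False
    then have i: "i \<le> d" using Suc.prems by auto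
    have ne: "e (Suc d) \<noteq> e i" "e (Suc d) \<noteq> e 0" "e i \<noteq> e 0"
      using Suc.prems False e_inj by auto
    then have ul: "u (e (Suc d)) \<noteq> b" "u (e (Suc d)) \<noteq> a"
      using Suc.prems(2-4) by (auto dest: injD)
    have c': "\<not> cov (tr a b \<circ> u) (Suc d)"
    proof
      assume c: "cov (tr a b \<circ> u) (Suc d)"
      then have "lt a (u (e (Suc d)))" "\<not> lt b (u (e (Suc d)))"
        using Suc.prems i ul lab unfolding cov_def by (auto simp: less_Suc_eq_le)
      then show False using ul adj_lt_iff(1)[OF Suc.prems(1)] by metis
    qed
    have IH: "chains d (dem a b f) u = chains d f (tr a b \<circ> u)" 
      by (rule Suc.IH) (use Suc.prems i in auto)
    have "chains d (dem a b f) (u \<circ> ?t) = 0"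
    proof -
      have "e 0 \<notin> {e i, e (Suc d)}" using ne by auto
      have lt: "lt (e i) (e (Suc d))" using e_mono[of i "Suc d"] Suc.prems i by simp
      have out: "e (Suc d) \<notin> e ` {..d}" using e_inj Suc.prems by auto
      have "(u \<circ> ?t) (e i) = a" "(u \<circ> ?t) (e (Suc d)) = b" "inj (u \<circ> ?t)"
        using Suc.prems ne by (auto simp: inj_compose)
      then show ?thesis
        using chains_dem_outside[of a b "u \<circ> ?t" "e i" "e (Suc d)" d f] Suc.prems out asym[OF lt] by auto
    qed
    then show ?thesis unfolding chains.simps IH using c' by simp
  qed
qed

text \<open>The delicate case has \<open>a\<close> at the far end and \<open>b\<close> before it. A
  cover of \<open>u\<close> moving \<open>a\<close> to the root has no counterpart for
  \<open>tr a b \<circ> u\<close>, where \<open>a\<close> lies in between; but by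
  \<open>chains_dem_root_lower\<close> its branch contributes only once, as needed.\<close>

lemma chains_dem_inside:
  assumes "adj a b" "inj u" "u (e i) = a" "u (e j) = b"
    and "0 < i" "i \<le> d" "0 < j" "j \<le> d" "d \<le> D"
  shows "chains d (dem a b f) u = (if j < i then chains d f u + chains d f (tr a b \<circ> u) else 0)"
  using assms
proof (induction d arbitrary: u)
  case 0
  then show ?case by simp
next
  case (Suc d)
  let ?t = "tr (e 0) (e (Suc d))"
  have lab: "lt a b" using Suc.prems(1) by (simp add: adj_def)
  have ij: "i \<noteq> j" using Suc.prems lab irrefl by auto
  have root: "e i \<noteq> e 0" "e j \<noteq> e 0" using Suc.prems e_inj by auto
  have u0: "u (e 0) \<noteq> a" "u (e 0) \<noteq> b" using Suc.prems(2-4) root by (metis injD)+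
  have inj': "inj (u \<circ> ?t)" using Suc.prems(2) by (simp add: inj_compose)
  have out: "e (Suc d) \<notin> e ` {..d}" using e_inj Suc.prems by auto
  show ?case
  proof (cases "i = Suc d \<or> j = Suc d")
    case False
    then have i: "i \<le> d" "j \<le> d" using Suc.prems by auto
    have ne: "e (Suc d) \<noteq> e i" "e (Suc d) \<noteq> e j" using i e_inj Suc.prems by auto
    have ul: "u (e (Suc d)) \<noteq> a" "u (e (Suc d)) \<noteq> b"
      using Suc.prems(2-4) ne by (metis injD)+
    have c: "cov (tr a b \<circ> u) (Suc d) \<longleftrightarrow> cov u (Suc d)"
      using u0 ul by (intro cov_transpose_iff[OF Suc.prems(1)]) auto
    have A: "chains d (dem a b f) u = (if j < i then chains d f u + chains d f (tr a b \<circ> u) else 0)"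
      using Suc.prems i by (intro Suc.IH) auto
    have B: "chains d (dem a b f) (u \<circ> ?t) =
        (if j < i then chains d f (u \<circ> ?t) + chains d f (tr a b \<circ> (u \<circ> ?t)) else 0)"
      by (rule Suc.IH[OF Suc.prems(1) inj']) (use Suc.prems i ne root in auto)
    show ?thesis unfolding chains.simps c A B comp_assoc by simp
  next
    case True
    show ?thesis
    proof (cases "i = Suc d")
      case i: True
      then have j: "j \<le> d" "j < i" using ij Suc.prems by auto
      have lt: "lt (e j) (e i)" using e_mono j Suc.prems by auto
      have A: "chains d (dem a b f) u = chains d f u + chains d f (tr a b \<circ> u)"
        using chains_dem_outside[of a b u "e i" "e j" d f] Suc.prems i out lt by auto
      have c': "\<not> cov (tr a b \<circ> u) (Suc d)"
      proof
        assume c: "cov (tr a b \<circ> u) (Suc d)"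
        have "0 < j" "j < Suc d" using j Suc.prems by auto
        then have "lt (u (e 0)) b" "\<not> (lt (u (e 0)) a \<and> lt a b)"
          using c Suc.prems i u0 unfolding cov_def by auto
        then show False using u0 lab adj_lt_iff(2)[OF Suc.prems(1)] by metis
      qed
      have ej: "e j \<noteq> e (Suc d)" using j i e_inj Suc.prems by auto
      have B: "chains d (dem a b f) (u \<circ> ?t) = chains d f (u \<circ> ?t)"
        by (rule chains_dem_root_lower[of a b _ j]) (use Suc.prems i j root ej inj' in auto)
      show ?thesis unfolding chains.simps A B using c' j by auto
    next
      case False
      then have j: "j = Suc d" and i: "i \<le> d" "\<not> j < i" using True Suc.prems by auto
      have lt: "lt (e i) (e j)" using e_mono[of i j] i j Suc.prems by auto
      have A: "chains d (dem a b f) u = 0"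
        using chains_dem_outside[of a b u "e i" "e j" d f] Suc.prems j out asym[OF lt] by auto
      have "\<not> cov u (Suc d)"
      proof
        assume c: "cov u (Suc d)"
        have "0 < i" "i < Suc d" using i Suc.prems by auto
        then have "lt (u (e 0)) b" "\<not> (lt (u (e 0)) a \<and> lt a b)"
          using c Suc.prems j unfolding cov_def by auto
        then show False using u0 lab adj_lt_iff(2)[OF Suc.prems(1)] by metis
      qed
      then show ?thesis unfolding chains.simps A using i by simp
    qed
  qed
qed

text \<open>The chain operator commutes with the left Demazure operator up to a multiple of itself, which is
nonzero only if one of the two exchanged values sits at the root position \<open>e 0\<close>.\<close>

theorem chains_dem:
  assumes "adj a b" "inj u" "u p = a" "u q = b" "d \<le> D"
  shows "chains d (dem a b f) u = dem a b (chains d f) u +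
    (if u (e 0) = a \<and> q \<in> e ` {1..d} then chains d f u else 0) -
    (if u (e 0) = b \<and> p \<in> e ` {1..d} then chains d f u else 0)"
proof -
  have lab: "lt a b" "a \<noteq> b" using assms(1) irrefl by (auto simp: adj_def)
  have root: "u (e 0) = a \<longleftrightarrow> p = e 0" "u (e 0) = b \<longleftrightarrow> q = e 0"
    using assms by (metis injD)+
  have split: "{..d} = insert 0 {1..d}" by auto
  have dem: "dem a b (chains d f) u = (if lt q p then chains d f u + chains d f (tr a b \<circ> u) else 0)"
    using desc_iff[OF assms(2-4)] by (simp add: dem_def)
  have e0: "e 0 \<notin> e ` {1..d}" using e_inj assms(5) by auto
  have pq: "p \<noteq> q" using assms lab by auto
  consider "\<not> (p \<in> e ` {..d} \<and> q \<in> e ` {..d})"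
    | j where "p = e 0" "q = e j" "0 < j" "j \<le> d"
    | i where "q = e 0" "p = e i" "0 < i" "i \<le> d"
    | i j where "p = e i" "q = e j" "0 < i" "i \<le> d" "0 < j" "j \<le> d"
    using pq unfolding split by fastforce
  then show ?thesis
  proof cases
    case 1
    then show ?thesis using chains_dem_outside[OF assms(1-5) 1, of f] root dem pq
      unfolding split by auto
  next
    case 2
    then have "lt p q" using e_mono assms by auto
    then show ?thesis using chains_dem_root_lower[of a b u j d f] 2 assms root dem pq asym by auto
  next
    case 3
    then have "lt q p" using e_mono assms by auto
    then show ?thesis using chains_dem_root_upper[of a b u i d f] 3 assms root dem pq by auto
  next
    case 4
    then have "p \<noteq> e 0" "q \<noteq> e 0" using e_inj assms by auto
    moreover have "j < i \<longleftrightarrow> lt q p"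
      using 4 e_mono[of j i] e_mono[of i j] assms(5) asym irrefl[of p] by (metis le_trans linorder_neqE_nat)
    ultimately show ?thesis using chains_dem_inside[of a b u i j d f] 4 assms root dem by auto
  qed
qed

lemma chains_no_cover:
  assumes "\<And>c. 0 < c \<Longrightarrow> c \<le> d \<Longrightarrow> \<not> cov u c"
  shows "chains d f u = f u"
  using assms by (induction d) auto

text \<open>After the swap at \<open>k\<close> only indices below \<open>k\<close> remain available,
  hence the range of the last hypothesis.\<close>

lemma chains_one_cover:
  assumes "0 < k" "k \<le> d" "cov u k"
    and "\<And>c. 0 < c \<Longrightarrow> c \<le> d \<Longrightarrow> c \<noteq> k \<Longrightarrow> \<not> cov u c"
    and "\<And>c. 0 < c \<Longrightarrow> c < k \<Longrightarrow> \<not> cov (u \<circ> tr (e 0) (e k)) c"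
  shows "chains d f u = f u + f (u \<circ> tr (e 0) (e k))"
  using assms
proof (induction d)
  case (Suc d)
  show ?case
  proof (cases "k = Suc d")
    case True
    have "chains d f u = f u"
      by (rule chains_no_cover) (use True Suc.prems in auto)
    moreover have "chains d f (u \<circ> tr (e 0) (e k)) = f (u \<circ> tr (e 0) (e k))"
      by (rule chains_no_cover) (rule Suc.prems(5), use True in auto)
    ultimately show ?thesis
      using Suc.prems(3) unfolding True chains.simps by (simp only: if_True)
  next
    case False
    then show ?thesis using Suc by auto
  qed
qed simp

text \<open>Every swap of a chain leaves the two values inverted, so no swap can end at the
  identity.\<close>

lemma chains_indicator_id:
  assumes "d \<le> D"
  shows "chains d (\<lambda>v. if v = id then 1 else 0) u = (if u = id then 1 else 0)"
  using assms
proof (induction d arbitrary: u)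
  case (Suc d)
  have "u \<circ> tr (e 0) (e (Suc d)) \<noteq> id" if "cov u (Suc d)"
  proof
    assume *: "u \<circ> tr (e 0) (e (Suc d)) = id"
    have "u (e (Suc d)) = e 0" "u (e 0) = e (Suc d)"
      using fun_cong[OF *, of "e 0"] fun_cong[OF *, of "e (Suc d)"] by auto
    then show False using that e_mono[of 0 "Suc d"] Suc.prems asym unfolding cov_def by auto
  qed
  moreover have "chains d (\<lambda>v. if v = id then 1 else 0) w = (if w = id then 1 else 0)" for w
    by (rule Suc.IH) (use Suc.prems in simp)
  ultimately show ?case
    unfolding chains.simps by (cases "cov u (Suc d)") (simp_all only: if_True if_False add_0_right)
qed simp

end

section \<open>Words in the 0-Hecke monoid and a numerical Monk formula\<close>

lemma (in chain_operator) chains_sum: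
  "chains d (\<lambda>v. \<Sum>k\<in>A. c k * g k v) u = (\<Sum>k\<in>A. c k * chains d (g k) u)"
  by (induction d arbitrary: u) (simp_all add: sum.distrib distrib_left)

lemma (in chain_operator) chains_add:
  "chains d (\<lambda>v. f v + g v) u = chains d f u + chains d g u"
  by (induction d arbitrary: u) simp_all

definition left_descent :: "nat \<Rightarrow> (nat \<Rightarrow> nat) \<Rightarrow> bool" where
  "left_descent k v \<longleftrightarrow> (\<exists>p q. p < q \<and> v p = Suc k \<and> v q = k)"

text \<open>The dual of left multiplication by the letter \<open>k\<close>: by
  \<open>left_hecke_step_eq_iff\<close>, a 0-Hecke product with first letter \<open>k\<close> equals
  \<open>v\<close> exactly when \<open>v\<close> has the descent and the product of the remaining
  letters is \<open>v\<close> or \<open>tr k (Suc k) \<circ> v\<close>.\<close>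

definition left_demazure :: "nat \<Rightarrow> ((nat \<Rightarrow> nat) \<Rightarrow> rat) \<Rightarrow> (nat \<Rightarrow> nat) \<Rightarrow> rat" where
  "left_demazure k f v = (if left_descent k v then f v + f (tr k (Suc k) \<circ> v) else 0)"

definition hecke_sum :: "(nat \<Rightarrow> rat) \<Rightarrow> nat \<Rightarrow> ((nat \<Rightarrow> nat) \<Rightarrow> rat) \<Rightarrow> (nat \<Rightarrow> nat) \<Rightarrow> rat" where
  "hecke_sum wt N f v = (\<Sum>k\<in>{1..<N}. wt k * left_demazure k f v)"

text \<open>The weighted count of 0-Hecke words of length \<open>m\<close>, by recursion on the first letter, and the
coefficients (normalised as for exponential generating functions) of $e^t$ times its generating
function.\<close>

primrec hecke_weight :: "(nat \<Rightarrow> rat) \<Rightarrow> nat \<Rightarrow> nat \<Rightarrow> (nat \<Rightarrow> nat) \<Rightarrow> rat" where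
  "hecke_weight wt N 0 = (\<lambda>v. if v = id then 1 else 0)"
| "hecke_weight wt N (Suc m) = hecke_sum wt N (hecke_weight wt N m)"

primrec hecke_weight_exp :: "(nat \<Rightarrow> rat) \<Rightarrow> nat \<Rightarrow> nat \<Rightarrow> (nat \<Rightarrow> nat) \<Rightarrow> rat" where
  "hecke_weight_exp wt N 0 = (\<lambda>v. if v = id then 1 else 0)"
| "hecke_weight_exp wt N (Suc m) = (\<lambda>v. hecke_weight_exp wt N m v + hecke_sum wt N (hecke_weight_exp wt N m) v)"

definition right_chains :: "nat \<Rightarrow> nat \<Rightarrow> ((nat \<Rightarrow> nat) \<Rightarrow> rat) \<Rightarrow> (nat \<Rightarrow> nat) \<Rightarrow> rat" where
  "right_chains r N = chain_operator.chains (<) (\<lambda>d. r + d) (N - r)"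

definition left_chains :: "nat \<Rightarrow> ((nat \<Rightarrow> nat) \<Rightarrow> rat) \<Rightarrow> (nat \<Rightarrow> nat) \<Rightarrow> rat" where
  "left_chains r = chain_operator.chains (>) (\<lambda>d. r - d) (r - 1)"

lemma chain_operator_right: "chain_operator (<) (\<lambda>d. r + d) D"
proof
  fix p i :: nat assume "r + 0 < p" "p < r + i"
  then show "\<exists>c<i. p = r + c" by (intro exI[of _ "p - r"]) auto
qed auto

lemma chain_operator_left:
  assumes "1 \<le> r"
  shows "chain_operator (>) (\<lambda>d. r - d) (r - 1)"
proof
  fix p i :: nat assume "r - 0 > p" "p > r - i" "i \<le> r - 1"
  then show "\<exists>c<i. p = r - c" by (intro exI[of _ "r - p"]) auto
qed (use assms in auto)

lemma right_chains_hecke_sum: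
  assumes "1 \<le> r" "r \<le> N" "v permutes {1..N}"
  shows "right_chains r N (hecke_sum wt N f) v = hecke_sum wt N (right_chains r N f) v +
    (\<Sum>k\<in>{1..<N}. wt k * ((if v r = k \<and> r < inv v (Suc k) then 1 else 0) -
       (if v r = Suc k \<and> r < inv v k then 1 else 0))) * right_chains r N f v"
proof -
  interpret chain_operator "(<)" "\<lambda>d. r + d" "N - r" by (rule chain_operator_right)
  have inj: "inj v" using assms(3) by (rule permutes_inj)
  have ld: "left_demazure k g = dem k (Suc k) g" for k g
    by (auto simp: fun_eq_iff left_demazure_def left_descent_def dem_def desc_def)
  have img: "(\<lambda>d. r + d) ` {1..N - r} = {r<..N}"
  proof (intro equalityI subsetI)
    fix x assume "x \<in> {r<..N}"
    then show "x \<in> (\<lambda>d. r + d) ` {1..N - r}" by (intro image_eqI[of _ _ "x - r"]) auto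
  qed (use assms in auto)
  have step: "chains (N - r) (left_demazure k f) v = left_demazure k (chains (N - r) f) v +
     ((if v r = k \<and> r < inv v (Suc k) then 1 else 0) -
       (if v r = Suc k \<and> r < inv v k then 1 else 0)) * chains (N - r) f v"
    if k: "k \<in> {1..<N}" for k
  proof -
    have "inv v k \<le> N" "inv v (Suc k) \<le> N"
      using permutes_in_image[OF permutes_inv[OF assms(3)], of k]
        permutes_in_image[OF permutes_inv[OF assms(3)], of "Suc k"] k by auto
    moreover have "v (inv v k) = k" "v (inv v (Suc k)) = Suc k"
      using permutes_inverses(1)[OF assms(3)] by auto
    ultimately show ?thesis
      unfolding ld
      using chains_dem[of k "Suc k" v "inv v k" "inv v (Suc k)" "N - r" f] inj
      unfolding img by (auto simp: adj_def)
  qed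
  show ?thesis
    unfolding right_chains_def hecke_sum_def chains_sum sum_distrib_right sum.distrib[symmetric]
    by (rule sum.cong) (simp_all only: step distrib_left mult.assoc)
qed

text \<open>In the reversed order the lower one of the two values is \<open>Suc k\<close>, so the
  signs attached to \<open>v r = k\<close> and \<open>v r = Suc k\<close> are opposite to those for
  right chains.\<close>

lemma left_chains_hecke_sum:
  assumes "1 \<le> r" "r \<le> N" "v permutes {1..N}"
  shows "left_chains r (hecke_sum wt N f) v = hecke_sum wt N (left_chains r f) v +
    (\<Sum>k\<in>{1..<N}. wt k * ((if v r = Suc k \<and> inv v k < r then 1 else 0) -
       (if v r = k \<and> inv v (Suc k) < r then 1 else 0))) * left_chains r f v"
proof -
  interpret chain_operator "(>)" "\<lambda>d. r - d" "r - 1" by (rule chain_operator_left[OF assms(1)])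
  have inj: "inj v" using assms(3) by (rule permutes_inj)
  have ld: "left_demazure k g = dem (Suc k) k g" for k g
    by (auto simp: fun_eq_iff left_demazure_def left_descent_def dem_def desc_def transpose_commute)
  have img: "(\<lambda>d. r - d) ` {1..r - 1} = {1..<r}"
  proof (intro equalityI subsetI)
    fix x assume "x \<in> {1..<r}"
    then show "x \<in> (\<lambda>d. r - d) ` {1..r - 1}" by (intro image_eqI[of _ _ "r - x"]) auto
  qed (use assms in auto)
  have step: "chains (r - 1) (left_demazure k f) v = left_demazure k (chains (r - 1) f) v +
     ((if v r = Suc k \<and> inv v k < r then 1 else 0) -
       (if v r = k \<and> inv v (Suc k) < r then 1 else 0)) * chains (r - 1) f v"
    if k: "k \<in> {1..<N}" for k
  proof -
    have "1 \<le> inv v k" "1 \<le> inv v (Suc k)"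
      using permutes_in_image[OF permutes_inv[OF assms(3)], of k]
        permutes_in_image[OF permutes_inv[OF assms(3)], of "Suc k"] k by auto
    moreover have "v (inv v k) = k" "v (inv v (Suc k)) = Suc k"
      using permutes_inverses(1)[OF assms(3)] by auto
    ultimately show ?thesis
      unfolding ld
      using chains_dem[of "Suc k" k v "inv v (Suc k)" "inv v k" "r - 1" f] inj
      unfolding img by (auto simp: adj_def)
  qed
  show ?thesis
    unfolding left_chains_def hecke_sum_def chains_sum sum_distrib_right sum.distrib[symmetric]
    by (rule sum.cong) (simp_all only: step distrib_left mult.assoc)
qed

text \<open>Only here the weights of the letters matter: the two corrections differ by a telescoping sum
$k - (k - 1)$ with \<open>k = v r\<close>. The condition \<open>v N = N\<close> excludes \<open>k = N\<close>, where the first summand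
would be missing.\<close>

lemma hecke_sum_correction:
  assumes "1 \<le> r" "r < N" "v permutes {1..N}" "v N = N"
  shows "(\<Sum>k\<in>{1..<N}. of_nat k * ((if v r = k \<and> r < inv v (Suc k) then 1 else 0) -
       (if v r = Suc k \<and> r < inv v k then 1 else 0))) =
    (\<Sum>k\<in>{1..<N}. of_nat k * ((if v r = Suc k \<and> inv v k < r then 1 else 0) -
       (if v r = k \<and> inv v (Suc k) < r then 1 else 0))) + (1 :: rat)"
proof -
  have vr: "v r \<in> {1..<N}"
  proof -
    have "v r \<in> {1..N}" using permutes_in_image[OF assms(3), of r] assms by simp
    moreover have "v r \<noteq> N" using permutes_inj[OF assms(3)] assms by (metis injD less_irrefl)
    ultimately show ?thesis by auto
  qed
  have ne: "inv v k \<noteq> r" if "v r \<noteq> k" for k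
    using permutes_inverses(1)[OF assms(3), of k] that by auto
  have "(\<Sum>k\<in>{1..<N}. of_nat k * ((if v r = k \<and> r < inv v (Suc k) then 1 else 0) -
       (if v r = Suc k \<and> r < inv v k then 1 else 0))) -
    (\<Sum>k\<in>{1..<N}. of_nat k * ((if v r = Suc k \<and> inv v k < r then 1 else 0) -
       (if v r = k \<and> inv v (Suc k) < r then 1 else 0))) =
    (\<Sum>k\<in>{1..<N}. of_nat k * ((if v r = k then 1 else 0) - (if v r = Suc k then 1 else 0)) :: rat)"
    unfolding sum_subtractf[symmetric]
  proof (rule sum.cong)
    fix k
    show "of_nat k * ((if v r = k \<and> r < inv v (Suc k) then 1 else 0) -
       (if v r = Suc k \<and> r < inv v k then 1 else 0)) -
      of_nat k * ((if v r = Suc k \<and> inv v k < r then 1 else 0) -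
       (if v r = k \<and> inv v (Suc k) < r then 1 else 0)) =
      (of_nat k * ((if v r = k then 1 else 0) - (if v r = Suc k then 1 else 0)) :: rat)"
      using ne[of k] ne[of "Suc k"] by auto
  qed simp
  also have "\<dots> = (\<Sum>k\<in>{1..<N}. if k = v r then of_nat (v r) else 0) -
      (\<Sum>k\<in>{1..<N}. if k = v r - 1 then of_nat (v r - 1) else 0)"
    unfolding sum_subtractf[symmetric] using vr by (intro sum.cong) auto
  also have "\<dots> = 1"
    using vr by (cases "v r = 1") (auto simp: of_nat_diff)
  finally show ?thesis by simp
qed

text \<open>Moving \<open>hecke_sum\<close> past the two operators leaves corrections that differ by
  1, and this 1 matches the extra summand in the recursion of
  \<open>hecke_weight_exp\<close>.\<close>

theorem right_chains_hecke_weight_eq_left_chains_Psi: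
  assumes "1 \<le> r" "r < N" "v permutes {1..N}" "v N = N"
  shows "right_chains r N (hecke_weight of_nat N m) v = left_chains r (hecke_weight_exp of_nat N m) v"
  using assms(3,4)
proof (induction m arbitrary: v)
  case 0
  interpret R: chain_operator "(<)" "\<lambda>d. r + d" "N - r" by (rule chain_operator_right)
  interpret L: chain_operator "(>)" "\<lambda>d. r - d" "r - 1" by (rule chain_operator_left[OF assms(1)])
  show ?case unfolding right_chains_def left_chains_def hecke_weight.simps hecke_weight_exp.simps R.chains_indicator_id[OF order_refl]
      L.chains_indicator_id[OF order_refl] ..
next
  case (Suc m)
  interpret L: chain_operator "(>)" "\<lambda>d. r - d" "r - 1" by (rule chain_operator_left[OF assms(1)])
  have dem: "left_demazure k (right_chains r N (hecke_weight of_nat N m)) v =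
      left_demazure k (left_chains r (hecke_weight_exp of_nat N m)) v" if k: "k \<in> {1..<N}" for k
  proof (cases "left_descent k v")
    case True
    \<comment> \<open>The value \<open>N\<close> stands at position \<open>N\<close>, so it cannot
      precede the value \<open>N - 1\<close>. Hence the swapped permutation still fixes
      \<open>N\<close> and the induction hypothesis applies to it.\<close>
    have "Suc k \<noteq> N"
    proof
      assume N: "Suc k = N"
      then obtain p q where *: "p < q" "v p = N" "v q = k"
        using True unfolding left_descent_def by auto
      then have "p = N" using permutes_inj[OF Suc.prems(1)] Suc.prems(2) by (metis injD)
      then show False using * permutes_not_in[OF Suc.prems(1), of q] N by auto
    qed
    then have "(tr k (Suc k) \<circ> v) N = N" using Suc.prems(2) k by simp
    moreover have "(tr k (Suc k) \<circ> v) permutes {1..N}"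
      using Suc.prems(1) k by (intro permutes_compose[OF _ permutes_swap_id]) auto
    ultimately show ?thesis
      unfolding left_demazure_def by (simp only: Suc.IH[OF Suc.prems] Suc.IH)
  qed (simp add: left_demazure_def)
  then have hs: "hecke_sum of_nat N (right_chains r N (hecke_weight of_nat N m)) v =
      hecke_sum of_nat N (left_chains r (hecke_weight_exp of_nat N m)) v"
    unfolding hecke_sum_def by (intro sum.cong) auto
  have "left_chains r (hecke_weight_exp of_nat N (Suc m)) v =
      left_chains r (hecke_weight_exp of_nat N m) v + left_chains r (hecke_sum of_nat N (hecke_weight_exp of_nat N m)) v"
    unfolding hecke_weight_exp.simps left_chains_def by (rule L.chains_add)
  then show ?case
    unfolding hecke_weight.simps right_chains_hecke_sum[OF assms(1) less_imp_le[OF assms(2)] Suc.prems(1)]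
      left_chains_hecke_sum[OF assms(1) less_imp_le[OF assms(2)] Suc.prems(1)] hs
      hecke_sum_correction[OF assms(1,2) Suc.prems] Suc.IH[OF Suc.prems]
    by (simp add: distrib_right)
qed

section \<open>Length and the two lowest coefficients of the generating function\<close>

lemma perm_length_eq_sum_code:
  "perm_length n w = (\<Sum>i\<in>{1..n}. lehmer_code n w i)"
proof -
  have "{(i, j). 1 \<le> i \<and> i < j \<and> j \<le> n \<and> w i > w j} =
      (SIGMA i:{1..n}. {j. i < j \<and> j \<le> n \<and> w i > w j})" by auto
  then show ?thesis unfolding perm_length_def lehmer_code_def by (simp add: card_SigmaI)
qed

lemma perm_length_left_descent:
  assumes "v permutes {1..N}" "k \<in> {1..<N}" "left_descent k v"
  shows "perm_length N v = Suc (perm_length N (tr k (Suc k) \<circ> v))"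
proof -
  obtain p q where pq: "p < q" "v p = Suc k" "v q = k"
    using assms(3) unfolding left_descent_def by auto
  have bnd: "1 \<le> p" "q \<le> N"
    using permutes_in_image[OF assms(1), of p] permutes_in_image[OF assms(1), of q] pq assms(2)
    by auto
  let ?I = "\<lambda>u. {(i, j). 1 \<le> i \<and> i < j \<and> j \<le> N \<and> u i > u j}"
  have fin: "finite (?I u)" for u :: "nat \<Rightarrow> nat"
    by (rule finite_subset[of _ "{1..N} \<times> {1..N}"]) auto
  have pos: "i = p" if "v i = Suc k" for i
    using that pq permutes_inj[OF assms(1)] by (metis injD)
  have pos': "i = q" if "v i = k" for i
    using that pq permutes_inj[OF assms(1)] by (metis injD)
  have "?I v = insert (p, q) (?I (tr k (Suc k) \<circ> v))"
  proof (intro set_eqI; clarify)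
    fix i j
    have *: "tr k (Suc k) (v i) > tr k (Suc k) (v j) \<longleftrightarrow> v i > v j"
      if "\<not> (i = p \<and> j = q)" "i < j"
      using that pos[of i] pos[of j] pos'[of i] pos'[of j] pq(1)
      by (auto simp: Transposition.transpose_def)
    show "(i, j) \<in> ?I v \<longleftrightarrow> (i, j) \<in> insert (p, q) (?I (tr k (Suc k) \<circ> v))"
      using pq bnd * by (cases "i = p \<and> j = q"; cases "i < j") auto
  qed
  moreover have "(p, q) \<notin> ?I (tr k (Suc k) \<circ> v)" using pq by auto
  ultimately show ?thesis unfolding perm_length_def using fin by simp
qed

lemma left_transposition_permutes:
  assumes "v permutes {1..N}" "k \<in> {1..<N}"
  shows "(tr k (Suc k) \<circ> v) permutes {1..N}"
  using assms by (intro permutes_compose[OF _ permutes_swap_id]) auto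

lemma hecke_weight_eq_0:
  assumes "v permutes {1..N}" "m < perm_length N v"
  shows "hecke_weight wt N m v = 0"
  using assms
proof (induction m arbitrary: v)
  case 0
  have "perm_length N id = 0"
    unfolding perm_length_def by (rule card_eq_0_iff[THEN iffD2]) auto
  then show ?case using 0 by auto
next
  case (Suc m)
  have "left_demazure k (hecke_weight wt N m) v = 0" if k: "k \<in> {1..<N}" for k
  proof (cases "left_descent k v")
    case True
    have "hecke_weight wt N m v = 0" using Suc by simp
    moreover have "hecke_weight wt N m (tr k (Suc k) \<circ> v) = 0"
      by (rule Suc.IH[OF left_transposition_permutes[OF Suc.prems(1) k]])
        (use perm_length_left_descent[OF Suc.prems(1) k True] Suc.prems(2) in linarith)
    ultimately show ?thesis unfolding left_demazure_def by simp
  qed (simp add: left_demazure_def)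
  then show ?case by (simp add: hecke_sum_def)
qed

lemma left_demazure_sum:
  "left_demazure k (\<lambda>u. \<Sum>j\<in>A. c j * f j u) v = (\<Sum>j\<in>A. c j * left_demazure k (f j) v)"
  by (simp add: left_demazure_def sum.distrib distrib_left)

lemma hecke_sum_sum:
  "hecke_sum wt N (\<lambda>u. \<Sum>j\<in>A. c j * f j u) v = (\<Sum>j\<in>A. c j * hecke_sum wt N (f j) v)"
  unfolding hecke_sum_def left_demazure_sum sum_distrib_left
  by (subst sum.swap) (simp add: algebra_simps)

text \<open>\<open>hecke_weight\<close> iterates the linear operator \<open>hecke_sum\<close>, and
  \<open>hecke_weight_exp\<close> iterates the identity plus this operator.\<close>

lemma hecke_weight_exp_binomial:
  "hecke_weight_exp wt N m v = (\<Sum>j\<le>m. of_nat (m choose j) * hecke_weight wt N j v)"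
proof (induction m arbitrary: v)
  case (Suc m)
  have IH: "hecke_weight_exp wt N m = (\<lambda>v. \<Sum>j\<le>m. of_nat (m choose j) * hecke_weight wt N j v)"
    using Suc by blast
  have "(\<Sum>j\<le>Suc m. of_nat (Suc m choose j) * hecke_weight wt N j v) =
      hecke_weight wt N 0 v + (\<Sum>j\<le>m. of_nat (Suc m choose Suc j) * hecke_weight wt N (Suc j) v)"
    by (subst sum.atMost_Suc_shift) simp
  also have "\<dots> = hecke_weight wt N 0 v + (\<Sum>j\<le>m. of_nat (m choose Suc j) * hecke_weight wt N (Suc j) v) +
      (\<Sum>j\<le>m. of_nat (m choose j) * hecke_weight wt N (Suc j) v)"
    by (simp add: sum.distrib distrib_right add_ac)
  also have "hecke_weight wt N 0 v + (\<Sum>j\<le>m. of_nat (m choose Suc j) * hecke_weight wt N (Suc j) v) =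
      (\<Sum>j\<le>Suc m. of_nat (m choose j) * hecke_weight wt N j v)"
    by (subst sum.atMost_Suc_shift) simp
  also have "\<dots> = (\<Sum>j\<le>m. of_nat (m choose j) * hecke_weight wt N j v)"
    by (simp add: binomial_eq_0)
  finally show ?case
    unfolding hecke_weight_exp.simps IH hecke_sum_sum by simp
qed simp

text \<open>If $\ell$ is the length of \<open>v\<close>, these are the coefficients of $(e^t-1)^\ell$ and $(e^t-1)^{\ell+1}$
in $\sum_m$ \<open>hecke_weight\<close>${}_m(v)\, t^m/m!$.\<close>

definition reduced_coeff :: "nat \<Rightarrow> (nat \<Rightarrow> nat) \<Rightarrow> rat" where
  "reduced_coeff N v = hecke_weight of_nat N (perm_length N v) v / fact (perm_length N v)"

definition nearly_reduced_coeff :: "nat \<Rightarrow> (nat \<Rightarrow> nat) \<Rightarrow> rat" where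
  "nearly_reduced_coeff N v = hecke_weight of_nat N (Suc (perm_length N v)) v / fact (Suc (perm_length N v)) -
     of_nat (perm_length N v) / 2 * reduced_coeff N v"

text \<open>Word counts below the length vanish, so only the last one, two or three terms of the
  binomial sum survive.\<close>

lemma hecke_weight_exp_low:
  assumes "v permutes {1..N}" "perm_length N v = l"
  shows "hecke_weight_exp wt N l v = hecke_weight wt N l v"
    and "hecke_weight_exp wt N (Suc l) v = hecke_weight wt N (Suc l) v + of_nat (Suc l) * hecke_weight wt N l v"
    and "hecke_weight_exp wt N (Suc (Suc l)) v = hecke_weight wt N (Suc (Suc l)) v +
      of_nat (Suc (Suc l)) * hecke_weight wt N (Suc l) v +
      of_nat (Suc (Suc l)) * of_nat (Suc l) / 2 * hecke_weight wt N l v"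
proof -
  have z: "(\<Sum>j<l. c j * hecke_weight wt N j v) = 0" for c
    using hecke_weight_eq_0[OF assms(1)] assms(2) by simp
  have ch: "rat_of_nat (Suc (Suc l) choose l) = of_nat (Suc (Suc l)) * of_nat (Suc l) / 2"
  proof -
    have "Suc (Suc l) choose l = Suc (Suc l) choose 2"
      by (subst binomial_symmetric) auto
    then have "2 * (Suc (Suc l) choose l) = Suc (Suc l) * Suc l"
      unfolding choose_two by (simp del: binomial_Suc_Suc)
    then have "rat_of_nat (2 * (Suc (Suc l) choose l)) = of_nat (Suc (Suc l) * Suc l)" by (rule arg_cong)
    then show ?thesis unfolding of_nat_mult by simp
  qed
  have split: "{..l} = insert l {..<l}" "{..Suc l} = insert (Suc l) (insert l {..<l})"
    "{..Suc (Suc l)} = insert (Suc (Suc l)) (insert (Suc l) (insert l {..<l}))"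
    by auto
  show "hecke_weight_exp wt N l v = hecke_weight wt N l v"
    unfolding hecke_weight_exp_binomial split by (simp add: z)
  show "hecke_weight_exp wt N (Suc l) v = hecke_weight wt N (Suc l) v + of_nat (Suc l) * hecke_weight wt N l v"
    unfolding hecke_weight_exp_binomial split by (simp add: z del: binomial_Suc_Suc)
  show "hecke_weight_exp wt N (Suc (Suc l)) v = hecke_weight wt N (Suc (Suc l)) v +
      of_nat (Suc (Suc l)) * hecke_weight wt N (Suc l) v +
      of_nat (Suc (Suc l)) * of_nat (Suc l) / 2 * hecke_weight wt N l v"
    unfolding hecke_weight_exp_binomial split ch[symmetric] by (simp add: z del: binomial_Suc_Suc)
qed

lemma transition:
  assumes "1 \<le> r" "r < N" "v permutes {1..N}" "v N = N" "w' permutes {1..N}"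
    and R: "\<And>f. right_chains r N f v = f v + f w" and L: "\<And>f. left_chains r f v = f v + f w'"
    and len: "perm_length N w = Suc (perm_length N v)" "perm_length N w' = Suc (perm_length N v)"
  shows "reduced_coeff N w = reduced_coeff N v + reduced_coeff N w'" "nearly_reduced_coeff N w = nearly_reduced_coeff N v + nearly_reduced_coeff N w' + reduced_coeff N w'"
proof -
  define l where "l = perm_length N v"
  let ?F = "hecke_weight of_nat N"
  have eq: "?F m v + ?F m w = hecke_weight_exp of_nat N m v + hecke_weight_exp of_nat N m w'" for m
    using right_chains_hecke_weight_eq_left_chains_Psi[OF assms(1-4), of m] unfolding R L .
  have 1: "?F (Suc l) w = of_nat (Suc l) * ?F l v + ?F (Suc l) w'"
    using eq[of "Suc l"] hecke_weight_exp_low(2)[OF assms(3), of l] hecke_weight_exp_low(1)[OF assms(5), of "Suc l"] len l_def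
    by simp
  have 2: "?F (Suc (Suc l)) w = of_nat (Suc (Suc l)) * ?F (Suc l) v +
      of_nat (Suc (Suc l)) * of_nat (Suc l) / 2 * ?F l v + ?F (Suc (Suc l)) w' +
      of_nat (Suc (Suc l)) * ?F (Suc l) w'"
    using eq[of "Suc (Suc l)"] hecke_weight_exp_low(3)[OF assms(3), of l] hecke_weight_exp_low(2)[OF assms(5), of "Suc l"]
      len l_def by simp
  define s :: rat where "s = of_nat (Suc l)"
  define t :: rat where "t = of_nat (Suc (Suc l))"
  define g :: rat where "g = fact l"
  have nz: "s \<noteq> 0" "t \<noteq> 0" "g \<noteq> 0" unfolding s_def t_def g_def by auto
  have f: "fact (Suc l) = s * g" "fact (Suc (Suc l)) = t * (s * g)"
    unfolding s_def t_def g_def by simp_all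
  have ts: "t = s + 1" "of_nat l = s - 1" unfolding s_def t_def by simp_all
  have n0v: "reduced_coeff N v = ?F l v / g" and n1v: "nearly_reduced_coeff N v = ?F (Suc l) v / (s * g) - (s - 1) / 2 * (?F l v / g)"
    unfolding nearly_reduced_coeff_def reduced_coeff_def l_def[symmetric] f g_def[symmetric] ts by simp_all
  have n0w: "reduced_coeff N w = ?F (Suc l) w / (s * g)"
    and n1w: "nearly_reduced_coeff N w = ?F (Suc (Suc l)) w / (t * (s * g)) - s / 2 * (?F (Suc l) w / (s * g))"
    unfolding nearly_reduced_coeff_def reduced_coeff_def len l_def[symmetric] f s_def by simp_all
  have n0w': "reduced_coeff N w' = ?F (Suc l) w' / (s * g)"
    and n1w': "nearly_reduced_coeff N w' = ?F (Suc (Suc l)) w' / (t * (s * g)) - s / 2 * (?F (Suc l) w' / (s * g))"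
    unfolding nearly_reduced_coeff_def reduced_coeff_def len l_def[symmetric] f s_def by simp_all
  show "reduced_coeff N w = reduced_coeff N v + reduced_coeff N w'"
    unfolding n0v n0w n0w' 1 s_def[symmetric] using nz by (simp add: field_simps)
  \<comment> \<open>The multiple of \<open>reduced_coeff\<close> subtracted in
    \<open>nearly_reduced_coeff\<close> is larger by one half at length \<open>Suc l\<close> than at
    length \<open>l\<close>; the term \<open>?F l v / g / 2\<close> makes up for this difference in
    the case of \<open>v\<close>.\<close>
  have "?F (Suc (Suc l)) w / (t * (s * g)) = ?F (Suc l) v / (s * g) + ?F l v / g / 2 +
      ?F (Suc (Suc l)) w' / (t * (s * g)) + ?F (Suc l) w' / (s * g)"
    unfolding 2 s_def[symmetric] t_def[symmetric] using nz by (simp add: field_simps)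
  then show "nearly_reduced_coeff N w = nearly_reduced_coeff N v + nearly_reduced_coeff N w' + reduced_coeff N w'"
    unfolding n1v n1w n1w' n0w' 1 s_def[symmetric] using nz by (simp add: field_simps)
qed

text \<open>Without a cover on the left the identity of generating functions reads
  \<open>F_v + F_w = e^t F_v\<close>.\<close>

lemma transition_left_empty:
  assumes "1 \<le> r" "r < N" "v permutes {1..N}" "v N = N"
    and R: "\<And>f. right_chains r N f v = f v + f w" and L: "\<And>f. left_chains r f v = f v"
    and len: "perm_length N w = Suc (perm_length N v)"
  shows "reduced_coeff N w = reduced_coeff N v" "nearly_reduced_coeff N w = nearly_reduced_coeff N v"
proof -
  define l where "l = perm_length N v"
  let ?F = "hecke_weight of_nat N"
  have eq: "?F m v + ?F m w = hecke_weight_exp of_nat N m v" for m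
    using right_chains_hecke_weight_eq_left_chains_Psi[OF assms(1-4), of m] unfolding R L .
  have 1: "?F (Suc l) w = of_nat (Suc l) * ?F l v"
    using eq[of "Suc l"] hecke_weight_exp_low(2)[OF assms(3), of l] l_def by simp
  have 2: "?F (Suc (Suc l)) w = of_nat (Suc (Suc l)) * ?F (Suc l) v +
      of_nat (Suc (Suc l)) * of_nat (Suc l) / 2 * ?F l v"
    using eq[of "Suc (Suc l)"] hecke_weight_exp_low(3)[OF assms(3), of l] l_def by simp
  define s :: rat where "s = of_nat (Suc l)"
  define t :: rat where "t = of_nat (Suc (Suc l))"
  define g :: rat where "g = fact l"
  have nz: "s \<noteq> 0" "t \<noteq> 0" "g \<noteq> 0" unfolding s_def t_def g_def by auto
  have f: "fact (Suc l) = s * g" "fact (Suc (Suc l)) = t * (s * g)"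
    unfolding s_def t_def g_def by simp_all
  have ts: "t = s + 1" "of_nat l = s - 1" unfolding s_def t_def by simp_all
  have n0v: "reduced_coeff N v = ?F l v / g" and n1v: "nearly_reduced_coeff N v = ?F (Suc l) v / (s * g) - (s - 1) / 2 * (?F l v / g)"
    unfolding nearly_reduced_coeff_def reduced_coeff_def l_def[symmetric] f g_def[symmetric] ts by simp_all
  have n0w: "reduced_coeff N w = ?F (Suc l) w / (s * g)"
    and n1w: "nearly_reduced_coeff N w = ?F (Suc (Suc l)) w / (t * (s * g)) - s / 2 * (?F (Suc l) w / (s * g))"
    unfolding nearly_reduced_coeff_def reduced_coeff_def len l_def[symmetric] f s_def by simp_all
  show "reduced_coeff N w = reduced_coeff N v"
    unfolding n0v n0w 1 s_def[symmetric] using nz by (simp add: field_simps)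
  have "?F (Suc (Suc l)) w / (t * (s * g)) = ?F (Suc l) v / (s * g) + ?F l v / g / 2"
    unfolding 2 s_def[symmetric] t_def[symmetric] using nz by (simp add: field_simps)
  then show "nearly_reduced_coeff N w = nearly_reduced_coeff N v"
    unfolding n1v n1w 1 s_def[symmetric] using nz by (simp add: field_simps)
qed

section \<open>Lehmer codes under transpositions\<close>

text \<open>Take the last position \<open>m\<close> before \<open>b\<close>, from \<open>a\<close>
  on, whose value is below \<open>w b\<close>. All values between \<open>m\<close> and
  \<open>b\<close> exceed \<open>w m\<close>, so every inversion of \<open>m\<close> lies behind
  \<open>b\<close> and is an inversion of \<open>b\<close>; thus the code at \<open>m\<close> is at
  most that at \<open>b\<close>.\<close>

lemma less_code_imp_le:
  assumes "b \<le> N" "a \<le> c" "c < b"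
    and "\<And>c. a \<le> c \<Longrightarrow> c < b \<Longrightarrow> lehmer_code N w b < lehmer_code N w c"
  shows "w b \<le> w c"
proof (rule ccontr)
  assume "\<not> w b \<le> w c"
  define A where "A = {c. a \<le> c \<and> c < b \<and> w c < w b}"
  have "finite A" "A \<noteq> {}" unfolding A_def using assms \<open>\<not> w b \<le> w c\<close> by auto
  then have m: "Max A \<in> A" "\<And>x. x \<in> A \<Longrightarrow> x \<le> Max A" by auto
  define m where "m = Max A"
  have m1: "a \<le> m" "m < b" "w m < w b" using m(1) unfolding m_def A_def by auto
  have "{j. m < j \<and> j \<le> N \<and> w m > w j} \<subseteq> {j. b < j \<and> j \<le> N \<and> w b > w j}"
  proof (clarify, intro conjI)
    fix j assume j: "m < j" "j \<le> N" "w j < w m"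
    show "b < j"
    proof (rule ccontr)
      assume "\<not> b < j"
      then have "j < b" using j m1 by (cases "j = b") auto
      then have "j \<in> A" unfolding A_def using j m1 by auto
      then show False using m(2) j(1) unfolding m_def by fastforce
    qed
    show "w j < w b" using j m1 by simp
  qed
  then have "lehmer_code N w m \<le> lehmer_code N w b"
    unfolding lehmer_code_def by (intro card_mono) auto
  then show False using assms(4)[of m] m1 by simp
qed

text \<open>In a 132 pattern at \<open>a, b, c\<close>, let \<open>m\<close> be the last position
  from \<open>a\<close> on and before \<open>b\<close> with value below \<open>w c\<close>. Then
  \<open>Suc m\<close> has a value above \<open>w c\<close>, so it inherits all inversions of
  \<open>m\<close> and gains \<open>c\<close>: the code increases from \<open>m\<close> to
  \<open>Suc m\<close>.\<close>

lemma code_antimono_avoids: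
  assumes inj: "inj w"
    and anti: "\<And>i j. R \<le> i \<Longrightarrow> i \<le> j \<Longrightarrow> j \<le> N \<Longrightarrow> lehmer_code N w j \<le> lehmer_code N w i"
    and "R \<le> a" "a < b" "b < c" "c \<le> N" "w a < w c"
  shows "w b < w c"
proof (rule ccontr)
  assume bc: "\<not> w b < w c"
  define A where "A = {a'. a \<le> a' \<and> a' < b \<and> w a' < w c}"
  have "finite A" "A \<noteq> {}" unfolding A_def using assms by auto
  then have m: "Max A \<in> A" "\<And>x. x \<in> A \<Longrightarrow> x \<le> Max A" by auto
  define m where "m = Max A"
  have m1: "a \<le> m" "m < b" "w m < w c" using m(1) unfolding m_def A_def by auto
  have "Suc m \<notin> A" using m(2)[of "Suc m"] unfolding m_def by auto
  then have "w c \<le> w (Suc m)" using m1 bc unfolding A_def by (cases "Suc m = b") auto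
  moreover have "Suc m \<noteq> c" using m1 assms(5) by simp
  then have "w (Suc m) \<noteq> w c" using inj by (metis injD)
  ultimately have m2: "w c < w (Suc m)" by simp
  have "insert c {j. m < j \<and> j \<le> N \<and> w m > w j} \<subseteq>
      {j. Suc m < j \<and> j \<le> N \<and> w (Suc m) > w j}"
  proof (rule insert_subsetI)
    show "c \<in> {j. Suc m < j \<and> j \<le> N \<and> w (Suc m) > w j}" using m1 m2 assms by auto
    show "{j. m < j \<and> j \<le> N \<and> w m > w j} \<subseteq> {j. Suc m < j \<and> j \<le> N \<and> w (Suc m) > w j}"
    proof (clarify, intro conjI)
      fix j assume j: "m < j" "j \<le> N" "w j < w m"
      then have "j \<noteq> Suc m" using m1 m2 by auto
      then show "Suc m < j" using j by simp
      show "w j < w (Suc m)" using j m1 m2 by simp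
    qed
  qed
  then have "card (insert c {j. m < j \<and> j \<le> N \<and> w m > w j}) \<le> lehmer_code N w (Suc m)"
    unfolding lehmer_code_def by (intro card_mono) auto
  moreover have "card (insert c {j. m < j \<and> j \<le> N \<and> w m > w j}) = Suc (lehmer_code N w m)"
    unfolding lehmer_code_def using m1 by (subst card_insert_disjoint) auto
  moreover have "lehmer_code N w (Suc m) \<le> lehmer_code N w m"
    using m1 assms(3-6) by (intro anti) auto
  ultimately show False by simp
qed

text \<open>Otherwise \<open>R\<close> itself and all inversions of \<open>R\<close> would be
  inversions of \<open>i\<close>, making the code at \<open>i\<close> the larger one.\<close>

lemma code_le_imp_less:
  assumes "inj w" "i < R" "R \<le> N" "lehmer_code N w i \<le> lehmer_code N w R"
    and "\<And>c. i < c \<Longrightarrow> c < R \<Longrightarrow> w R < w c"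
  shows "w i < w R"
proof (rule ccontr)
  assume "\<not> w i < w R"
  moreover have "w i \<noteq> w R" using assms(1,2) by (metis injD less_irrefl)
  ultimately have less: "w R < w i" by simp
  have "insert R {j. R < j \<and> j \<le> N \<and> w R > w j} \<subseteq> {j. i < j \<and> j \<le> N \<and> w i > w j}"
    using less assms(2,3) by auto
  then have "card (insert R {j. R < j \<and> j \<le> N \<and> w R > w j}) \<le> lehmer_code N w i"
    unfolding lehmer_code_def by (intro card_mono) auto
  moreover have "card (insert R {j. R < j \<and> j \<le> N \<and> w R > w j}) = Suc (lehmer_code N w R)"
    unfolding lehmer_code_def by (subst card_insert_disjoint) auto
  ultimately show False using assms(4) by simp
qed

lemma code_zero_imp_less:
  assumes "inj w" "i < c" "c \<le> N" "lehmer_code N w i = 0"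
  shows "w i < w c"
proof -
  have "{j. i < j \<and> j \<le> N \<and> w i > w j} = {}"
    using assms(4) unfolding lehmer_code_def by (subst (asm) card_0_eq) auto
  then have "\<not> w c < w i" using assms by auto
  moreover have "w i \<noteq> w c" using assms(1,2) by (metis injD less_irrefl)
  ultimately show ?thesis by simp
qed

lemma code_transposition_before:
  assumes "R \<le> N" "s \<le> N" "p < R" "p < s"
  shows "lehmer_code N (w \<circ> tr R s) p = lehmer_code N w p"
proof -
  let ?t = "tr R s"
  have tp: "?t p = p" using assms by (intro transpose_apply_other) auto
  have "{j. p < j \<and> j \<le> N \<and> w p > w (?t j)} = ?t ` {j. p < j \<and> j \<le> N \<and> w p > w j}"
  proof (intro equalityI subsetI)
    fix j assume "j \<in> {j. p < j \<and> j \<le> N \<and> w p > w (?t j)}"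
    then show "j \<in> ?t ` {j. p < j \<and> j \<le> N \<and> w p > w j}"
      using assms by (intro image_eqI[of _ _ "?t j"]) (auto simp: Transposition.transpose_def)
  next
    fix j assume "j \<in> ?t ` {j. p < j \<and> j \<le> N \<and> w p > w j}"
    then show "j \<in> {j. p < j \<and> j \<le> N \<and> w p > w (?t j)}"
      using assms by (auto simp: Transposition.transpose_def)
  qed
  then show ?thesis
    unfolding lehmer_code_def o_apply tp by (simp add: card_image)
qed

text \<open>By \<open>gap\<close>, every other position behind \<open>R\<close> compares alike with
  \<open>w s\<close> and \<open>w R\<close>, so the pair at \<open>R\<close> and \<open>s\<close> is
  the only inversion lost.\<close>

lemma code_lower_transposition:
  assumes "inj w" "R < s" "s \<le> N" "w s < w R"
    and gap: "\<And>c. R < c \<Longrightarrow> c \<le> N \<Longrightarrow> \<not> (w s < w c \<and> w c < w R)"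
  shows "lehmer_code N (w \<circ> tr R s) = (lehmer_code N w)(R := lehmer_code N w R - 1)"
proof
  fix p
  let ?v = "w \<circ> tr R s"
  have vR: "?v R = w s" and vs: "?v s = w R" and v: "\<And>c. c \<noteq> R \<Longrightarrow> c \<noteq> s \<Longrightarrow> ?v c = w c"
    by auto
  have neq: "w c \<noteq> w s" if "c \<noteq> s" for c using that assms(1) by (metis injD)
  have neq': "w c \<noteq> w R" if "c \<noteq> R" for c using that assms(1) by (metis injD)
  have iff: "w c < w s \<longleftrightarrow> w c < w R" if "R < c" "c \<le> N" "c \<noteq> s" for c
    using gap[OF that(1,2)] neq[OF that(3)] assms(4) by auto
  consider "p < R" | "p = R" | "R < p" "p < s" | "p = s" | "s < p" by linarith
  then show "lehmer_code N ?v p = ((lehmer_code N w)(R := lehmer_code N w R - 1)) p"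
  proof cases
    case 1
    then show ?thesis using assms code_transposition_before[of R N s p w] by simp
  next
    case 2
    have "{j. R < j \<and> j \<le> N \<and> ?v R > ?v j} = {j. R < j \<and> j \<le> N \<and> w R > w j} - {s}"
    proof (intro set_eqI iffI)
      fix j assume j: "j \<in> {j. R < j \<and> j \<le> N \<and> ?v R > ?v j}"
      then have "j \<noteq> s" using vR vs assms(4) by auto
      then show "j \<in> {j. R < j \<and> j \<le> N \<and> w R > w j} - {s}" using j v[of j] vR iff[of j] by auto
    next
      fix j assume "j \<in> {j. R < j \<and> j \<le> N \<and> w R > w j} - {s}"
      then show "j \<in> {j. R < j \<and> j \<le> N \<and> ?v R > ?v j}" using v[of j] vR iff[of j] by auto
    qed
    then show ?thesis using 2 assms unfolding lehmer_code_def by (simp add: card_Diff_singleton)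
  next
    case 3
    have "{j. p < j \<and> j \<le> N \<and> ?v p > ?v j} = {j. p < j \<and> j \<le> N \<and> w p > w j}"
    proof (intro set_eqI)
      fix j
      show "j \<in> {j. p < j \<and> j \<le> N \<and> ?v p > ?v j} \<longleftrightarrow> j \<in> {j. p < j \<and> j \<le> N \<and> w p > w j}"
        using 3 v[of p] v[of j] vs iff[of p] neq[of p] neq'[of p] assms(2,3) by (cases "j = s") auto
    qed
    then show ?thesis using 3 unfolding lehmer_code_def by simp
  next
    case 4
    have "{j. p < j \<and> j \<le> N \<and> ?v p > ?v j} = {j. p < j \<and> j \<le> N \<and> w p > w j}"
    proof (intro set_eqI)
      fix j
      show "j \<in> {j. p < j \<and> j \<le> N \<and> ?v p > ?v j} \<longleftrightarrow> j \<in> {j. p < j \<and> j \<le> N \<and> w p > w j}"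
        using 4 v[of j] vs iff[of j] assms(2,3) by auto
    qed
    then show ?thesis using 4 assms(2) unfolding lehmer_code_def by simp
  next
    case 5
    then show ?thesis using assms(2) unfolding lehmer_code_def by (auto intro!: arg_cong[of _ _ card])
  qed
qed

text \<open>The values between \<open>i\<close> and \<open>R\<close> exceed both exchanged values,
  so the inversions of \<open>i\<close> and of \<open>R\<close> all lie behind \<open>R\<close>. The
  two codes therefore travel with their values, and the new inversion adds 1 at
  \<open>i\<close>.\<close>

lemma code_raise_transposition:
  assumes "i < R" "R \<le> N" "v i < v R" and between: "\<And>c. i < c \<Longrightarrow> c < R \<Longrightarrow> v R < v c"
  shows "lehmer_code N (v \<circ> tr R i) =
    (lehmer_code N v)(i := Suc (lehmer_code N v R), R := lehmer_code N v i)"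
proof
  fix p
  let ?u = "v \<circ> tr R i"
  have uR: "?u R = v i" and ui: "?u i = v R" and u: "\<And>c. c \<noteq> R \<Longrightarrow> c \<noteq> i \<Longrightarrow> ?u c = v c"
    by auto
  consider "p < i" | "p = i" | "i < p" "p < R" | "p = R" | "R < p" by linarith
  then show "lehmer_code N ?u p =
      ((lehmer_code N v)(i := Suc (lehmer_code N v R), R := lehmer_code N v i)) p"
  proof cases
    case 1
    then show ?thesis using assms code_transposition_before[of R N i p v] by simp
  next
    case 2
    have "{j. i < j \<and> j \<le> N \<and> ?u i > ?u j} = insert R {j. R < j \<and> j \<le> N \<and> v R > v j}"
    proof (intro set_eqI)
      fix j
      show "j \<in> {j. i < j \<and> j \<le> N \<and> ?u i > ?u j} \<longleftrightarrow> j \<in> insert R {j. R < j \<and> j \<le> N \<and> v R > v j}"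
        using assms(1-3) between[of j] u[of j] uR ui
        by (cases "j = R"; cases "j = i"; cases "j < R") auto
    qed
    then show ?thesis using 2 assms unfolding lehmer_code_def by (simp add: card_insert_disjoint)
  next
    case 3
    have "{j. p < j \<and> j \<le> N \<and> ?u p > ?u j} = {j. p < j \<and> j \<le> N \<and> v p > v j}"
    proof (intro set_eqI)
      fix j
      show "j \<in> {j. p < j \<and> j \<le> N \<and> ?u p > ?u j} \<longleftrightarrow> j \<in> {j. p < j \<and> j \<le> N \<and> v p > v j}"
        using 3 assms(1-3) between[of p] u[of p] u[of j] uR by (cases "j = R") auto
    qed
    then show ?thesis using 3 unfolding lehmer_code_def by simp
  next
    case 4
    have "{j. R < j \<and> j \<le> N \<and> ?u R > ?u j} = {j. i < j \<and> j \<le> N \<and> v i > v j}"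
    proof (intro set_eqI)
      fix j
      show "j \<in> {j. R < j \<and> j \<le> N \<and> ?u R > ?u j} \<longleftrightarrow> j \<in> {j. i < j \<and> j \<le> N \<and> v i > v j}"
        using 4 assms(1-3) between[of j] u[of j] uR
        by (cases "j = R"; cases "j < R") auto
    qed
    then show ?thesis using 4 assms(1) unfolding lehmer_code_def by simp
  next
    case 5
    then show ?thesis using assms(1) unfolding lehmer_code_def by (auto intro!: arg_cong[of _ _ card])
  qed
qed

section \<open>Permutations whose chain sums have at most one cover\<close>

text \<open>Let \<open>s\<close> carry the largest value below \<open>w R\<close> to the right of
  \<open>R\<close>, and swap. The only cover of the result \<open>v\<close> is the one back to
  \<open>w\<close>: between \<open>R\<close> and \<open>s\<close> all values lie below
  \<open>v R\<close>, since the weakly decreasing codes of \<open>v\<close> from \<open>R\<close> on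
  exclude 132 patterns, and behind \<open>s\<close> every value above \<open>v R\<close> also
  exceeds \<open>v s\<close>, so \<open>s\<close> blocks it.\<close>

lemma exists_code_decrement:
  assumes perm: "w permutes {1..N}" and wN: "w N = N" and R: "1 \<le> R" "R \<le> N"
    and code: "lehmer_code N w R = Suc m"
    and anti: "\<And>i j. R < i \<Longrightarrow> i \<le> j \<Longrightarrow> j \<le> N \<Longrightarrow> lehmer_code N w j \<le> lehmer_code N w i"
    and le: "\<And>i. R < i \<Longrightarrow> i \<le> N \<Longrightarrow> lehmer_code N w i \<le> m"
  shows "\<exists>v. v permutes {1..N} \<and> v N = N \<and> R < N \<and>
    lehmer_code N v = (lehmer_code N w)(R := m) \<and> (\<forall>f. right_chains R N f v = f v + f w)"
proof -
  have inj: "inj w" using perm by (rule permutes_inj)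
  define A where "A = {j. R < j \<and> j \<le> N \<and> w R > w j}"
  have fin: "finite A" unfolding A_def by auto
  have "A \<noteq> {}" using code unfolding lehmer_code_def A_def by (metis card.empty nat.distinct(1))
  then have "Max (w ` A) \<in> w ` A" using fin by (intro Max_in) auto
  then obtain s where s0: "s \<in> A" "w s = Max (w ` A)" by auto
  then have s: "s \<in> A" "\<And>j. j \<in> A \<Longrightarrow> w j \<le> w s" using fin by auto
  have s1: "R < s" "s \<le> N" "w s < w R" using s(1) unfolding A_def by auto
  have gap: "\<not> (w s < w c \<and> w c < w R)" if "R < c" "c \<le> N" for c
    using s(2)[of c] that unfolding A_def by auto
  define v where "v = w \<circ> tr R s"
  have vR: "v R = w s" and vs: "v s = w R" and v: "\<And>c. c \<noteq> R \<Longrightarrow> c \<noteq> s \<Longrightarrow> v c = w c"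
    unfolding v_def by auto
  have vperm: "v permutes {1..N}"
    unfolding v_def using s1 R by (intro permutes_compose[OF permutes_swap_id perm]) auto
  have injv: "inj v" using vperm by (rule permutes_inj)
  have wR: "w R \<le> N" using permutes_in_image[OF perm, of R] R by auto
  then have "s \<noteq> N" using s1 wN by auto
  then have vN: "v N = N" using v[of N] wN s1 by auto
  have cv: "lehmer_code N v = (lehmer_code N w)(R := m)"
    using code_lower_transposition[OF inj s1 gap] code unfolding v_def by simp
  have vanti: "lehmer_code N v j \<le> lehmer_code N v i" if "R \<le> i" "i \<le> j" "j \<le> N" for i j
    using that anti[of i j] le[of j] unfolding cv by auto
  have small: "v c < v R" if "R < c" "c < s" for c
  proof -
    have "v c < v s" using code_antimono_avoids[OF injv vanti, of R R c s] that s1 vR vs by simp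
    then show ?thesis using gap[of c] v[of c] vR vs that s1 injD[OF inj, of c s] by fastforce
  qed
  interpret chain_operator "(<)" "\<lambda>d. R + d" "N - R" by (rule chain_operator_right)
  have "right_chains R N f v = f v + f w" for f
  proof -
    have w: "v \<circ> tr (R + 0) (R + (s - R)) = w"
      unfolding v_def using s1 by (simp add: comp_assoc)
    have "chains (N - R) f v = f v + f (v \<circ> tr (R + 0) (R + (s - R)))"
    proof (rule chains_one_cover)
      show "cov v (s - R)" unfolding cov_def
      proof (intro conjI allI impI)
        fix c assume c: "0 < c \<and> c < s - R"
        then have "R + c < s" by linarith
        with c show "\<not> (v (R + 0) < v (R + c) \<and> v (R + c) < v (R + (s - R)))"
          using small[of "R + c"] by auto
      qed (use s1 vR vs in auto)
    next
      fix c assume c: "0 < c" "c \<le> N - R" "c \<noteq> s - R"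
      show "\<not> cov v c"
      proof (cases "c < s - R")
        case True
        then have "R + c < s" by linarith
        then show ?thesis using small[of "R + c"] c unfolding cov_def by auto
      next
        case False
        then have c': "s < R + c" "R + c \<le> N" using c s1 by auto
        have "v R < v s \<and> v s < v (R + c)" if "v R < v (R + c)"
          using that gap[of "R + c"] c' v[of "R + c"] vR vs s1 injD[OF inj, of "R + c" R] by fastforce
        moreover have "0 < s - R" "s - R < c" "R + (s - R) = s" using c' s1 by auto
        ultimately show ?thesis unfolding cov_def by (metis add_0_right)
      qed
    next
      fix c assume c: "0 < c" "c < s - R"
      then have "R + c < s" by linarith
      with c show "\<not> cov (v \<circ> tr (R + 0) (R + (s - R))) c"
        unfolding w cov_def using small[of "R + c"] v[of "R + c"] vR s1 by auto
    qed (use s1 in auto)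
    then show ?thesis unfolding right_chains_def w .
  qed
  then show ?thesis using vperm vN cv s1 by auto
qed

text \<open>Values between \<open>i\<close> and \<open>R\<close> are too large to be swapped with
  \<open>v R\<close>, before or after the swap with \<open>i\<close>; the values in front of
  \<open>i\<close> are blocked by \<open>v i\<close>.\<close>

lemma left_chains_one_cover:
  assumes "1 \<le> i" "i < R" "v i < v R" and between: "\<And>c. i < c \<Longrightarrow> c < R \<Longrightarrow> v R < v c"
    and before: "\<And>c. 1 \<le> c \<Longrightarrow> c < i \<Longrightarrow> v c < v i"
  shows "left_chains R f v = f v + f (v \<circ> tr R i)"
proof -
  have R: "1 \<le> R" using assms by simp
  interpret chain_operator "(>)" "\<lambda>d. R - d" "R - 1" by (rule chain_operator_left[OF R])
  have t: "R - 0 = R" "R - (R - i) = i" using assms by auto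
  have "chains (R - 1) f v = f v + f (v \<circ> tr (R - 0) (R - (R - i)))"
  proof (rule chains_one_cover)
    show "cov v (R - i)" unfolding cov_def t
    proof (intro conjI allI impI)
      fix c assume c: "0 < c \<and> c < R - i"
      then have "i < R - c" "R - c < R" using assms(2) by linarith+
      then show "\<not> (v R > v (R - c) \<and> v (R - c) > v i)" using between[of "R - c"] by auto
    qed (use assms in auto)
  next
    fix c assume c: "0 < c" "c \<le> R - 1" "c \<noteq> R - i"
    show "\<not> cov v c"
    proof (cases "c < R - i")
      case True
      then have "i < R - c" "R - c < R" using c assms(2) by linarith+
      then show ?thesis using between[of "R - c"] unfolding cov_def by auto
    next
      case False
      then have c': "R - i < c" "R - c < i" "1 \<le> R - c" using c R assms by auto
      then show ?thesis using before[of "R - c"] assms t unfolding cov_def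
        by (metis diff_zero zero_less_diff)
    qed
  next
    fix c assume c: "0 < c" "c < R - i"
    then have "i < R - c" "R - c < R" using assms(2) by linarith+
    then show "\<not> cov (v \<circ> tr (R - 0) (R - (R - i))) c"
      unfolding cov_def t using between[of "R - c"] assms(3) by auto
  qed (use assms in auto)
  then show ?thesis unfolding left_chains_def t .
qed

lemma left_chains_no_cover:
  assumes "1 \<le> R" "\<And>c. 1 \<le> c \<Longrightarrow> c < R \<Longrightarrow> v R < v c"
  shows "left_chains R f v = f v"
proof -
  interpret chain_operator "(>)" "\<lambda>d. R - d" "R - 1" by (rule chain_operator_left[OF assms(1)])
  show ?thesis unfolding left_chains_def
  proof (rule chains_no_cover)
    fix c assume "0 < c" "c \<le> R - 1"
    then have "1 \<le> R - c" "R - c < R" using assms(1) by linarith+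
    then show "\<not> cov v c" using assms(2)[of "R - c"] unfolding cov_def by auto
  qed
qed

section \<open>Evaluation at shifted dominant permutations\<close>

definition subshapes :: "(nat \<Rightarrow> nat) \<Rightarrow> (nat \<Rightarrow> nat) set" where
  "subshapes lam = {mu. antimono mu \<and> (\<forall>i. mu i \<le> lam i)}"

primrec chain_count :: "nat \<Rightarrow> (nat \<Rightarrow> nat) \<Rightarrow> rat" where
  "chain_count 0 lam = 1"
| "chain_count (Suc x) lam = (\<Sum>mu\<in>subshapes lam. chain_count x mu)"

primrec chain_stat :: "((nat \<Rightarrow> nat) \<Rightarrow> rat) \<Rightarrow> nat \<Rightarrow> (nat \<Rightarrow> nat) \<Rightarrow> rat" where
  "chain_stat st 0 lam = 0"
| "chain_stat st (Suc x) lam =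
     (\<Sum>mu\<in>subshapes lam. chain_stat st x mu + st mu * chain_count x mu)"

definition corners :: "(nat \<Rightarrow> nat) \<Rightarrow> rat" where
  "corners mu = of_nat (card {i. mu (Suc i) < mu i})"

lemma finite_subshapes:
  assumes "\<And>i. r \<le> i \<Longrightarrow> lam i = 0"
  shows "finite (subshapes lam)"
proof (rule finite_subset)
  show "subshapes lam \<subseteq> {f. \<forall>i. (i \<in> {..<r} \<longrightarrow> f i \<in> {..Max (lam ` {..<r})}) \<and> (i \<notin> {..<r} \<longrightarrow> f i = 0)}"
  proof (intro subsetI CollectI allI conjI impI)
    fix f i assume f: "f \<in> subshapes lam" and i: "i \<in> {..<r}"
    have "f i \<le> lam i" using f by (simp add: subshapes_def)
    also have "\<dots> \<le> Max (lam ` {..<r})" using i by (intro Max_ge) auto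
    finally show "f i \<in> {..Max (lam ` {..<r})}" by simp
  next
    fix f i assume f: "f \<in> subshapes lam" and i: "i \<notin> {..<r}"
    have "f i \<le> lam i" using f by (simp add: subshapes_def)
    then show "f i = 0" using assms[of i] i by simp
  qed
qed (rule finite_set_of_finite_funs; simp)

lemma perm_length_eq_0_imp_id:
  assumes "w permutes {1..N}" "perm_length N w = 0"
  shows "w = id"
proof -
  have fin: "finite {(i, j). 1 \<le> i \<and> i < j \<and> j \<le> N \<and> w i > w j}"
    by (rule finite_subset[of _ "{1..N} \<times> {1..N}"]) auto
  then have "{(i, j). 1 \<le> i \<and> i < j \<and> j \<le> N \<and> w i > w j} = {}"
    using assms(2) unfolding perm_length_def by simp
  then have "\<not> w j < w i" if "1 \<le> i" "i < j" "j \<le> N" for i j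
    using that by blast
  then have mono: "w i < w j" if "1 \<le> i" "i < j" "j \<le> N" for i j
    using that permutes_inj[OF assms(1)] by (metis injD linorder_neqE_nat less_irrefl)
  have "i \<le> w i" if "i \<in> {1..N}" for i
    using that
  proof (induction i)
    case (Suc i)
    then show ?case using mono[of i "Suc i"] permutes_in_image[OF assms(1), of "Suc i"]
      by (cases "i = 0") (auto simp: Suc_le_eq intro: le_less_trans)
  qed simp
  then show ?thesis using permutes_natset_ge[OF assms(1)] by auto
qed

lemma coeff_id: "reduced_coeff N id = 1" "nearly_reduced_coeff N id = 0"
proof -
  have l: "perm_length N id = 0"
    unfolding perm_length_def by (rule card_eq_0_iff[THEN iffD2]) auto
  have "left_demazure k f id = 0" for k f
    by (auto simp: left_demazure_def left_descent_def)
  then show "reduced_coeff N id = 1" "nearly_reduced_coeff N id = 0"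
    unfolding reduced_coeff_def nearly_reduced_coeff_def l by (simp_all add: hecke_sum_def del: id_apply)
qed

lemma perm_length_code_update:
  assumes "lehmer_code N w = (lehmer_code N v)(R := Suc (lehmer_code N v R))" "R \<in> {1..N}"
  shows "perm_length N w = Suc (perm_length N v)"
proof -
  have "(\<Sum>i\<in>{1..N} - {R}. ((lehmer_code N v)(R := Suc (lehmer_code N v R))) i) =
      (\<Sum>i\<in>{1..N} - {R}. lehmer_code N v i)"
    by (rule sum.cong) auto
  then show ?thesis
    unfolding perm_length_eq_sum_code assms(1) sum.remove[OF finite_atLeastAtMost assms(2)] by simp
qed

lemma code_pos_imp_less: "0 < lehmer_code N w R \<Longrightarrow> R < N"
  unfolding lehmer_code_def card_gt_0_iff by auto

text \<open>The boxes are removed one by one from the last row. In front of that row all codes are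
  larger than the shortened one, hence so are the values; there is no cover on the left and each
  step preserves both coefficients.\<close>

lemma coeff_dominant:
  assumes "w permutes {1..N}" "w N = N" "antimono lam" "\<And>i. r \<le> i \<Longrightarrow> lam i = 0"
    and "\<And>i. lehmer_code N w (Suc i) = lam i"
  shows "reduced_coeff N w = 1 \<and> nearly_reduced_coeff N w = 0"
  using assms
proof (induction "perm_length N w" arbitrary: w lam)
  case 0
  have "w = id" using 0 by (intro perm_length_eq_0_imp_id[of w N]) auto
  then show ?case by (simp only: coeff_id)
next
  case (Suc l)
  have anti: "lam j \<le> lam i" if "i \<le> j" for i j using Suc.prems(3) that by (auto dest: antimonoD)
  have "\<exists>i. lam i \<noteq> 0"
  proof (rule ccontr)
    assume "\<nexists>i. lam i \<noteq> 0"
    then have "lehmer_code N w i = 0" if "i \<in> {1..N}" for i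
      using that Suc.prems(5)[of "i - 1"] by simp
    then show False using Suc.hyps(2) unfolding perm_length_eq_sum_code by simp
  qed
  then obtain i0 where "lam i0 \<noteq> 0" ..
  \<comment> \<open>Rows are counted from 0 and positions from 1, so the last nonzero row
    \<open>p\<close> sits at position \<open>Suc p\<close>.\<close>
  define p where "p = (GREATEST i. lam i \<noteq> 0)"
  have bound: "i \<le> r" if "lam i \<noteq> 0" for i using Suc.prems(4)[of i] that by (cases "r \<le> i") auto
  have p: "lam p \<noteq> 0" unfolding p_def
    by (rule GreatestI_nat[of "\<lambda>i. lam i \<noteq> 0" i0 r]) (use bound \<open>lam i0 \<noteq> 0\<close> in auto)
  have p0: "lam i = 0" if "p < i" for i
    using Greatest_le_nat[of "\<lambda>i. lam i \<noteq> 0" i r] bound that unfolding p_def by fastforce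
  obtain m where m: "lam p = Suc m" using p by (cases "lam p") auto
  have RN: "Suc p < N" using code_pos_imp_less[of N w "Suc p"] Suc.prems(5) m by simp
  have after: "lehmer_code N w i = 0" if "Suc p < i" for i
    using Suc.prems(5)[of "i - 1"] p0[of "i - 1"] that by simp
  have "\<exists>v. v permutes {1..N} \<and> v N = N \<and> Suc p < N \<and>
    lehmer_code N v = (lehmer_code N w)(Suc p := m) \<and> (\<forall>f. right_chains (Suc p) N f v = f v + f w)"
    by (rule exists_code_decrement) (use Suc.prems RN m after in auto)
  then obtain v where v: "v permutes {1..N}" "v N = N"
    and cv: "lehmer_code N v = (lehmer_code N w)(Suc p := m)"
    and right_chains: "\<And>f. right_chains (Suc p) N f v = f v + f w" by auto
  have inj: "inj v" using v(1) by (rule permutes_inj)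
  have "v (Suc p) < v c" if "1 \<le> c" "c < Suc p" for c
  proof -
    have "v (Suc p) \<le> v c"
    proof (rule less_code_imp_le[of "Suc p" N 1])
      fix c assume "1 \<le> c" "c < Suc p"
      moreover from this have "c - 1 \<le> p" by linarith
      ultimately show "lehmer_code N v (Suc p) < lehmer_code N v c"
        using Suc.prems(5)[of "c - 1"] anti[of "c - 1" p] m unfolding cv by auto
    qed (use RN that in auto)
    moreover have "v (Suc p) \<noteq> v c" using inj that by (metis injD less_irrefl)
    ultimately show ?thesis by simp
  qed
  then have left_chains: "left_chains (Suc p) f v = f v" for f by (intro left_chains_no_cover) auto
  have len: "perm_length N w = Suc (perm_length N v)"
    by (rule perm_length_code_update[of _ _ _ "Suc p"])
      (use cv m Suc.prems(5)[of p] RN in \<open>auto simp: fun_eq_iff\<close>)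
  have "reduced_coeff N v = 1 \<and> nearly_reduced_coeff N v = 0"
  proof (rule Suc.hyps(1))
    show "l = perm_length N v" using len Suc.hyps(2) by simp
    show "antimono (lam(p := m))"
      using anti p0 m by (auto intro!: antimonoI simp: le_Suc_eq) (metis Suc_leD)
    show "lehmer_code N v (Suc i) = (lam(p := m)) i" for i
      unfolding cv using Suc.prems(5) by simp
  qed (use v Suc.prems(4) p in auto)
  then show ?case
    using transition_left_empty[of "Suc p" N v w] RN v Suc.prems(1) right_chains left_chains len by auto
qed

text \<open>The Lehmer codes met on the way from $1^{x+1} \times w_\lambda$ to $1^x \times w_\mu$ for \<open>\<mu> \<subseteq> \<lambda>\<close>: rows
\<open>\<ge> p\<close> have their final lengths, row \<open>p\<close> is parked at position \<open>x + 1\<close>, and the rows above still have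
their original lengths. A transition at the last original row either shortens it by one box or
exchanges it with the parked row.\<close>

definition stage :: "nat \<Rightarrow> nat \<Rightarrow> (nat \<Rightarrow> nat) \<Rightarrow> (nat \<Rightarrow> nat) \<Rightarrow> nat \<Rightarrow> nat" where
  "stage x p lam mu i = (if i \<le> x then 0 else if i = Suc x then mu p
     else if i < Suc (Suc (x + p)) then lam (i - Suc (Suc x)) else mu (i - Suc x))"

definition subshapes_from :: "nat \<Rightarrow> (nat \<Rightarrow> nat) \<Rightarrow> (nat \<Rightarrow> nat) \<Rightarrow> (nat \<Rightarrow> nat) set" where
  "subshapes_from p lam mu = {nu \<in> subshapes lam. \<forall>i\<ge>p. nu i = mu i}"

definition stage_count :: "nat \<Rightarrow> nat \<Rightarrow> (nat \<Rightarrow> nat) \<Rightarrow> (nat \<Rightarrow> nat) \<Rightarrow> rat" where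
  "stage_count x p lam mu = (\<Sum>nu\<in>subshapes_from p lam mu. chain_count x nu)"

text \<open>Corners in rows from \<open>p\<close> on are left out: a corner in row \<open>i\<close>
  is accounted for by the transition that parks row \<open>i\<close>, and these rows have been
  parked before stage \<open>p\<close>.\<close>

definition stage_stat :: "nat \<Rightarrow> nat \<Rightarrow> (nat \<Rightarrow> nat) \<Rightarrow> (nat \<Rightarrow> nat) \<Rightarrow> rat" where
  "stage_stat x p lam mu = (\<Sum>nu\<in>subshapes_from p lam mu.
     chain_stat corners x nu + of_nat (card {i. i < p \<and> nu (Suc i) < nu i}) * chain_count x nu)"

lemma sum_subshapes_from_Suc:
  assumes "\<And>i. r \<le> i \<Longrightarrow> lam i = 0"
  shows "(\<Sum>nu\<in>subshapes_from (Suc p) lam mu. f nu) =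
    (\<Sum>m\<in>{mu (Suc p)..lam p}. \<Sum>nu\<in>subshapes_from p lam (mu(p := m)). f nu)"
proof -
  have fin: "finite (subshapes_from p lam mu)" for p mu
    unfolding subshapes_from_def using finite_subshapes[OF assms] by auto
  have "subshapes_from (Suc p) lam mu = (\<Union>m\<in>{mu (Suc p)..lam p}. subshapes_from p lam (mu(p := m)))"
  proof (intro equalityI subsetI)
    fix nu assume nu: "nu \<in> subshapes_from (Suc p) lam mu"
    then have "nu (Suc p) = mu (Suc p)" "antimono nu" "nu p \<le> lam p"
      unfolding subshapes_from_def subshapes_def by auto
    then have "nu p \<in> {mu (Suc p)..lam p}" by (metis antimonoD atLeastAtMost_iff lessI less_imp_le)
    moreover have "nu \<in> subshapes_from p lam (mu(p := nu p))"
      using nu unfolding subshapes_from_def by auto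
    ultimately show "nu \<in> (\<Union>m\<in>{mu (Suc p)..lam p}. subshapes_from p lam (mu(p := m)))" by blast
  next
    fix nu assume "nu \<in> (\<Union>m\<in>{mu (Suc p)..lam p}. subshapes_from p lam (mu(p := m)))"
    then show "nu \<in> subshapes_from (Suc p) lam mu" unfolding subshapes_from_def by auto
  qed
  moreover have "subshapes_from p lam (mu(p := m)) \<inter> subshapes_from p lam (mu(p := m')) = {}"
    if "m \<noteq> m'" for m m'
  proof -
    have "nu p = m" if "nu \<in> subshapes_from p lam (mu(p := m))" for nu m
      using that unfolding subshapes_from_def by auto
    then show ?thesis using that by (metis disjoint_iff)
  qed
  ultimately show ?thesis by (simp add: sum.UNION_disjoint fin)
qed

lemma card_corners_below_Suc:
  "card {i. i < Suc p \<and> nu (Suc i) < nu i} =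
    card {i. i < p \<and> nu (Suc i) < nu i} + (if nu (Suc p) < nu p then 1 else (0 :: nat))"
proof -
  have "{i. i < Suc p \<and> nu (Suc i) < nu i} =
      {i. i < p \<and> nu (Suc i) < nu i} \<union> (if nu (Suc p) < nu p then {p} else {})"
    by (auto simp: less_Suc_eq)
  then show ?thesis by (simp add: card_insert_if)
qed

text \<open>The induction is on the current length \<open>m\<close> of row \<open>p\<close>, the
  last row not yet parked, at position \<open>x + p + 2\<close>. Each transition splits off the
  exchanged permutation, where row \<open>p\<close> is parked with its current length; summing up,
  row \<open>p\<close> takes every length from that of the parked row \<open>p + 1\<close> up to
  \<open>m\<close>.\<close>

lemma stage_Suc:
  assumes lam: "antimono lam" "\<And>i. r \<le> i \<Longrightarrow> lam i = 0"
    and mu: "\<And>i j. p < i \<Longrightarrow> i \<le> j \<Longrightarrow> mu j \<le> mu i" "\<And>i. p < i \<Longrightarrow> mu i \<le> lam i"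
    and IH: "\<And>w m. w permutes {1..N} \<Longrightarrow> w N = N \<Longrightarrow> mu (Suc p) \<le> m \<Longrightarrow> m \<le> lam p \<Longrightarrow>
      lehmer_code N w = stage x p lam (mu(p := m)) \<Longrightarrow>
      reduced_coeff N w = stage_count x p lam (mu(p := m)) \<and> nearly_reduced_coeff N w = stage_stat x p lam (mu(p := m))"
    and w: "w permutes {1..N}" "w N = N" "mu (Suc p) \<le> m" "m \<le> lam p"
    and code: "lehmer_code N w = (stage x (Suc p) lam mu)(Suc (Suc (x + p)) := m)"
  shows "reduced_coeff N w = (\<Sum>m'\<in>{mu (Suc p)..m}. stage_count x p lam (mu(p := m'))) \<and>
    nearly_reduced_coeff N w = (\<Sum>m'\<in>{mu (Suc p)..m}. stage_stat x p lam (mu(p := m')) +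
      (if mu (Suc p) < m' then stage_count x p lam (mu(p := m')) else 0))"
  using w code
proof (induction m arbitrary: w)
  case 0
  then have c: "lehmer_code N w = stage x p lam (mu(p := 0))" and q: "mu (Suc p) = 0"
    by (auto simp: stage_def fun_eq_iff)
  have single: "(\<Sum>m'\<in>{0..0::nat}. f m') = f 0" for f :: "nat \<Rightarrow> rat" by simp
  show ?case
    using IH[OF 0(1-4) c] unfolding q single by (simp only: less_irrefl if_False add_0_right)
next
  case (Suc m)
  define q where "q = mu (Suc p)"
  define R where "R = Suc (Suc (x + p))"
  show ?case
  \<comment> \<open>Rows \<open>p\<close> and \<open>p + 1\<close> then have equal length and
    exchanging them changes nothing: the permutation already belongs to stage \<open>p\<close>, and
    row \<open>p\<close> gets no corner.\<close>
  proof (cases "q = Suc m")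
    case True
    then have c: "lehmer_code N w = stage x p lam (mu(p := Suc m))"
      using Suc.prems(5) unfolding q_def by (auto simp: stage_def fun_eq_iff)
    have single: "(\<Sum>m'\<in>{k..k::nat}. f m') = f k" for k and f :: "nat \<Rightarrow> rat" by simp
    show ?thesis using IH[OF Suc.prems(1-4) c]
      unfolding q_def[symmetric] True single by (simp only: less_irrefl if_False add_0_right)
  next
    case False
    then have qm: "q \<le> m" using Suc.prems(3) unfolding q_def by simp
    have anti: "lam j \<le> lam i" if "i \<le> j" for i j using lam(1) that by (auto dest: antimonoD)
    have cw: "lehmer_code N w = (stage x (Suc p) lam mu)(R := Suc m)"
      using Suc.prems(5) unfolding R_def .
    have cR: "lehmer_code N w R = Suc m" unfolding cw by simp
    have RN: "R < N" using code_pos_imp_less[of N w R] cR by simp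
    have after: "lehmer_code N w i = mu (i - Suc x)" if "R < i" for i
      using that unfolding cw R_def by (auto simp: stage_def)
    have "\<exists>v. v permutes {1..N} \<and> v N = N \<and> R < N \<and>
      lehmer_code N v = (lehmer_code N w)(R := m) \<and> (\<forall>f. right_chains R N f v = f v + f w)"
    proof (rule exists_code_decrement)
      fix i j assume "R < i" "i \<le> j" "j \<le> N"
      then show "lehmer_code N w j \<le> lehmer_code N w i"
        using after[of i] after[of j] mu(1)[of "i - Suc x" "j - Suc x"] unfolding R_def by auto
    next
      fix i assume "R < i" "i \<le> N"
      then have "lehmer_code N w i \<le> q"
        using after[of i] mu(1)[of "Suc p" "i - Suc x"] unfolding R_def q_def by auto
      then show "lehmer_code N w i \<le> m" using qm by simp
    qed (use Suc.prems RN cR R_def in auto)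
    then obtain v where v: "v permutes {1..N}" "v N = N"
      and cv0: "lehmer_code N v = (lehmer_code N w)(R := m)"
      and right_chains: "\<And>f. right_chains R N f v = f v + f w" by auto
    have cv: "lehmer_code N v = (stage x (Suc p) lam mu)(R := m)" unfolding cv0 cw by simp
    have inj: "inj v" using v(1) by (rule permutes_inj)
    have between: "v R < v c" if "Suc x < c" "c < R" for c
    proof -
      have "v R \<le> v c"
      proof (rule less_code_imp_le[of R N "Suc (Suc x)"])
        fix c assume c: "Suc (Suc x) \<le> c" "c < R"
        then have "c - Suc (Suc x) \<le> p" unfolding R_def by auto
        then have "m < lam (c - Suc (Suc x))" using anti[of "c - Suc (Suc x)" p] Suc.prems(4) by simp
        then show "lehmer_code N v R < lehmer_code N v c"
          using c unfolding cv R_def by (auto simp: stage_def)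
      qed (use RN that in auto)
      moreover have "v R \<noteq> v c" using inj that by (metis injD less_irrefl)
      ultimately show ?thesis by simp
    qed
    have xR: "Suc x < R" unfolding R_def by simp
    have cX: "lehmer_code N v (Suc x) = q" unfolding cv R_def q_def by (simp add: stage_def)
    have cvR: "lehmer_code N v R = m" unfolding cv by simp
    have less: "v (Suc x) < v R"
      using code_le_imp_less[OF inj xR less_imp_le[OF RN]] between cX cvR qm by auto
    have before: "v c < v (Suc x)" if "1 \<le> c" "c < Suc x" for c
      using code_zero_imp_less[OF inj that(2), of N] that RN xR unfolding cv by (auto simp: stage_def)
    define w' where "w' = v \<circ> tr R (Suc x)"
    have left_chains: "left_chains R f v = f v + f w'" for f
      unfolding w'_def using less between before xR by (intro left_chains_one_cover) auto
    have w': "w' permutes {1..N}"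
      unfolding w'_def using RN xR by (intro permutes_compose[OF permutes_swap_id v(1)]) auto
    have w'N: "w' N = N" unfolding w'_def using RN xR v(2) by simp
    have cw': "lehmer_code N w' = (lehmer_code N v)(Suc x := Suc m, R := q)"
      unfolding w'_def using code_raise_transposition[of "Suc x" R N v] RN xR less between cX cvR
      by auto
    \<comment> \<open>Row \<open>p\<close> is now parked with length \<open>Suc m\<close>, and the
      row \<open>p + 1\<close> parked before has reached its final position
      \<open>R\<close>.\<close>
    have cw'': "lehmer_code N w' = stage x p lam (mu(p := Suc m))"
      unfolding cw' cv R_def q_def by (auto simp: stage_def fun_eq_iff)
    have len: "perm_length N w = Suc (perm_length N v)"
      by (rule perm_length_code_update[of _ _ _ R]) (use cv0 cR RN R_def in \<open>auto simp: fun_eq_iff\<close>)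
    have len': "perm_length N w' = Suc (perm_length N v)"
    proof -
      let ?A = "{1..N} - {R} - {Suc x}"
      have A: "R \<in> {1..N}" "Suc x \<in> {1..N} - {R}" using RN xR by auto
      have "(\<Sum>i\<in>?A. lehmer_code N w' i) = (\<Sum>i\<in>?A. lehmer_code N v i)"
        unfolding cw' by (rule sum.cong) auto
      moreover have "lehmer_code N w' R = q" "lehmer_code N w' (Suc x) = Suc m"
        unfolding cw' using xR by auto
      ultimately show ?thesis
        unfolding perm_length_eq_sum_code sum.remove[OF finite_atLeastAtMost A(1)]
          sum.remove[OF finite_Diff[OF finite_atLeastAtMost] A(2)] cX cvR by simp
    qed
    have tr: "reduced_coeff N w = reduced_coeff N v + reduced_coeff N w'" "nearly_reduced_coeff N w = nearly_reduced_coeff N v + nearly_reduced_coeff N w' + reduced_coeff N w'"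
      using transition[of R N v w' w] RN xR v Suc.prems(1) w' right_chains left_chains len len' by auto
    have IHv: "reduced_coeff N v = (\<Sum>m'\<in>{q..m}. stage_count x p lam (mu(p := m'))) \<and>
      nearly_reduced_coeff N v = (\<Sum>m'\<in>{q..m}. stage_stat x p lam (mu(p := m')) +
        (if q < m' then stage_count x p lam (mu(p := m')) else 0))"
      unfolding q_def using Suc.prems(4) qm q_def cv R_def by (intro Suc.IH v) auto
    have IHw': "reduced_coeff N w' = stage_count x p lam (mu(p := Suc m)) \<and>
        nearly_reduced_coeff N w' = stage_stat x p lam (mu(p := Suc m))"
      using IH[OF w' w'N Suc.prems(3,4) cw''] .
    have last: "(\<Sum>m'\<in>{q..Suc m}. f m') = (\<Sum>m'\<in>{q..m}. f m') + f (Suc m)"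
      for f :: "nat \<Rightarrow> rat" using qm by simp
    \<comment> \<open>So row \<open>p\<close> of the exchanged permutation ends in a corner; the
      extra \<open>reduced_coeff N w'\<close> of the transition is its weight.\<close>
    have "q < Suc m" using qm by simp
    then show ?thesis unfolding q_def[symmetric] tr last using IHv IHw'
      by (simp only: if_True add.assoc)
  qed
qed

lemma stage_values:
  assumes lam: "antimono lam" "\<And>i. r \<le> i \<Longrightarrow> lam i = 0"
    and base: "\<And>w nu. w permutes {1..N} \<Longrightarrow> w N = N \<Longrightarrow> nu \<in> subshapes lam \<Longrightarrow>
      lehmer_code N w = stage x 0 lam nu \<Longrightarrow>
      reduced_coeff N w = chain_count x nu \<and> nearly_reduced_coeff N w = chain_stat corners x nu"
    and w: "w permutes {1..N}" "w N = N"
    and mu: "\<And>i j. p \<le> i \<Longrightarrow> i \<le> j \<Longrightarrow> mu j \<le> mu i" "\<And>i. p \<le> i \<Longrightarrow> mu i \<le> lam i"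
    and code: "lehmer_code N w = stage x p lam mu"
  shows "reduced_coeff N w = stage_count x p lam mu \<and> nearly_reduced_coeff N w = stage_stat x p lam mu"
  using w mu code
proof (induction p arbitrary: w mu)
  case 0
  have "mu \<in> subshapes lam" using 0 unfolding subshapes_def by (auto intro: antimonoI)
  moreover from this have "subshapes_from 0 lam mu = {mu}" unfolding subshapes_from_def by auto
  ultimately show ?case using base[of w mu] 0 by (simp add: stage_count_def stage_stat_def)
next
  case (Suc p)
  \<comment> \<open>At stage \<open>Suc p\<close> the row at position \<open>x + p + 2\<close> still
    has its full length, which is the case \<open>m = lam p\<close> of
    \<open>stage_Suc\<close>.\<close>
  have c: "stage x (Suc p) lam mu = (stage x (Suc p) lam mu)(Suc (Suc (x + p)) := lam p)"
    by (auto simp: stage_def fun_eq_iff)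
  have anti: "lam (Suc p) \<le> lam p" using antimonoD[OF lam(1), of p "Suc p"] by simp
  have "mu (Suc p) \<le> lam p" using Suc.prems(4)[of "Suc p"] anti by simp
  have main: "reduced_coeff N w = (\<Sum>m'\<in>{mu (Suc p)..lam p}. stage_count x p lam (mu(p := m'))) \<and>
    nearly_reduced_coeff N w = (\<Sum>m'\<in>{mu (Suc p)..lam p}. stage_stat x p lam (mu(p := m')) +
      (if mu (Suc p) < m' then stage_count x p lam (mu(p := m')) else 0))"
  proof (rule stage_Suc[OF lam])
    fix w' m assume w': "w' permutes {1..N}" "w' N = N" "mu (Suc p) \<le> m" "m \<le> lam p"
      "lehmer_code N w' = stage x p lam (mu(p := m))"
    show "reduced_coeff N w' = stage_count x p lam (mu(p := m)) \<and> nearly_reduced_coeff N w' = stage_stat x p lam (mu(p := m))"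
    proof (rule Suc.IH[of w' "mu(p := m)", OF w'(1,2) _ _ w'(5)])
      fix i j assume ij: "p \<le> i" "i \<le> j"
      show "(mu(p := m)) j \<le> (mu(p := m)) i"
      proof (cases "i = p")
        case True
        have "mu j \<le> mu (Suc p)" if "j \<noteq> p" using Suc.prems(3)[of "Suc p" j] ij True that by simp
        then show ?thesis using True w'(3) by auto
      qed (use ij Suc.prems(3)[of i j] in auto)
    next
      fix i assume "p \<le> i"
      then show "(mu(p := m)) i \<le> lam i" using w'(4) Suc.prems(4)[of i] by auto
    qed
  qed (use Suc.prems c \<open>mu (Suc p) \<le> lam p\<close> in auto)
  have st: "stage_stat x p lam (mu(p := m')) +
      (if mu (Suc p) < m' then stage_count x p lam (mu(p := m')) else 0) =
    (\<Sum>nu\<in>subshapes_from p lam (mu(p := m')). chain_stat corners x nu +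
      of_nat (card {i. i < Suc p \<and> nu (Suc i) < nu i}) * chain_count x nu)" for m'
  proof -
    have "nu p = m' \<and> nu (Suc p) = mu (Suc p)" if "nu \<in> subshapes_from p lam (mu(p := m'))" for nu
      using that unfolding subshapes_from_def by auto
    then have "(\<Sum>nu\<in>subshapes_from p lam (mu(p := m')). chain_stat corners x nu +
      of_nat (card {i. i < Suc p \<and> nu (Suc i) < nu i}) * chain_count x nu) =
      (\<Sum>nu\<in>subshapes_from p lam (mu(p := m')). (chain_stat corners x nu +
        of_nat (card {i. i < p \<and> nu (Suc i) < nu i}) * chain_count x nu) +
        (if mu (Suc p) < m' then chain_count x nu else 0))"
      unfolding card_corners_below_Suc by (intro sum.cong) (auto simp: distrib_right)
    then show ?thesis unfolding stage_stat_def stage_count_def by (simp add: sum.distrib)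
  qed
  have eq: "(\<Sum>nu\<in>subshapes_from (Suc p) lam mu. f nu) =
      (\<Sum>m\<in>{mu (Suc p)..lam p}. \<Sum>nu\<in>subshapes_from p lam (mu(p := m)). f nu)"
    for f :: "(nat \<Rightarrow> nat) \<Rightarrow> rat"
    by (rule sum_subshapes_from_Suc[of r lam]) (use lam in auto)
  show ?case
    using main unfolding st unfolding stage_count_def stage_stat_def eq .
qed

text \<open>The two ends of the stages are shifted partitions. Stage \<open>r\<close> with an empty
  parked row is \<open>lam\<close> shifted by \<open>x + 1\<close>; at stage 0 the parked row is the
  first row of \<open>nu\<close>, so the code is \<open>nu\<close> shifted by \<open>x\<close> only.
  Each further unit of \<open>x\<close> thus adds one member to the chain.\<close>

theorem coeff_shifted_dominant:
  assumes "antimono lam" "\<And>i. r \<le> i \<Longrightarrow> lam i = 0" "w permutes {1..N}" "w N = N"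
    and "lehmer_code N w = (\<lambda>i. if i \<le> x then 0 else lam (i - Suc x))"
  shows "reduced_coeff N w = chain_count x lam \<and> nearly_reduced_coeff N w = chain_stat corners x lam"
  using assms
proof (induction x arbitrary: w lam)
  case 0
  then show ?case using coeff_dominant[of w N lam r] by simp
next
  case (Suc x)
  have "reduced_coeff N w = stage_count x r lam (\<lambda>_. 0) \<and> nearly_reduced_coeff N w = stage_stat x r lam (\<lambda>_. 0)"
  proof (rule stage_values[OF Suc.prems(1,2)])
    fix u nu assume u: "u permutes {1..N}" "u N = N" "nu \<in> subshapes lam"
      "lehmer_code N u = stage x 0 lam nu"
    have "nu i = 0" if "r \<le> i" for i
      using u(3) Suc.prems(2)[OF that] unfolding subshapes_def by (metis (mono_tags, lifting) le_zero_eq mem_Collect_eq)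
    moreover have "stage x 0 lam nu = (\<lambda>i. if i \<le> x then 0 else nu (i - Suc x))"
      by (auto simp: stage_def fun_eq_iff)
    ultimately show "reduced_coeff N u = chain_count x nu \<and> nearly_reduced_coeff N u = chain_stat corners x nu"
      using u by (intro Suc.IH) (auto simp: subshapes_def)
  next
    show "lehmer_code N w = stage x r lam (\<lambda>_. 0)"
      unfolding Suc.prems(5) using Suc.prems(2) by (auto simp: stage_def fun_eq_iff)
  qed (use Suc.prems in auto)
  moreover have "subshapes_from r lam (\<lambda>_. 0) = subshapes lam"
    unfolding subshapes_from_def subshapes_def using Suc.prems(2) by (auto, metis le_zero_eq)
  moreover have "{i. i < r \<and> nu (Suc i) < nu i} = {i. nu (Suc i) < nu i}"
    if "nu \<in> subshapes lam" for nu
  proof -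
    have "nu i = 0" if "r \<le> i" for i
      using \<open>nu \<in> subshapes lam\<close> Suc.prems(2)[OF that] unfolding subshapes_def
      by (metis (mono_tags, lifting) le_zero_eq mem_Collect_eq)
    then show ?thesis by (auto, metis linorder_not_less less_nat_zero_code)
  qed
  ultimately show ?case
    unfolding stage_count_def stage_stat_def by (simp add: corners_def[symmetric])
qed

section \<open>Plane partitions and toggles\<close>

lemma subshapes_eq_0: "mu \<in> subshapes lam \<Longrightarrow> lam i = 0 \<Longrightarrow> mu i = 0"
  unfolding subshapes_def by (metis (mono_tags, lifting) le_zero_eq mem_Collect_eq)

text \<open>Chains of shapes in cumulative form: \<open>T i j\<close> is the number of members of
  the chain that contain the cell \<open>(i, j)\<close>, and \<open>level T k\<close> recovers the
  \<open>k\<close>-th member.\<close>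

definition plane_partitions :: "(nat \<Rightarrow> nat) \<Rightarrow> nat \<Rightarrow> (nat \<Rightarrow> nat \<Rightarrow> nat) set" where
  "plane_partitions lam x = {T. \<forall>i j. T (Suc i) j \<le> T i j \<and> T i (Suc j) \<le> T i j \<and> T i j \<le> x \<and>
     (lam i \<le> j \<longrightarrow> T i j = 0)}"

definition level :: "(nat \<Rightarrow> nat \<Rightarrow> nat) \<Rightarrow> nat \<Rightarrow> nat \<Rightarrow> nat" where
  "level T k i = card {j. k \<le> T i j}"

text \<open>Puts \<open>mu\<close> as a new outermost member in front of the chain encoded by
  \<open>T\<close>.\<close>

definition raise :: "(nat \<Rightarrow> nat) \<Rightarrow> (nat \<Rightarrow> nat \<Rightarrow> nat) \<Rightarrow> nat \<Rightarrow> nat \<Rightarrow> nat" where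
  "raise mu T i j = (if j < mu i then Suc (T i j) else 0)"

lemma plane_partitionsD:
  assumes "T \<in> plane_partitions lam x"
  shows "T (Suc i) j \<le> T i j" "T i (Suc j) \<le> T i j" "T i j \<le> x" "lam i \<le> j \<Longrightarrow> T i j = 0"
  using assms unfolding plane_partitions_def by auto

text \<open>Rows of \<open>T\<close> decrease weakly, so the columns with entry at least
  \<open>k\<close> form an initial segment; for \<open>k = 0\<close> this segment would be
  infinite.\<close>

lemma less_level_iff:
  assumes "T \<in> plane_partitions lam x" "1 \<le> k"
  shows "j < level T k i \<longleftrightarrow> k \<le> T i j"
proof
  have mono: "T i j' \<le> T i j" if "j \<le> j'" for j j'
    using lift_Suc_antimono_le[of "T i", OF plane_partitionsD(2)[OF assms(1)] that] .
  have fin: "finite {j. k \<le> T i j}"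
  proof (rule finite_subset)
    show "{j. k \<le> T i j} \<subseteq> {..<lam i}"
    proof
      fix j assume "j \<in> {j. k \<le> T i j}"
      then show "j \<in> {..<lam i}"
        using plane_partitionsD(4)[OF assms(1), of i j] assms(2) by (cases "lam i \<le> j") auto
    qed
  qed simp
  {
    assume "k \<le> T i j"
    then have "{..j} \<subseteq> {j. k \<le> T i j}" using mono by (auto intro: le_trans)
    then have "card {..j} \<le> level T k i" unfolding level_def using fin by (intro card_mono)
    then show "j < level T k i" by simp
  }
  {
    assume "j < level T k i"
    show "k \<le> T i j"
    proof (rule ccontr)
      assume "\<not> k \<le> T i j"
      then have "{j. k \<le> T i j} \<subseteq> {..<j}" using mono by (auto, metis le_trans linorder_not_less)
      then have "level T k i \<le> card {..<j}" unfolding level_def by (intro card_mono) auto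
      then show False using \<open>j < level T k i\<close> by simp
    qed
  }
qed

lemma level_in_subshapes:
  assumes "T \<in> plane_partitions lam x" "1 \<le> k"
  shows "level T k \<in> subshapes lam"
proof -
  have "level T k (Suc i) \<le> level T k i" for i
  proof (rule ccontr)
    assume "\<not> level T k (Suc i) \<le> level T k i"
    then have "level T k i < level T k (Suc i)" by simp
    then have "k \<le> T (Suc i) (level T k i)" unfolding less_level_iff[OF assms] .
    then have "k \<le> T i (level T k i)" using plane_partitionsD(1)[OF assms(1)] by (rule le_trans)
    then show False unfolding less_level_iff[OF assms, symmetric] by simp
  qed
  then have "antimono (level T k)" by (intro antimonoI) (rule lift_Suc_antimono_le)
  moreover have "level T k i \<le> lam i" for i
  proof (rule ccontr)
    assume "\<not> level T k i \<le> lam i"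
    then have "lam i < level T k i" by simp
    then have "k \<le> T i (lam i)" unfolding less_level_iff[OF assms] .
    then show False using plane_partitionsD(4)[OF assms(1), of i "lam i"] assms(2) by simp
  qed
  ultimately show ?thesis unfolding subshapes_def by simp
qed

lemma raise_in_plane_partitions:
  assumes "mu \<in> subshapes lam" "T \<in> plane_partitions mu x"
  shows "raise mu T \<in> plane_partitions lam (Suc x)"
proof -
  have mu: "mu (Suc i) \<le> mu i" "mu i \<le> lam i" for i
    using assms(1) unfolding subshapes_def by (auto dest!: antimonoD[of mu i "Suc i"])
  show ?thesis
    unfolding plane_partitions_def
  proof (intro CollectI allI conjI impI)
    fix i j
    show "raise mu T (Suc i) j \<le> raise mu T i j" "raise mu T i (Suc j) \<le> raise mu T i j"
      "raise mu T i j \<le> Suc x"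
      using plane_partitionsD(1-3)[OF assms(2), of i j] mu(1)[of i] by (auto simp: raise_def)
    assume "lam i \<le> j"
    then show "raise mu T i j = 0" using mu(2)[of i] by (simp add: raise_def)
  qed
qed

lemma level_raise_1: "level (raise mu T) (Suc 0) = mu"
proof
  fix i
  have "{j. Suc 0 \<le> raise mu T i j} = {..<mu i}" by (auto simp: raise_def)
  then show "level (raise mu T) (Suc 0) i = mu i" by (simp add: level_def)
qed

lemma level_raise_Suc:
  assumes "T \<in> plane_partitions mu x" "1 \<le> k"
  shows "level (raise mu T) (Suc k) = level T k"
proof
  fix i
  have "j < mu i" if "k \<le> T i j" for j
    using plane_partitionsD(4)[OF assms(1), of i j] that assms(2) by (cases "mu i \<le> j") auto
  then have "{j. Suc k \<le> raise mu T i j} = {j. k \<le> T i j}" by (auto simp: raise_def)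
  then show "level (raise mu T) (Suc k) i = level T k i" by (simp add: level_def)
qed

lemma bij_betw_raise:
  "bij_betw (\<lambda>(mu, T). raise mu T) (SIGMA mu:subshapes lam. plane_partitions mu x)
     (plane_partitions lam (Suc x))"
proof (rule bij_betw_byWitness[where f' = "\<lambda>T. (level T 1, \<lambda>i j. T i j - 1)"])
  show "\<forall>a\<in>SIGMA mu:subshapes lam. plane_partitions mu x.
      (level (case a of (mu, T) \<Rightarrow> raise mu T) 1, \<lambda>i j. (case a of (mu, T) \<Rightarrow> raise mu T) i j - 1) = a"
  proof
    fix a assume "a \<in> (SIGMA mu:subshapes lam. plane_partitions mu x)"
    then obtain mu T where a: "a = (mu, T)" and T: "T \<in> plane_partitions mu x" by auto
    have "raise mu T i j - 1 = T i j" for i j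
      using plane_partitionsD(4)[OF T, of i j] by (auto simp: raise_def)
    then show "(level (case a of (mu, T) \<Rightarrow> raise mu T) 1,
        \<lambda>i j. (case a of (mu, T) \<Rightarrow> raise mu T) i j - 1) = a"
      unfolding a by (simp add: level_raise_1)
  qed
  show "\<forall>T\<in>plane_partitions lam (Suc x).
      (case (level T 1, \<lambda>i j. T i j - 1) of (mu, T) \<Rightarrow> raise mu T) = T"
    by (auto simp: fun_eq_iff raise_def less_level_iff)
  show "(\<lambda>(mu, T). raise mu T) ` (SIGMA mu:subshapes lam. plane_partitions mu x)
      \<subseteq> plane_partitions lam (Suc x)"
    using raise_in_plane_partitions by auto
  show "(\<lambda>T. (level T 1, \<lambda>i j. T i j - 1)) ` plane_partitions lam (Suc x)
      \<subseteq> (SIGMA mu:subshapes lam. plane_partitions mu x)"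
  proof clarify
    fix T assume T: "T \<in> plane_partitions lam (Suc x)"
    have "(\<lambda>i j. T i j - 1) \<in> plane_partitions (level T 1) x"
      unfolding plane_partitions_def
    proof (intro CollectI allI conjI impI)
      fix i j
      show "T (Suc i) j - 1 \<le> T i j - 1" "T i (Suc j) - 1 \<le> T i j - 1" "T i j - 1 \<le> x"
        using plane_partitionsD(1-3)[OF T, of i j] by auto
      assume "level T 1 i \<le> j"
      then have "\<not> 1 \<le> T i j" using less_level_iff[OF T order_refl, of j i] by simp
      then show "T i j - 1 = 0" by simp
    qed
    then show "level T 1 \<in> subshapes lam \<and> (\<lambda>i j. T i j - 1) \<in> plane_partitions (level T 1) x"
      using level_in_subshapes[OF T] by simp
  qed
qed

lemma finite_plane_partitions:
  assumes "\<And>i. r \<le> i \<Longrightarrow> lam i = 0"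
  shows "finite (plane_partitions lam x)"
  using assms
proof (induction x arbitrary: lam)
  case 0
  have "plane_partitions lam 0 \<subseteq> {\<lambda>_ _. 0}" unfolding plane_partitions_def by (auto simp: fun_eq_iff)
  then show ?case by (rule finite_subset) simp
next
  case (Suc x)
  have "finite (plane_partitions mu x)" if "mu \<in> subshapes lam" for mu
    using that Suc.prems by (intro Suc.IH subshapes_eq_0[of mu lam]) auto
  then have "finite (SIGMA mu:subshapes lam. plane_partitions mu x)"
    using finite_subshapes[of r lam] Suc.prems by auto
  then show ?case using bij_betw_finite[OF bij_betw_raise] by blast
qed

lemma sum_plane_partitions_Suc:
  assumes "\<And>i. r \<le> i \<Longrightarrow> lam i = 0"
  shows "(\<Sum>T\<in>plane_partitions lam (Suc x). f T) =
    (\<Sum>mu\<in>subshapes lam. \<Sum>T\<in>plane_partitions mu x. f (raise mu T))"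
proof -
  have "finite (plane_partitions mu x)" if "mu \<in> subshapes lam" for mu
    using that assms by (intro finite_plane_partitions[of r] subshapes_eq_0[of mu lam]) auto
  then have "(\<Sum>mu\<in>subshapes lam. \<Sum>T\<in>plane_partitions mu x. f (raise mu T)) =
      (\<Sum>(mu, T)\<in>(SIGMA mu:subshapes lam. plane_partitions mu x). f (raise mu T))"
    using finite_subshapes[of r lam] assms by (intro sum.Sigma) auto
  also have "\<dots> = (\<Sum>a\<in>(SIGMA mu:subshapes lam. plane_partitions mu x). f ((\<lambda>(mu, T). raise mu T) a))"
    by (simp add: case_prod_beta)
  also have "\<dots> = (\<Sum>T\<in>plane_partitions lam (Suc x). f T)"
    by (rule sum.reindex_bij_betw[OF bij_betw_raise])
  finally show ?thesis by simp
qed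

lemma chain_count_eq:
  assumes "\<And>i. r \<le> i \<Longrightarrow> lam i = 0"
  shows "chain_count x lam = (\<Sum>T\<in>plane_partitions lam x. 1)"
  using assms
proof (induction x arbitrary: lam)
  case 0
  have "plane_partitions lam 0 = {\<lambda>_ _. 0}" unfolding plane_partitions_def by (auto simp: fun_eq_iff)
  then show ?case by simp
next
  case (Suc x)
  have "chain_count x mu = (\<Sum>T\<in>plane_partitions mu x. 1)" if "mu \<in> subshapes lam" for mu
    using that Suc.prems by (intro Suc.IH subshapes_eq_0[of mu lam]) auto
  then show ?case using sum_plane_partitions_Suc[of r lam "\<lambda>_. 1 :: rat" x] Suc.prems by simp
qed

lemma chain_stat_eq:
  assumes "\<And>i. r \<le> i \<Longrightarrow> lam i = 0"
  shows "chain_stat st x lam = (\<Sum>T\<in>plane_partitions lam x. \<Sum>k\<in>{1..x}. st (level T k))"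
  using assms
proof (induction x arbitrary: lam)
  case (Suc x)
  have "chain_stat st x mu + st mu * chain_count x mu =
      (\<Sum>T\<in>plane_partitions mu x. \<Sum>k\<in>{1..Suc x}. st (level (raise mu T) k))"
    if mu: "mu \<in> subshapes lam" for mu
  proof -
    have z: "mu i = 0" if "r \<le> i" for i using subshapes_eq_0[OF mu Suc.prems[OF that]] .
    have "(\<Sum>k\<in>{1..Suc x}. st (level (raise mu T) k)) = (\<Sum>k\<in>{1..x}. st (level T k)) + st mu"
      if T: "T \<in> plane_partitions mu x" for T
    proof -
      have "(\<Sum>k\<in>{1..Suc x}. st (level (raise mu T) k)) =
          st (level (raise mu T) 1) + (\<Sum>k\<in>{1..x}. st (level (raise mu T) (Suc k)))"
        by (subst sum.atLeast_Suc_atMost) (simp_all add: sum.shift_bounds_cl_Suc_ivl del: sum.cl_ivl_Suc)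
      also have "(\<Sum>k\<in>{1..x}. st (level (raise mu T) (Suc k))) = (\<Sum>k\<in>{1..x}. st (level T k))"
        using level_raise_Suc[OF T] by (intro sum.cong) auto
      finally show ?thesis by (simp add: level_raise_1)
    qed
    then have "(\<Sum>T\<in>plane_partitions mu x. \<Sum>k\<in>{1..Suc x}. st (level (raise mu T) k)) =
        (\<Sum>T\<in>plane_partitions mu x. (\<Sum>k\<in>{1..x}. st (level T k)) + st mu * 1)"
      by (intro sum.cong) auto
    also have "\<dots> = chain_stat st x mu + st mu * chain_count x mu"
    proof -
      have "chain_stat st x mu = (\<Sum>T\<in>plane_partitions mu x. \<Sum>k\<in>{1..x}. st (level T k))"
        by (rule Suc.IH) (rule z)
      moreover have "chain_count x mu = (\<Sum>T\<in>plane_partitions mu x. 1)"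
        by (rule chain_count_eq[of r]) (rule z)
      ultimately show ?thesis unfolding sum.distrib sum_distrib_left[symmetric] by simp
    qed
    finally show ?thesis by simp
  qed
  then have "chain_stat st (Suc x) lam = (\<Sum>mu\<in>subshapes lam.
      \<Sum>T\<in>plane_partitions mu x. \<Sum>k\<in>{1..Suc x}. st (level (raise mu T) k))"
    unfolding chain_stat.simps by (intro sum.cong) auto
  also have "\<dots> = (\<Sum>T\<in>plane_partitions lam (Suc x). \<Sum>k\<in>{1..Suc x}. st (level T k))"
    by (rule sum_plane_partitions_Suc[of r, symmetric]) (rule Suc.prems)
  finally show ?case .
qed simp

section \<open>Toggling a single cell of a plane partition\<close>

definition addable :: "nat \<Rightarrow> nat \<Rightarrow> (nat \<Rightarrow> nat) \<Rightarrow> bool" where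
  "addable i j mu \<longleftrightarrow> mu i = j \<and> (i = 0 \<or> j < mu (i - 1))"

definition removable :: "nat \<Rightarrow> nat \<Rightarrow> (nat \<Rightarrow> nat) \<Rightarrow> bool" where
  "removable i j mu \<longleftrightarrow> mu i = Suc j \<and> mu (Suc i) \<le> j"

text \<open>\<open>lower\<close> and \<open>upper\<close> bound the values that the entry may take
  while all others stay fixed; \<open>x\<close> stands in for a missing neighbour above or to the
  left.\<close>

definition upper :: "nat \<Rightarrow> nat \<Rightarrow> nat \<Rightarrow> (nat \<Rightarrow> nat \<Rightarrow> nat) \<Rightarrow> nat" where
  "upper x i j T = min (if i = 0 then x else T (i - 1) j) (if j = 0 then x else T i (j - 1))"

definition lower :: "nat \<Rightarrow> nat \<Rightarrow> (nat \<Rightarrow> nat \<Rightarrow> nat) \<Rightarrow> nat" where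
  "lower i j T = max (T (Suc i) j) (T i (Suc j))"

text \<open>The piecewise-linear toggle: the entry is reflected in the interval from
  \<open>lower\<close> to \<open>upper\<close>. On plane partitions the subtraction is not
  truncated.\<close>

definition toggle :: "nat \<Rightarrow> nat \<Rightarrow> nat \<Rightarrow> (nat \<Rightarrow> nat \<Rightarrow> nat) \<Rightarrow> nat \<Rightarrow> nat \<Rightarrow> nat" where
  "toggle x i j T = T(i := (T i)(j := upper x i j T + lower i j T - T i j))"

lemma lower_upper:
  assumes "T \<in> plane_partitions lam x"
  shows "lower i j T \<le> T i j" "T i j \<le> upper x i j T" "upper x i j T \<le> x"
  using plane_partitionsD[OF assms, of i j] plane_partitionsD[OF assms, of "i - 1" j]
    plane_partitionsD[OF assms, of i "j - 1"]
  unfolding lower_def upper_def by (cases i; cases j; auto)+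

lemma toggle_simps:
  "upper x i j (toggle x i j T) = upper x i j T" "lower i j (toggle x i j T) = lower i j T"
  "toggle x i j T i j = upper x i j T + lower i j T - T i j"
  unfolding toggle_def by (auto simp: upper_def lower_def)

lemma toggle_involution:
  assumes "T \<in> plane_partitions lam x"
  shows "toggle x i j (toggle x i j T) = T"
proof -
  have "upper x i j T + lower i j T - (upper x i j T + lower i j T - T i j) = T i j"
    using lower_upper[OF assms, of i j] by simp
  then show ?thesis
    unfolding toggle_def[of x i j "toggle x i j T"] toggle_simps by (simp add: toggle_def)
qed

lemma toggle_in_plane_partitions:
  assumes "T \<in> plane_partitions lam x" "j < lam i"
  shows "toggle x i j T \<in> plane_partitions lam x"
proof -
  define t where "t = upper x i j T + lower i j T - T i j"
  have t: "lower i j T \<le> t" "t \<le> upper x i j T" "t \<le> x"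
    using lower_upper[OF assms(1), of i j] unfolding t_def by auto
  have lo: "T (Suc i) j \<le> t" "T i (Suc j) \<le> t" using t(1) unfolding lower_def by auto
  have up: "i = Suc i' \<Longrightarrow> t \<le> T i' j" "j = Suc j' \<Longrightarrow> t \<le> T i j'" for i' j'
    using t(2) unfolding upper_def by auto
  show ?thesis
    unfolding plane_partitions_def
  proof (intro CollectI allI conjI impI)
    fix a b
    show "toggle x i j T (Suc a) b \<le> toggle x i j T a b"
      using plane_partitionsD(1)[OF assms(1), of a b] lo up
      unfolding toggle_def t_def[symmetric] by auto
    show "toggle x i j T a (Suc b) \<le> toggle x i j T a b"
      using plane_partitionsD(2)[OF assms(1), of a b] lo up
      unfolding toggle_def t_def[symmetric] by auto
    show "toggle x i j T a b \<le> x"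
      using plane_partitionsD(3)[OF assms(1), of a b] t
      unfolding toggle_def t_def[symmetric] by auto
    assume "lam a \<le> b"
    then show "toggle x i j T a b = 0"
      using plane_partitionsD(4)[OF assms(1), of a b] assms(2) unfolding toggle_def by auto
  qed
qed

text \<open>A cell is addable to the \<open>k\<close>-th level exactly if that level misses the cell
  but contains its neighbours above and to the left, that is, for \<open>k\<close> in the part of
  the toggle interval above \<open>T i j\<close>.\<close>

lemma sum_addable:
  assumes "T \<in> plane_partitions lam x"
  shows "(\<Sum>k\<in>{1..x}. if addable i j (level T k) then 1 else 0) = (of_nat (upper x i j T) - of_nat (T i j) :: rat)"
proof -
  have "{k\<in>{1..x}. addable i j (level T k)} = {T i j<..upper x i j T}"
  proof (intro set_eqI iffI)
    fix k assume "k \<in> {k\<in>{1..x}. addable i j (level T k)}"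
    then have k: "1 \<le> k" "k \<le> x" "level T k i = j" "i = 0 \<or> j < level T k (i - 1)"
      unfolding addable_def by auto
    have "\<not> k \<le> T i j" using less_level_iff[OF assms k(1), of j i] k(3) by simp
    moreover have "i = 0 \<or> k \<le> T (i - 1) j" using less_level_iff[OF assms k(1)] k(4) by blast
    moreover have "j = 0 \<or> k \<le> T i (j - 1)"
      using less_level_iff[OF assms k(1), of "j - 1" i] k(3) by auto
    ultimately show "k \<in> {T i j<..upper x i j T}" using k unfolding upper_def by auto
  next
    fix k assume k0: "k \<in> {T i j<..upper x i j T}"
    then have k: "1 \<le> k" "k \<le> x" "T i j < k" using lower_upper(3)[OF assms, of i j] by auto
    have u: "i = 0 \<or> k \<le> T (i - 1) j" "j = 0 \<or> k \<le> T i (j - 1)"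
      using k0 unfolding upper_def by (auto split: if_splits)
    have "\<not> j < level T k i" using less_level_iff[OF assms k(1)] k(3) by simp
    moreover have "j = 0 \<or> j - 1 < level T k i" using less_level_iff[OF assms k(1)] u(2) by simp
    moreover have "i = 0 \<or> j < level T k (i - 1)" using less_level_iff[OF assms k(1)] u(1) by simp
    ultimately show "k \<in> {k\<in>{1..x}. addable i j (level T k)}" using k unfolding addable_def by auto
  qed
  moreover have "(\<Sum>k\<in>{1..x}. if addable i j (level T k) then 1 else 0) =
      (of_nat (card {k\<in>{1..x}. addable i j (level T k)}) :: rat)"
    by (simp add: sum.If_cases Int_def)
  ultimately show ?thesis using lower_upper[OF assms, of i j] by (simp add: of_nat_diff)
qed

text \<open>Dually, the level must contain the cell but not its neighbours below and to the
  right.\<close>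

lemma sum_removable:
  assumes "T \<in> plane_partitions lam x"
  shows "(\<Sum>k\<in>{1..x}. if removable i j (level T k) then 1 else 0) = (of_nat (T i j) - of_nat (lower i j T) :: rat)"
proof -
  have "{k\<in>{1..x}. removable i j (level T k)} = {lower i j T<..T i j}"
  proof (intro set_eqI iffI)
    fix k assume "k \<in> {k\<in>{1..x}. removable i j (level T k)}"
    then have k: "1 \<le> k" "k \<le> x" "level T k i = Suc j" "level T k (Suc i) \<le> j"
      unfolding removable_def by auto
    have "k \<le> T i j" "\<not> k \<le> T i (Suc j)" "\<not> k \<le> T (Suc i) j"
      unfolding less_level_iff[OF assms k(1), symmetric] using k by auto
    then show "k \<in> {lower i j T<..T i j}" unfolding lower_def by auto
  next
    fix k assume k0: "k \<in> {lower i j T<..T i j}"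
    then have k: "1 \<le> k" "k \<le> x" using plane_partitionsD(3)[OF assms, of i j] by auto
    have "j < level T k i" "\<not> Suc j < level T k i" "\<not> j < level T k (Suc i)"
      unfolding less_level_iff[OF assms k(1)] using k0 unfolding lower_def by auto
    then show "k \<in> {k\<in>{1..x}. removable i j (level T k)}" using k unfolding removable_def by auto
  qed
  moreover have "(\<Sum>k\<in>{1..x}. if removable i j (level T k) then 1 else 0) =
      (of_nat (card {k\<in>{1..x}. removable i j (level T k)}) :: rat)"
    by (simp add: sum.If_cases Int_def)
  ultimately show ?thesis using lower_upper[OF assms, of i j] by (simp add: of_nat_diff)
qed

text \<open>Reflecting \<open>T i j\<close> exchanges its distances to \<open>upper\<close> and to
  \<open>lower\<close>, which count the levels where the cell is addable and removable
  respectively.\<close>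

lemma toggle_symmetry:
  assumes "\<And>i. r \<le> i \<Longrightarrow> lam i = 0" "j < lam i"
  shows "(\<Sum>T\<in>plane_partitions lam x. \<Sum>k\<in>{1..x}. (if addable i j (level T k) then 1 else 0) -
    (if removable i j (level T k) then 1 else 0)) = (0 :: rat)"
proof -
  let ?PP = "plane_partitions lam x"
  have closed: "toggle x i j T \<in> ?PP" if "T \<in> ?PP" for T
    using that assms(2) by (rule toggle_in_plane_partitions)
  have "(\<Sum>T\<in>?PP. of_nat (upper x i j T) - of_nat (T i j)) =
      (\<Sum>T\<in>?PP. of_nat (T i j) - of_nat (lower i j T) :: rat)"
    by (rule sum.reindex_bij_witness[of _ "toggle x i j" "toggle x i j"])
      (use lower_upper in \<open>auto simp: toggle_involution closed
         toggle_simps of_nat_diff trans_le_add1\<close>)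
  moreover have "(\<Sum>T\<in>?PP. \<Sum>k\<in>{1..x}. if addable i j (level T k) then 1 else 0) =
      (\<Sum>T\<in>?PP. of_nat (upper x i j T) - of_nat (T i j) :: rat)"
    by (intro sum.cong refl sum_addable)
  moreover have "(\<Sum>T\<in>?PP. \<Sum>k\<in>{1..x}. if removable i j (level T k) then 1 else 0) =
      (\<Sum>T\<in>?PP. of_nat (T i j) - of_nat (lower i j T) :: rat)"
    by (intro sum.cong refl sum_removable)
  ultimately show ?thesis
    by (simp only: sum_subtractf)
qed

text \<open>The coefficient \<open>c i + r j - r c\<close> of the cell \<open>(i, j)\<close> (counted from 0) vanishes at every cell that is
addable to \<open>mu\<close> but lies outside \<open>lam\<close>; for the inner corners of \<open>lam\<close> this is what balance says.\<close>

lemma corners_linear_relation: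
  fixes r c :: nat
  assumes lam: "antimono lam" "\<And>i. r \<le> i \<Longrightarrow> lam i = 0" "lam 0 = c" "0 < r"
    and bal: "\<And>i. 1 \<le> i \<Longrightarrow> i < r \<Longrightarrow> lam i < lam (i - 1) \<Longrightarrow> r * lam i = c * (r - i)"
    and mu: "mu \<in> subshapes lam"
  shows "of_nat (r + c) * corners mu = of_nat (r * c) +
    (\<Sum>i<r. \<Sum>j<lam i. (of_nat (c * i + r * j) - of_nat (r * c)) *
      ((if addable i j mu then 1 else 0) - (if removable i j mu then 1 else 0)))"
proof -
  define kap :: "nat \<Rightarrow> nat \<Rightarrow> rat" where "kap i j = of_nat (c * i + r * j) - of_nat (r * c)" for i j
  have mu1: "mu (Suc i) \<le> mu i" "mu i \<le> lam i" for i
    using mu unfolding subshapes_def by (auto dest!: antimonoD[of mu i "Suc i"])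
  have mur: "mu i = 0" if "r \<le> i" for i using mu1(2)[of i] lam(2)[OF that] by simp
  define d where "d i = (if mu (Suc i) < mu i then 1 else 0 :: rat)" for i
  have add: "(\<Sum>j<lam i. kap i j * (if addable i j mu then 1 else 0)) =
      (if i = 0 then 1 else d (i - 1)) * kap i (mu i)" if i: "i < r" for i
  proof -
    have "(\<Sum>j<lam i. kap i j * (if addable i j mu then 1 else 0)) =
       (\<Sum>j<lam i. if j = mu i then kap i (mu i) * (if i = 0 then 1 else d (i - 1)) else 0)"
      by (intro sum.cong) (auto simp: addable_def d_def)
    also have "\<dots> = (if mu i < lam i then kap i (mu i) * (if i = 0 then 1 else d (i - 1)) else 0)"
      by simp
    also have "\<dots> = (if i = 0 then 1 else d (i - 1)) * kap i (mu i)"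
    proof (cases "mu i < lam i")
      case False
      then have eq: "mu i = lam i" using mu1(2)[of i] by simp
      show ?thesis
      proof (cases "i = 0")
        case True
        then show ?thesis using eq lam(3) by (simp add: kap_def)
      next
        case i0: False
        show ?thesis
        proof (cases "mu i < mu (i - 1)")
          case True
          then have "lam i < lam (i - 1)" using eq mu1(2)[of "i - 1"] by simp
          then have "r * lam i = c * (r - i)" using bal[of i] i i0 by simp
          moreover have "c * i + c * (r - i) = c * r"
            using i by (simp only: distrib_left[symmetric] le_add_diff_inverse less_imp_le)
          ultimately have "c * i + r * lam i = r * c" by (simp add: mult.commute)
          then show ?thesis using eq by (simp add: kap_def del: of_nat_add of_nat_mult)
        next
          case False
          then show ?thesis using \<open>\<not> mu i < lam i\<close> i0 by (simp add: d_def)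
        qed
      qed
    qed simp
    finally show ?thesis .
  qed
  have rem: "(\<Sum>j<lam i. kap i j * (if removable i j mu then 1 else 0)) = d i * kap i (mu i - 1)" for i
  proof -
    have "(\<Sum>j<lam i. kap i j * (if removable i j mu then 1 else 0)) =
       (\<Sum>j<lam i. if j = mu i - 1 then d i * kap i (mu i - 1) else 0)"
      by (intro sum.cong) (auto simp: removable_def d_def)
    also have "\<dots> = d i * kap i (mu i - 1)"
      using mu1(2)[of i] by (auto simp: d_def)
    finally show ?thesis .
  qed
  \<comment> \<open>The cell below the last row has coefficient \<open>c r - r c\<close>, so the sum
    over addable cells may be extended to \<open>i = r\<close>. This pairs every corner with the
    addable cell in the next row.\<close>
  have kr: "kap r (mu r) = 0" using mur[of r] by (simp add: kap_def)
  have "(\<Sum>i<r. (if i = 0 then 1 else d (i - 1)) * kap i (mu i)) =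
      (\<Sum>i<Suc r. (if i = 0 then 1 else d (i - 1)) * kap i (mu i))"
    using kr by simp
  also have "\<dots> = kap 0 (mu 0) + (\<Sum>i<r. d i * kap (Suc i) (mu (Suc i)))"
    by (subst sum.lessThan_Suc_shift) simp
  finally have A: "(\<Sum>i<r. (if i = 0 then 1 else d (i - 1)) * kap i (mu i)) =
      kap 0 (mu 0) + (\<Sum>i<r. d i * kap (Suc i) (mu (Suc i)))" .
  \<comment> \<open>A corner in row \<open>i\<close> and the addable cell in row
    \<open>i + 1\<close> differ by one row and by \<open>mu i - mu (Suc i) - 1\<close> columns. The
    row and the 1 give \<open>c + r\<close> per corner; the rest telescopes to
    \<open>- r * mu 0\<close>, which cancels against \<open>kap 0 (mu 0)\<close>.\<close>
  have step: "d i * kap (Suc i) (mu (Suc i)) - d i * kap i (mu i - 1) =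
      of_nat (r + c) * d i + of_nat r * (of_nat (mu (Suc i)) - of_nat (mu i))" for i
  proof (cases "mu (Suc i) < mu i")
    case True
    then obtain k where "mu i = Suc k" by (cases "mu i") auto
    with True show ?thesis by (simp add: d_def kap_def algebra_simps)
  next
    case False
    then have "mu (Suc i) = mu i" using mu1(1)[of i] by simp
    then show ?thesis by (simp add: d_def)
  qed
  have dsum: "(\<Sum>i<r. d i) = corners mu"
  proof -
    have "{i. mu (Suc i) < mu i} = {..<r} \<inter> {i. mu (Suc i) < mu i}"
      using mur by (auto, metis linorder_not_less less_nat_zero_code)
    then show ?thesis unfolding d_def corners_def by (simp add: sum.If_cases)
  qed
  have tele: "(\<Sum>i<r. of_nat (mu (Suc i)) - of_nat (mu i) :: rat) = - of_nat (mu 0)"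
    using sum_lessThan_telescope[of "\<lambda>i. rat_of_nat (mu i)" r] mur[of r] by simp
  have "(\<Sum>i<r. \<Sum>j<lam i. kap i j *
      ((if addable i j mu then 1 else 0) - (if removable i j mu then 1 else 0))) =
    (\<Sum>i<r. (if i = 0 then 1 else d (i - 1)) * kap i (mu i)) - (\<Sum>i<r. d i * kap i (mu i - 1))"
    unfolding right_diff_distrib sum_subtractf rem using add by simp
  also have "\<dots> = kap 0 (mu 0) +
      (\<Sum>i<r. d i * kap (Suc i) (mu (Suc i)) - d i * kap i (mu i - 1))"
    unfolding A sum_subtractf by simp
  also have "\<dots> = kap 0 (mu 0) + of_nat (r + c) * corners mu - of_nat r * of_nat (mu 0)"
    unfolding step sum.distrib sum_distrib_left[symmetric] dsum tele by simp
  also have "\<dots> = of_nat (r + c) * corners mu - of_nat (r * c)"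
    by (simp add: kap_def)
  finally show ?thesis unfolding kap_def by simp
qed

text \<open>The coefficients in \<open>corners_linear_relation\<close> depend on the cell only, so
  after summing over all plane partitions and levels \<open>toggle_symmetry\<close> annihilates the
  linear combination cell by cell.\<close>

theorem chain_stat_corners_balanced:
  assumes lam: "antimono lam" "\<And>i. r \<le> i \<Longrightarrow> lam i = 0" "lam 0 = c" "0 < r"
    and bal: "\<And>i. 1 \<le> i \<Longrightarrow> i < r \<Longrightarrow> lam i < lam (i - 1) \<Longrightarrow> r * lam i = c * (r - i)"
  shows "of_nat (r + c) * chain_stat corners x lam = of_nat (x * r * c) * chain_count x lam"
proof -
  let ?PP = "plane_partitions lam x"
  let ?k = "\<lambda>i j. (of_nat (c * i + r * j) - of_nat (r * c) :: rat)"
  let ?t = "\<lambda>T k i j. (if addable i j (level T k) then 1 else 0) -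
    (if removable i j (level T k) then 1 else 0) :: rat"
  have cor: "of_nat (r + c) * corners (level T k) = of_nat (r * c) +
      (\<Sum>i<r. \<Sum>j<lam i. ?k i j * ?t T k i j)" if "T \<in> ?PP" "k \<in> {1..x}" for T k
    using that by (intro corners_linear_relation[OF lam bal] level_in_subshapes) auto
  have stat: "chain_stat corners x lam = (\<Sum>T\<in>?PP. \<Sum>k\<in>{1..x}. corners (level T k))"
    by (rule chain_stat_eq[of r]) (rule lam(2))
  have count: "chain_count x lam = (\<Sum>T\<in>?PP. 1)"
    by (rule chain_count_eq[of r]) (rule lam(2))
  have "of_nat (r + c) * chain_stat corners x lam =
      (\<Sum>T\<in>?PP. \<Sum>k\<in>{1..x}. of_nat (r + c) * corners (level T k))"
    unfolding stat sum_distrib_left ..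
  also have "\<dots> = (\<Sum>T\<in>?PP. \<Sum>k\<in>{1..x}. of_nat (r * c) + (\<Sum>i<r. \<Sum>j<lam i. ?k i j * ?t T k i j))"
    using cor by (intro sum.cong) auto
  also have "\<dots> = (\<Sum>T\<in>?PP. \<Sum>k\<in>{1..x}. of_nat (r * c)) +
      (\<Sum>T\<in>?PP. \<Sum>k\<in>{1..x}. \<Sum>i<r. \<Sum>j<lam i. ?k i j * ?t T k i j)"
    unfolding sum.distrib ..
  also have "(\<Sum>T\<in>?PP. \<Sum>k\<in>{1..x}. \<Sum>i<r. \<Sum>j<lam i. ?k i j * ?t T k i j) =
      (\<Sum>i<r. \<Sum>j<lam i. ?k i j * (\<Sum>T\<in>?PP. \<Sum>k\<in>{1..x}. ?t T k i j))"
  proof -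
    have "(\<Sum>T\<in>?PP. \<Sum>k\<in>{1..x}. \<Sum>i<r. \<Sum>j<lam i. ?k i j * ?t T k i j) =
        (\<Sum>T\<in>?PP. \<Sum>i<r. \<Sum>j<lam i. \<Sum>k\<in>{1..x}. ?k i j * ?t T k i j)"
      unfolding sum.swap[of _ _ "{1..x}"] ..
    also have "\<dots> = (\<Sum>i<r. \<Sum>T\<in>?PP. \<Sum>j<lam i. \<Sum>k\<in>{1..x}. ?k i j * ?t T k i j)"
      by (rule sum.swap)
    also have "\<dots> = (\<Sum>i<r. \<Sum>j<lam i. \<Sum>T\<in>?PP. \<Sum>k\<in>{1..x}. ?k i j * ?t T k i j)"
      by (intro sum.cong refl sum.swap)
    finally show ?thesis unfolding sum_distrib_left .
  qed
  also have "\<dots> = 0"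
    using toggle_symmetry[of r lam, OF lam(2)] by (intro sum.neutral ballI) auto
  finally show ?thesis
    unfolding count by simp
qed

section \<open>Hecke words read from the left\<close>

lemma perm_length_right_descent:
  assumes "v (Suc i) < v i" "1 \<le> i" "Suc i \<le> n"
  shows "perm_length n v = Suc (perm_length n (v \<circ> tr i (Suc i)))"
proof -
  let ?t = "tr i (Suc i)"
  let ?I = "\<lambda>u. {(a, b). 1 \<le> a \<and> a < b \<and> b \<le> n \<and> u a > u b}"
  let ?T = "\<lambda>(a, b). (?t a, ?t b)"
  have fin: "finite (?I u)" for u :: "nat \<Rightarrow> nat"
    by (rule finite_subset[of _ "{1..n} \<times> {1..n}"]) auto
  have t_less: "?t a < ?t b" if "a < b" "\<not> (a = i \<and> b = Suc i)" for a b
    using that by (auto simp: Transposition.transpose_def)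
  have t_in: "1 \<le> ?t a" "?t a \<le> n" if "1 \<le> a" "a \<le> n" for a
    using that assms(2,3) by (auto simp: Transposition.transpose_def)
  have sub: "?T ` ?I (v \<circ> ?t) \<subseteq> ?I v"
  proof clarify
    fix a b assume ab: "1 \<le> a" "a < b" "b \<le> n" "(v \<circ> ?t) b < (v \<circ> ?t) a"
    have "\<not> (a = i \<and> b = Suc i)" using ab(4) assms(1) by auto
    then show "1 \<le> ?t a \<and> ?t a < ?t b \<and> ?t b \<le> n \<and> v (?t b) < v (?t a)"
      using t_less[of a b] t_in[of a] t_in[of b] ab by auto
  qed
  have "?I v = insert (i, Suc i) (?T ` ?I (v \<circ> ?t))"
  proof (intro equalityI subsetI)
    fix z assume z: "z \<in> ?I v"
    obtain a b where ab: "z = (a, b)" by (cases z)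
    have z': "1 \<le> a" "a < b" "b \<le> n" "v b < v a" using z ab by auto
    show "z \<in> insert (i, Suc i) (?T ` ?I (v \<circ> ?t))"
    proof (cases "a = i \<and> b = Suc i")
      case False
      then have "(?t a, ?t b) \<in> ?I (v \<circ> ?t)"
        using t_less[of a b] t_in[of a] t_in[of b] z' by auto
      moreover have "z = ?T (?t a, ?t b)" using ab by simp
      ultimately show ?thesis by blast
    qed (use ab in simp)
  qed (use sub assms in auto)
  moreover have "(i, Suc i) \<notin> ?T ` ?I (v \<circ> ?t)"
  proof
    assume "(i, Suc i) \<in> ?T ` ?I (v \<circ> ?t)"
    then obtain a b where ab: "i = ?t a" "Suc i = ?t b" "a < b" by auto
    have "a = Suc i" using arg_cong[OF ab(1), of "?t"] by simp
    moreover have "b = i" using arg_cong[OF ab(2), of "?t"] by simp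
    ultimately show False using ab(3) by simp
  qed
  moreover have "card (?T ` ?I (v \<circ> ?t)) = card (?I (v \<circ> ?t))"
    by (rule card_image) (auto intro!: inj_onI dest: injD[OF inj_transpose])
  ultimately show ?thesis unfolding perm_length_def using fin[of "v \<circ> ?t"] by simp
qed

lemma hecke_step_eq:
  assumes "inj v" "1 \<le> i" "i < n"
  shows "hecke_step n v i = (if v (Suc i) < v i then v else v \<circ> tr i (Suc i))"
proof (cases "v (Suc i) < v i")
  case True
  then show ?thesis using perm_length_right_descent[of v i n] assms
    unfolding hecke_step_def simple_transposition_def by simp
next
  case False
  moreover have "v (Suc i) \<noteq> v i" using assms(1) by (metis injD n_not_Suc_n)
  ultimately have "(v \<circ> tr i (Suc i)) (Suc i) < (v \<circ> tr i (Suc i)) i" by simp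
  from perm_length_right_descent[of "v \<circ> tr i (Suc i)" i n, OF this] assms
  have "perm_length n (v \<circ> tr i (Suc i)) = Suc (perm_length n v)"
    by (simp add: comp_assoc)
  then show ?thesis using False unfolding hecke_step_def simple_transposition_def by simp
qed

definition left_hecke_step :: "nat \<Rightarrow> (nat \<Rightarrow> nat) \<Rightarrow> nat \<Rightarrow> nat" where
  "left_hecke_step k v = (if left_descent k v then v else tr k (Suc k) \<circ> v)"

lemma left_descent_iff:
  assumes "inj v" "v p = Suc k" "v q = k"
  shows "left_descent k v \<longleftrightarrow> p < q"
  unfolding left_descent_def using assms by (metis injD)

lemma transpose_Suc_less_iff:
  assumes "\<not> (x = k \<and> y = Suc k)" "\<not> (x = Suc k \<and> y = k)"
  shows "tr k (Suc k) x < tr k (Suc k) y \<longleftrightarrow> x < y"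
  using assms by (auto simp: Transposition.transpose_def)

text \<open>Associativity of the 0-Hecke product. The steps interfere only if the positions
  \<open>i\<close> and \<open>Suc i\<close> carry the values \<open>k\<close> and
  \<open>Suc k\<close>; then \<open>tr k (Suc k) \<circ> v\<close> and
  \<open>v \<circ> tr i (Suc i)\<close> coincide.\<close>

lemma left_right_hecke_step_commute:
  assumes "v permutes {1..n}" "1 \<le> i" "i < n"
  shows "hecke_step n (left_hecke_step k v) i = left_hecke_step k (hecke_step n v i)"
proof -
  let ?s = "tr k (Suc k)" and ?t = "tr i (Suc i)"
  have inj: "inj v" using assms(1) by (rule permutes_inj)
  obtain p q where pq: "v p = Suc k" "v q = k"
    using permutes_surj[OF assms(1)] by (metis surjD)
  have injs: "inj (?s \<circ> v)" "inj (v \<circ> ?t)" using inj by (simp_all add: inj_compose)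
  have pos: "u = p" if "v u = Suc k" for u using that pq inj by (metis injD)
  have pos': "u = q" if "v u = k" for u using that pq inj by (metis injD)
  have ne: "p \<noteq> q" using pq by auto
  have ld: "left_descent k v \<longleftrightarrow> p < q" by (rule left_descent_iff[OF inj pq])
  have ldt: "left_descent k (v \<circ> ?t) \<longleftrightarrow> ?t p < ?t q"
    by (rule left_descent_iff[OF injs(2)]) (simp_all add: pq)
  have inj': "inj (left_hecke_step k v)"
    unfolding left_hecke_step_def using inj injs by simp
  note step = hecke_step_eq[OF inj assms(2,3)] hecke_step_eq[OF inj' assms(2,3)]
  consider "p = i" "q = Suc i" | "p = Suc i" "q = i"
    | "\<not> (p = i \<and> q = Suc i)" "\<not> (p = Suc i \<and> q = i)" by blast
  then show ?thesis
  proof cases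
    case 1
    then show ?thesis unfolding step unfolding left_hecke_step_def using ld pq by simp
  next
    case 2
    have eq: "?s \<circ> v = v \<circ> ?t"
    proof
      fix u
      consider "u = i" | "u = Suc i" | "u \<noteq> i" "u \<noteq> Suc i" "v u \<noteq> k" "v u \<noteq> Suc k"
        using pos[of u] pos'[of u] 2 by blast
      then show "(?s \<circ> v) u = (v \<circ> ?t) u" by cases (use 2 pq in simp_all)
    qed
    show ?thesis unfolding step unfolding left_hecke_step_def using ld ldt pq 2 eq by simp
  next
    case 3
    have t: "?t p < ?t q \<longleftrightarrow> p < q" using 3 by (intro transpose_Suc_less_iff) auto
    have s: "?s (v (Suc i)) < ?s (v i) \<longleftrightarrow> v (Suc i) < v i"
      using 3 pos[of i] pos[of "Suc i"] pos'[of i] pos'[of "Suc i"]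
      by (intro transpose_Suc_less_iff) metis+
    show ?thesis unfolding step unfolding left_hecke_step_def using ld ldt t s by (simp add: comp_assoc)
  qed
qed

lemma hecke_step_permutes:
  assumes "v permutes {1..n}" "1 \<le> i" "i < n"
  shows "hecke_step n v i permutes {1..n}"
proof -
  have "(v \<circ> tr i (Suc i)) permutes {1..n}"
    using assms by (intro permutes_compose[OF permutes_swap_id]) auto
  then show ?thesis unfolding hecke_step_def simple_transposition_def using assms(1) by simp
qed

lemma hecke_product_permutes:
  "set S \<subseteq> {1..<n} \<Longrightarrow> hecke_product n S permutes {1..n}"
proof (induction S rule: rev_induct)
  case (snoc i S)
  then show ?case
    using hecke_step_permutes[of "hecke_product n S" n i] by (simp add: hecke_product_def)
qed (simp add: hecke_product_def permutes_id)

text \<open>\<open>hecke_product\<close> grows at the last letter while \<open>hecke_weight\<close>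
  peels off the first one; commuting left and right steps reconciles the two.\<close>

lemma hecke_product_Cons:
  assumes "set (k # S) \<subseteq> {1..<n}"
  shows "hecke_product n (k # S) = left_hecke_step k (hecke_product n S)"
  using assms
proof (induction S rule: rev_induct)
  case Nil
  have "\<not> left_descent k id" by (auto simp: left_descent_def)
  then have "left_hecke_step k id = tr k (Suc k)" by (simp only: left_hecke_step_def if_False comp_id)
  moreover have "hecke_product n [] = id" by (simp add: hecke_product_def)
  ultimately show ?case by (simp only: hecke_product_singleton simple_transposition_def)
next
  case (snoc i S)
  have snoc_eq: "hecke_product n (xs @ [i]) = hecke_step n (hecke_product n xs) i" for xs
    by (simp add: hecke_product_def)
  have "hecke_product n (k # S @ [i]) = hecke_step n (hecke_product n (k # S)) i"
    using snoc_eq[of "k # S"] by simp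
  also have "\<dots> = left_hecke_step k (hecke_step n (hecke_product n S) i)"
    using snoc left_right_hecke_step_commute[of "hecke_product n S" n i k]
      hecke_product_permutes[of S n] by simp
  finally show ?case unfolding snoc_eq .
qed

text \<open>A left step always ends with the descent, and just one of \<open>u\<close> and
  \<open>tr k (Suc k) \<circ> u\<close> has it.\<close>

lemma left_hecke_step_eq_iff:
  assumes "u permutes {1..n}"
  shows "left_hecke_step k u = w \<longleftrightarrow> left_descent k w \<and> (u = w \<or> u = tr k (Suc k) \<circ> w)"
proof -
  have inv: "tr k (Suc k) \<circ> (tr k (Suc k) \<circ> v) = v" for v
    by (simp add: comp_assoc[symmetric])
  obtain p q where pq: "u p = Suc k" "u q = k"
    using permutes_surj[OF assms] by (metis surjD)
  have inj: "inj u" "inj (tr k (Suc k) \<circ> u)"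
    using permutes_inj[OF assms] by (simp_all add: inj_compose)
  have ne: "p \<noteq> q" using pq by auto
  have 1: "left_descent k u \<longleftrightarrow> p < q" by (rule left_descent_iff[OF inj(1) pq])
  have 2: "left_descent k (tr k (Suc k) \<circ> u) \<longleftrightarrow> q < p"
    by (rule left_descent_iff[OF inj(2)]) (simp_all add: pq)
  show ?thesis
  proof (cases "p < q")
    case True
    then show ?thesis using 1 2 inv unfolding left_hecke_step_def by (metis less_asym)
  next
    case False
    then have "q < p" using ne by simp
    then show ?thesis using 1 2 False inv unfolding left_hecke_step_def by metis
  qed
qed

lemma finite_hecke_words: "finite (hecke_words n w m)"
  by (rule finite_subset[OF _ finite_lists_length_eq[of "{1..<n}" m]]) (auto simp: hecke_words_def)

lemma hecke_words_Suc:
  "hecke_words n w (Suc m) = (\<Union>k\<in>{k\<in>{1..<n}. left_descent k w}.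
     (#) k ` (hecke_words n w m \<union> hecke_words n (tr k (Suc k) \<circ> w) m))"
proof (intro equalityI subsetI)
  fix S assume S: "S \<in> hecke_words n w (Suc m)"
  then obtain k S' where k: "S = k # S'" unfolding hecke_words_def by (cases S) auto
  then have "left_hecke_step k (hecke_product n S') = w" "set S' \<subseteq> {1..<n}" "k \<in> {1..<n}" "length S' = m"
    using S hecke_product_Cons[of k S' n] unfolding hecke_words_def by auto
  moreover from this have "left_descent k w \<and>
      (hecke_product n S' = w \<or> hecke_product n S' = tr k (Suc k) \<circ> w)"
    using left_hecke_step_eq_iff[OF hecke_product_permutes[of S' n]] by blast
  ultimately show "S \<in> (\<Union>k\<in>{k\<in>{1..<n}. left_descent k w}.
     (#) k ` (hecke_words n w m \<union> hecke_words n (tr k (Suc k) \<circ> w) m))"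
    using k unfolding hecke_words_def by blast
next
  fix S assume "S \<in> (\<Union>k\<in>{k\<in>{1..<n}. left_descent k w}.
     (#) k ` (hecke_words n w m \<union> hecke_words n (tr k (Suc k) \<circ> w) m))"
  then obtain k S' where k: "k \<in> {1..<n}" "left_descent k w" "S = k # S'"
    and S': "length S' = m" "set S' \<subseteq> {1..<n}"
      "hecke_product n S' = w \<or> hecke_product n S' = tr k (Suc k) \<circ> w"
    unfolding hecke_words_def by blast
  then have "left_hecke_step k (hecke_product n S') = w"
    using left_hecke_step_eq_iff[OF hecke_product_permutes[of S' n]] by blast
  then show "S \<in> hecke_words n w (Suc m)"
    using k S' hecke_product_Cons[of k S' n] unfolding hecke_words_def by auto
qed

section \<open>Evaluation of \<open>FK\<close> and the shifted permutation\<close>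

lemma poly_FK: "poly (FK n w m) y = (\<Sum>S\<in>hecke_words n w m. \<Prod>i\<leftarrow>S. y + of_nat i)"
proof -
  have "poly (\<Prod>i\<leftarrow>S. [:of_nat i, 1:]) y = (\<Prod>i\<leftarrow>S. y + of_nat i)" for S
    by (induction S) (simp_all add: algebra_simps)
  then show ?thesis unfolding FK_def poly_sum by simp
qed

lemma poly_FK_eq_hecke_weight:
  "poly (FK n w m) y = hecke_weight (\<lambda>k. y + of_nat k) n m w"
proof (induction m arbitrary: w)
  case 0
  have "hecke_words n w 0 = (if w = id then {[]} else {})"
    by (auto simp: hecke_words_def hecke_product_def)
  then show ?case by (simp add: poly_FK)
next
  case (Suc m)
  let ?f = "\<lambda>S. \<Prod>i\<leftarrow>S. y + rat_of_nat i"
  let ?D = "{k\<in>{1..<n}. left_descent k w}"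
  let ?W = "\<lambda>k. hecke_words n w m \<union> hecke_words n (tr k (Suc k) \<circ> w) m"
  have summand: "sum ?f ((#) k ` ?W k) = (y + of_nat k) * left_demazure k (hecke_weight (\<lambda>k. y + of_nat k) n m) w"
    if k: "k \<in> ?D" for k
  proof -
    obtain p q where pq: "p < q" "w p = Suc k" "w q = k"
      using k unfolding left_descent_def by auto
    have "(tr k (Suc k) \<circ> w) p \<noteq> w p" using pq by simp
    then have "w \<noteq> tr k (Suc k) \<circ> w" by metis
    then have disj: "hecke_words n w m \<inter> hecke_words n (tr k (Suc k) \<circ> w) m = {}"
      unfolding hecke_words_def by blast
    have "sum ?f ((#) k ` ?W k) = (\<Sum>S\<in>?W k. (y + of_nat k) * ?f S)"
      by (subst sum.reindex) (auto intro: inj_onI)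
    also have "\<dots> = (y + of_nat k) * (sum ?f (hecke_words n w m) +
        sum ?f (hecke_words n (tr k (Suc k) \<circ> w) m))"
      unfolding sum_distrib_left[symmetric]
      by (subst sum.union_disjoint[OF finite_hecke_words finite_hecke_words disj]) (rule refl)
    also have "\<dots> = (y + of_nat k) * (hecke_weight (\<lambda>k. y + of_nat k) n m w +
        hecke_weight (\<lambda>k. y + of_nat k) n m (tr k (Suc k) \<circ> w))"
      unfolding Suc[symmetric] poly_FK ..
    finally show ?thesis using k unfolding left_demazure_def by simp
  qed
  have "poly (FK n w (Suc m)) y = (\<Sum>k\<in>?D. sum ?f ((#) k ` ?W k))"
    unfolding poly_FK hecke_words_Suc
    by (rule sum.UNION_disjoint) (auto simp: finite_hecke_words)
  also have "\<dots> = (\<Sum>k\<in>?D. (y + of_nat k) * left_demazure k (hecke_weight (\<lambda>k. y + of_nat k) n m) w)"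
    using summand by (intro sum.cong) auto
  also have "\<dots> = (\<Sum>k\<in>{1..<n}. (y + of_nat k) * left_demazure k (hecke_weight (\<lambda>k. y + of_nat k) n m) w)"
    by (rule sum.mono_neutral_left) (auto simp: left_demazure_def)
  finally show ?case by (simp add: hecke_sum_def)
qed

text \<open>The permutation $1^x \times w$, whose letters \<open>k + x\<close> have weight \<open>k + x\<close> without any variable.\<close>

definition shift_perm :: "nat \<Rightarrow> (nat \<Rightarrow> nat) \<Rightarrow> nat \<Rightarrow> nat" where
  "shift_perm x w i = (if i \<le> x then i else w (i - x) + x)"

lemma shift_perm_ge:
  assumes "w permutes {1..n}" "x < i"
  shows "x < shift_perm x w i"
proof -
  have "w (i - x) \<noteq> 0"
  proof (cases "i - x \<le> n")
    case True
    then show ?thesis using permutes_in_image[OF assms(1), of "i - x"] assms(2) by auto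
  qed (use permutes_not_in[OF assms(1), of "i - x"] assms(2) in auto)
  then show ?thesis using assms(2) unfolding shift_perm_def by simp
qed

lemma shift_perm_permutes:
  assumes "w permutes {1..n}" "n + x \<le> N"
  shows "shift_perm x w permutes {1..N}"
proof -
  have "bij (shift_perm x w)"
  proof (rule bij_betw_byWitness[where f' = "shift_perm x (inv w)"])
    have *: "shift_perm x u (shift_perm x v i) = i"
      if "v permutes {1..n}" "\<And>a. u (v a) = a" for u v i
      using shift_perm_ge[OF that(1), of x i] that(2) by (auto simp: shift_perm_def)
    show "\<forall>i\<in>UNIV. shift_perm x (inv w) (shift_perm x w i) = i"
      using *[OF assms(1)] permutes_inverses[OF assms(1)] by blast
    show "\<forall>i\<in>UNIV. shift_perm x w (shift_perm x (inv w) i) = i"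
      using *[OF permutes_inv[OF assms(1)]] permutes_inverses[OF assms(1)] by blast
  qed auto
  moreover have "shift_perm x w i = i" if "i \<notin> {1..N}" for i
  proof (cases "i \<le> x")
    case False
    then have "i - x \<notin> {1..n}" using that assms(2) by auto
    then show ?thesis using permutes_not_in[OF assms(1), of "i - x"] False by (simp add: shift_perm_def)
  qed (simp add: shift_perm_def)
  ultimately show ?thesis unfolding permutes_def bij_iff by blast
qed

lemma transpose_shift_perm:
  assumes "w permutes {1..n}" "1 \<le> k"
  shows "tr (k + x) (Suc (k + x)) \<circ> shift_perm x w = shift_perm x (tr k (Suc k) \<circ> w)"
  using assms by (auto simp: fun_eq_iff shift_perm_def Transposition.transpose_def)

lemma left_descent_shift_perm:
  assumes "w permutes {1..n}" "1 \<le> k"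
  shows "left_descent (k + x) (shift_perm x w) \<longleftrightarrow> left_descent k w"
proof -
  obtain p q where pq: "w p = Suc k" "w q = k"
    using permutes_surj[OF assms(1)] by (metis surjD)
  have "w 0 = 0" using permutes_not_in[OF assms(1), of 0] by simp
  then have "p \<noteq> 0" "q \<noteq> 0" using pq assms(2) by (metis Zero_not_Suc, metis not_one_le_zero)
  then have "shift_perm x w (p + x) = Suc (k + x)" "shift_perm x w (q + x) = k + x"
    using pq by (auto simp: shift_perm_def)
  then have "left_descent (k + x) (shift_perm x w) \<longleftrightarrow> p + x < q + x"
    using permutes_inj[OF shift_perm_permutes[OF assms(1) order_refl]] by (intro left_descent_iff)
  then show ?thesis using left_descent_iff[OF permutes_inj[OF assms(1)] pq] by simp
qed

lemma not_left_descent_shift_perm: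
  assumes "w permutes {1..n}" "k \<le> x \<or> n + x \<le> k"
  shows "\<not> left_descent k (shift_perm x w)"
proof
  assume "left_descent k (shift_perm x w)"
  then obtain p q where pq: "p < q" "shift_perm x w p = Suc k" "shift_perm x w q = k"
    unfolding left_descent_def by auto
  have perm: "shift_perm x w permutes {1..n + x}" by (rule shift_perm_permutes[OF assms(1) order_refl])
  from assms(2) show False
  proof
    assume k: "k \<le> x"
    then have "q \<le> x" using shift_perm_ge[OF assms(1), of x q] pq(3) by (cases "q \<le> x") auto
    then have "q = k" "p \<le> x" using pq by (auto simp: shift_perm_def)
    then show False using pq by (simp add: shift_perm_def)
  next
    assume k: "n + x \<le> k"
    have "p \<notin> {1..n + x}" using permutes_in_image[OF perm, of p] pq(2) k by auto
    then have "p = Suc k" using permutes_not_in[OF perm, of p] pq(2) by simp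
    then have "q \<notin> {1..n + x}" using pq(1) k by simp
    then show False using permutes_not_in[OF perm, of q] pq \<open>p = Suc k\<close> by simp
  qed
qed

text \<open>Letters outside the range from \<open>x + 1\<close> to \<open>x + n - 1\<close> are
  never left descents of the shifted permutation, so any large enough bound \<open>N\<close> gives
  the same sum.\<close>

lemma hecke_weight_shift_perm:
  assumes "w permutes {1..n}" "n + x \<le> N"
  shows "hecke_weight of_nat N m (shift_perm x w) = hecke_weight (\<lambda>k. of_nat x + of_nat k) n m w"
  using assms(1)
proof (induction m arbitrary: w)
  case 0
  have "w = id" if "shift_perm x w = id"
  proof
    fix i
    show "w i = id i"
    proof (cases "i = 0")
      case True
      then show ?thesis using permutes_not_in[OF 0, of 0] by simp
    next
      case False
      then show ?thesis using fun_cong[OF that, of "i + x"] by (simp add: shift_perm_def)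
    qed
  qed
  moreover have "shift_perm x id = id" by (auto simp: shift_perm_def)
  ultimately have "shift_perm x w = id \<longleftrightarrow> w = id" by metis
  then show ?case by (simp only: hecke_weight.simps)
next
  case (Suc m)
  let ?f = "\<lambda>k. of_nat k * left_demazure k (hecke_weight of_nat N m) (shift_perm x w)"
  have inner: "?f (k + x) = (of_nat x + of_nat k) *
      left_demazure k (hecke_weight (\<lambda>k. of_nat x + of_nat k) n m) w" if k: "k \<in> {1..<n}" for k
  proof -
    have k1: "1 \<le> k" using k by simp
    have "hecke_weight of_nat N m (tr (k + x) (Suc (k + x)) \<circ> shift_perm x w) =
        hecke_weight (\<lambda>k. of_nat x + of_nat k) n m (tr k (Suc k) \<circ> w)"
      unfolding transpose_shift_perm[OF Suc.prems k1]
      by (rule Suc.IH[OF left_transposition_permutes[OF Suc.prems k]])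
    then show ?thesis
      unfolding left_demazure_def using left_descent_shift_perm[OF Suc.prems, of k x] k
        Suc.IH[OF Suc.prems] by simp
  qed
  have "hecke_weight of_nat N (Suc m) (shift_perm x w) = (\<Sum>k\<in>{1..<N}. ?f k)"
    by (simp add: hecke_sum_def)
  also have "\<dots> = (\<Sum>k\<in>{1 + x..<n + x}. ?f k)"
  proof (rule sum.mono_neutral_right)
    show "\<forall>k\<in>{1..<N} - {1 + x..<n + x}. ?f k = 0"
      using not_left_descent_shift_perm[OF Suc.prems, of _ x] by (auto simp: left_demazure_def)
  qed (use assms(2) in auto)
  also have "\<dots> = (\<Sum>k\<in>{1..<n}. ?f (k + x))"
    by (rule sum.shift_bounds_nat_ivl)
  also have "\<dots> = hecke_weight (\<lambda>k. of_nat x + of_nat k) n (Suc m) w"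
    using inner by (simp add: hecke_sum_def)
  finally show ?case .
qed

lemma code_shift_perm:
  assumes "w permutes {1..n}" "n + x \<le> N"
  shows "lehmer_code N (shift_perm x w) = (\<lambda>i. if i \<le> x then 0 else lehmer_code n w (Suc (i - Suc x)))"
proof
  fix i
  show "lehmer_code N (shift_perm x w) i = (if i \<le> x then 0 else lehmer_code n w (Suc (i - Suc x)))"
  proof (cases "i \<le> x")
    case True
    have "{j. i < j \<and> j \<le> N \<and> shift_perm x w i > shift_perm x w j} = {}"
    proof -
      have "\<not> shift_perm x w i > shift_perm x w j" if "i < j" for j
        using shift_perm_ge[OF assms(1), of x j] that True by (cases "j \<le> x") (auto simp: shift_perm_def)
      then show ?thesis by auto
    qed
    then show ?thesis using True by (simp add: lehmer_code_def)
  next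
    case False
    define a where "a = i - x"
    have a: "i = a + x" "1 \<le> a" "Suc (i - Suc x) = a" unfolding a_def using False by auto
    have "{j. i < j \<and> j \<le> N \<and> shift_perm x w i > shift_perm x w j} =
        (\<lambda>j. j + x) ` {j. a < j \<and> j \<le> n \<and> w a > w j}"
    proof (intro equalityI subsetI)
      fix j assume "j \<in> {j. i < j \<and> j \<le> N \<and> shift_perm x w i > shift_perm x w j}"
      then have j: "a < j - x" "w (j - x) < w a" "j = j - x + x"
        using a by (auto simp: shift_perm_def)
      have "j - x \<le> n"
      proof (rule ccontr)
        assume *: "\<not> j - x \<le> n"
        then have "w (j - x) = j - x" using permutes_not_in[OF assms(1), of "j - x"] by simp
        moreover have "w a \<le> max a n"
          using permutes_in_image[OF assms(1), of a] permutes_not_in[OF assms(1), of a]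
          by (cases "a \<in> {1..n}") auto
        ultimately show False using j * by simp
      qed
      then show "j \<in> (\<lambda>j. j + x) ` {j. a < j \<and> j \<le> n \<and> w a > w j}" using j by blast
    qed (use a assms(2) in \<open>auto simp: shift_perm_def\<close>)
    then show ?thesis using False a unfolding lehmer_code_def by (simp add: card_image)
  qed
qed

lemma perm_length_shift_perm:
  assumes "w permutes {1..n}" "n + x \<le> N"
  shows "perm_length N (shift_perm x w) = perm_length n w"
proof -
  have "perm_length N (shift_perm x w) = (\<Sum>i\<in>{1 + x..n + x}. lehmer_code N (shift_perm x w) i)"
    unfolding perm_length_eq_sum_code
  proof (rule sum.mono_neutral_right)
    show "\<forall>i\<in>{1..N} - {1 + x..n + x}. lehmer_code N (shift_perm x w) i = 0"
    proof
      fix i assume i: "i \<in> {1..N} - {1 + x..n + x}"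
      have "lehmer_code n w j = 0" if "n < j" for j using code_pos_imp_less[of n w j] that by auto
      then show "lehmer_code N (shift_perm x w) i = 0"
        using i unfolding code_shift_perm[OF assms] by auto
    qed
  qed (use assms(2) in auto)
  also have "\<dots> = (\<Sum>i\<in>{1..n}. lehmer_code N (shift_perm x w) (i + x))"
    by (rule sum.shift_bounds_cl_nat_ivl)
  also have "\<dots> = perm_length n w"
    unfolding perm_length_eq_sum_code code_shift_perm[OF assms] by (intro sum.cong) auto
  finally show ?thesis .
qed

section \<open>Dominant permutations and their partitions\<close>

text \<open>An inversion \<open>j\<close> of position \<open>i + 1\<close> that is not one of
  \<open>i\<close> would make \<open>i, i + 1, j\<close> a 132 pattern.\<close>

lemma dominant_code_antimono:
  assumes "w permutes {1..n}" "dominant n w"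
  shows "antimono (\<lambda>i. lehmer_code n w (Suc i))"
proof (intro antimonoI)
  have step: "lehmer_code n w (Suc i) \<le> lehmer_code n w i" if i: "1 \<le> i" for i
  proof -
    have "{j. Suc i < j \<and> j \<le> n \<and> w (Suc i) > w j} \<subseteq> {j. i < j \<and> j \<le> n \<and> w i > w j}"
    proof (clarify, intro conjI)
      fix j assume j: "Suc i < j" "j \<le> n" "w j < w (Suc i)"
      then show "i < j" by simp
      have "\<not> w i < w j" using assms(2) i j unfolding dominant_def by (metis lessI)
      moreover have "w i \<noteq> w j" using permutes_inj[OF assms(1)] j(1) by (metis injD Suc_lessD less_irrefl)
      ultimately show "w j < w i" by simp
    qed
    then show ?thesis unfolding lehmer_code_def by (intro card_mono) auto
  qed
  fix i j :: nat assume "i \<le> j"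
  then show "lehmer_code n w (Suc j) \<le> lehmer_code n w (Suc i)"
    by (rule lift_Suc_antimono_le[rotated]) (use step in auto)
qed

text \<open>The code decreases weakly, so the filter in \<open>lehmer_shape\<close> only cuts off a
  tail and no index is shifted.\<close>

lemma lehmer_shape_eq:
  assumes "w permutes {1..n}" "dominant n w"
  shows "lehmer_code n w (Suc i) = (if i < length (lehmer_shape n w) then lehmer_shape n w ! i else 0)"
proof -
  define g where "g = (\<lambda>i. lehmer_code n w (Suc i))"
  have anti: "g j \<le> g i" if "i \<le> j" for i j
    using antimonoD[OF dominant_code_antimono[OF assms] that] unfolding g_def .
  have "g n = 0" using code_pos_imp_less[of n w "Suc n"] unfolding g_def by auto
  define r where "r = (LEAST i. g i = 0)"
  have r: "g r = 0" "r \<le> n" unfolding r_def using \<open>g n = 0\<close> by (auto intro: LeastI Least_le)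
  have pos: "g i \<noteq> 0" if "i < r" for i using not_less_Least[of i "\<lambda>i. g i = 0"] that unfolding r_def by auto
  have zero: "g i = 0" if "r \<le> i" for i using anti[OF that] r(1) by simp
  have "map (lehmer_code n w) [1..<Suc n] = map g [0..<n]"
    unfolding g_def by (simp flip: map_Suc_upt del: upt_Suc)
  also have "[0..<n] = [0..<r] @ [r..<n]" using r(2) by (metis le_add_diff_inverse upt_add_eq_append zero_le)
  finally have "lehmer_shape n w = map g [0..<r]"
    unfolding lehmer_shape_def using pos zero by (simp add: filter_map filter_id_conv filter_empty_conv)
  moreover have "lehmer_code n w (Suc i) = g i" by (simp add: g_def)
  ultimately show ?thesis using zero[of i] by auto
qed

section \<open>The balanced case\<close>

lemma poly_FK_of_nat:
  assumes "w permutes {1..n}" "dominant n w" "l = perm_length n w"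
  defines "lam \<equiv> (\<lambda>i. lehmer_code n w (Suc i))"
  shows "poly (FK n w l) (of_nat x) = fact l * chain_count x lam"
    and "poly (FK n w (Suc l)) (of_nat x) =
      fact (Suc l) * (chain_stat corners x lam + of_nat l / 2 * chain_count x lam)"
proof -
  \<comment> \<open>One more than \<open>n + x\<close>, so that the shifted permutation fixes its
    last position, as the Monk formula requires.\<close>
  define N where "N = Suc (n + x)"
  have N: "n + x \<le> N" unfolding N_def by simp
  have perm: "shift_perm x w permutes {1..N}" by (rule shift_perm_permutes[OF assms(1) N])
  have "shift_perm x w N = N"
    using permutes_not_in[OF shift_perm_permutes[OF assms(1) order_refl[of "n + x"]], of N]
    unfolding N_def by simp
  moreover have "lam i = 0" if "n \<le> i" for i
    using code_pos_imp_less[of n w "Suc i"] that unfolding lam_def by auto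
  moreover have "lehmer_code N (shift_perm x w) = (\<lambda>i. if i \<le> x then 0 else lam (i - Suc x))"
    using code_shift_perm[OF assms(1) N] unfolding lam_def .
  moreover have "antimono lam" unfolding lam_def by (rule dominant_code_antimono[OF assms(1,2)])
  ultimately have vals: "reduced_coeff N (shift_perm x w) = chain_count x lam"
    "nearly_reduced_coeff N (shift_perm x w) = chain_stat corners x lam"
    using coeff_shifted_dominant[of lam n "shift_perm x w" N x] perm by auto
  have len: "perm_length N (shift_perm x w) = l"
    using perm_length_shift_perm[OF assms(1) N] assms(3) by simp
  have FK: "poly (FK n w m) (of_nat x) = hecke_weight of_nat N m (shift_perm x w)" for m
    unfolding poly_FK_eq_hecke_weight hecke_weight_shift_perm[OF assms(1) N] ..
  show 1: "poly (FK n w l) (of_nat x) = fact l * chain_count x lam"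
    unfolding FK vals(1)[symmetric] reduced_coeff_def len by simp
  show "poly (FK n w (Suc l)) (of_nat x) =
      fact (Suc l) * (chain_stat corners x lam + of_nat l / 2 * chain_count x lam)"
    unfolding FK vals[symmetric] nearly_reduced_coeff_def len by (simp del: fact_Suc)
qed

lemma poly_eqI_of_nat:
  fixes p q :: "rat poly"
  assumes "\<And>x :: nat. poly p (of_nat x) = poly q (of_nat x)"
  shows "p = q"
proof (rule ccontr)
  assume "p \<noteq> q"
  then have "finite {y. poly (p - q) y = 0}" by (intro poly_roots_finite) simp
  moreover have "range of_nat \<subseteq> {y. poly (p - q) y = 0}" using assms by auto
  ultimately have "finite (range (of_nat :: nat \<Rightarrow> rat))" by (rule rev_finite_subset)
  moreover have "inj (of_nat :: nat \<Rightarrow> rat)" by (rule inj_of_nat)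
  ultimately show False by (metis finite_imageD infinite_UNIV_nat)
qed

text \<open>This is the ratio \<open>(l + 1) (x r c / (r + c) + l / 2)\<close> with denominators
  cleared: an identity of polynomials, to be checked at natural numbers only.\<close>

lemma FK_balanced:
  assumes perm: "w permutes {1..n}" and dom: "dominant n w"
    and lam: "lam = lehmer_shape n w" and nonempty: "lam \<noteq> []" and bal: "balanced lam"
    and r: "r = length lam" and c: "c = hd lam" and l: "l = perm_length n w"
  shows "of_nat (2 * (r + c)) * FK n w (Suc l) =
    FK n w l * (of_nat (Suc l * l * (r + c)) + of_nat (2 * Suc l * r * c) * [:0, 1:])"
proof (rule poly_eqI_of_nat)
  fix x :: nat
  define g where "g = (\<lambda>i. lehmer_code n w (Suc i))"
  have g: "g i = (if i < r then lam ! i else 0)" for i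
    unfolding g_def r lam by (rule lehmer_shape_eq[OF perm dom])
  have r0: "0 < r" using nonempty r by simp
  have "of_nat (r + c) * chain_stat corners x g = of_nat (x * r * c) * chain_count x g"
  proof (rule chain_stat_corners_balanced)
    show "antimono g" unfolding g_def by (rule dominant_code_antimono[OF perm dom])
    show "g 0 = c" using r0 nonempty by (simp add: g c hd_conv_nth)
    fix i assume i: "1 \<le> i" "i < r" "g i < g (i - 1)"
    then have "i - 1 < r" "i \<le> length lam - 1" using r by auto
    then have "i \<le> length lam - 1" "lam ! (i - 1) > lam ! i" using i by (simp_all add: g)
    then have "length lam * lam ! i = hd lam * (length lam - i)"
      using bal i(1) unfolding balanced_iff[OF nonempty] by blast
    then show "r * g i = c * (r - i)" using i r c by (simp add: g)
  qed (use r0 in \<open>auto simp: g\<close>)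
  then have rel: "(of_nat r + of_nat c) * chain_stat corners x g =
      of_nat x * of_nat r * of_nat c * chain_count x g" by simp
  have FK: "poly (FK n w l) (of_nat x) = fact l * chain_count x g"
    "poly (FK n w (Suc l)) (of_nat x) =
      (of_nat l + 1) * fact l * (chain_stat corners x g + of_nat l / 2 * chain_count x g)"
    using poly_FK_of_nat[OF perm dom l, of x] unfolding g_def by simp_all
  have "poly (of_nat (2 * (r + c)) * FK n w (Suc l)) (of_nat x) =
      (of_nat l + 1) * fact l * (2 * ((of_nat r + of_nat c) * chain_stat corners x g) +
      (of_nat r + of_nat c) * of_nat l * chain_count x g)"
    by (simp add: FK field_simps)
  also have "\<dots> = poly (FK n w l * (of_nat (Suc l * l * (r + c)) +
      of_nat (2 * Suc l * r * c) * [:0, 1:])) (of_nat x)"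
    unfolding rel by (simp add: FK algebra_simps)
  finally show "poly (of_nat (2 * (r + c)) * FK n w (Suc l)) (of_nat x) =
    poly (FK n w l * (of_nat (Suc l * l * (r + c)) +
      of_nat (2 * Suc l * r * c) * [:0, 1:])) (of_nat x)" .
qed

theorem theorem3p4:
  fixes n r c l :: nat and w :: "nat \<Rightarrow> nat" and lam :: "nat list"
    and x :: "rat poly fract"
  assumes perm: "w permutes {1..n}"
    and dom: "dominant n w"
    and lam: "lam = lehmer_shape n w"
    and nonempty: "lam \<noteq> []"
    and bal: "balanced lam"
    and r: "r = length lam"
    and c: "c = hd lam"
    and l: "l = perm_length n w"
    and x: "x = to_fract [:0, 1:]"
  shows "to_fract (FK n w (l + 1)) / to_fract (FK n w l) =
    of_nat ((l + 1) choose 2) *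
      (2 * x * of_nat r * of_nat c / (of_nat l * (of_nat r + of_nat c)) + 1)"
proof -
  let ?F = "to_fract (FK n w l)" and ?G = "to_fract (FK n w (Suc l))"
  have of_nat_fract: "to_fract (of_nat k) = (of_nat k :: rat poly fract)" for k
    by (induction k) simp_all
  have r0: "0 < r" using nonempty r by simp
  have "lehmer_code n w (Suc 0) = hd lam"
    using lehmer_shape_eq[OF perm dom, of 0] nonempty lam by (simp add: hd_conv_nth)
  moreover have "hd lam \<noteq> 0"
    using nonempty hd_in_set[OF nonempty] unfolding lam lehmer_shape_def by auto
  \<comment> \<open>The first part of the partition is positive, whence \<open>l > 0\<close>, and
    the division by \<open>l\<close> in the theorem is genuine.\<close>
  ultimately have code: "0 < lehmer_code n w 1" by simp
  then have "1 \<in> {1..n}" using code_pos_imp_less[of n w 1] by simp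
  then have "lehmer_code n w 1 \<le> l"
    unfolding l perm_length_eq_sum_code by (intro member_le_sum) auto
  then have l0: "0 < l" using code by simp
  \<comment> \<open>At \<open>x = 0\<close> there is only the empty chain, so
    \<open>FK n w l\<close> takes the value \<open>fact l\<close> there and is not the zero
    polynomial.\<close>
  have "chain_count 0 (\<lambda>i. lehmer_code n w (Suc i)) = 1" by simp
  then have "poly (FK n w l) (of_nat 0) = fact l"
    using poly_FK_of_nat(1)[OF perm dom l, of 0] by simp
  then have "FK n w l \<noteq> 0" by (metis fact_nonzero poly_0)
  then have F0: "?F \<noteq> 0" by simp
  have "to_fract (of_nat (2 * (r + c)) * FK n w (Suc l)) =
      to_fract (FK n w l * (of_nat (Suc l * l * (r + c)) + of_nat (2 * Suc l * r * c) * [:0, 1:]))"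
    unfolding FK_balanced[OF perm dom lam nonempty bal r c l] ..
  then have main: "of_nat (2 * (r + c)) * ?G =
      ?F * (of_nat (Suc l * l * (r + c)) + of_nat (2 * Suc l * r * c) * x)"
    unfolding x to_fract_mult to_fract_add of_nat_fract .
  define R C L where "R = (of_nat r :: rat poly fract)" and "C = (of_nat c :: rat poly fract)"
    and "L = (of_nat l :: rat poly fract)"
  have rc: "R + C \<noteq> 0" unfolding R_def C_def of_nat_add[symmetric] of_nat_eq_0_iff using r0 by simp
  have L: "L \<noteq> 0" unfolding L_def of_nat_eq_0_iff using l0 by simp
  have "2 * ((l + 1) choose 2) = (l + 1) * l" unfolding choose_two by simp
  then have "(of_nat (2 * ((l + 1) choose 2)) :: rat poly fract) = of_nat ((l + 1) * l)" by (rule arg_cong)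
  then have ch: "2 * of_nat ((l + 1) choose 2) = (L + 1) * L"
    unfolding L_def of_nat_mult of_nat_add by simp
  have "2 * (R + C) * ?G = ?F * ((L + 1) * L * (R + C) + 2 * (L + 1) * R * C * x)"
    using main unfolding R_def C_def L_def by (simp add: algebra_simps)
  also have "\<dots> = 2 * (R + C) * (?F * (of_nat ((l + 1) choose 2) * (2 * x * R * C / (L * (R + C)) + 1)))"
  proof -
    have "2 * (R + C) * (?F * (of_nat ((l + 1) choose 2) * (2 * x * R * C / (L * (R + C)) + 1))) =
        ?F * ((2 * of_nat ((l + 1) choose 2)) * ((R + C) * (2 * x * R * C / (L * (R + C)) + 1)))"
      by (simp only: mult_ac)
    also have "\<dots> = ?F * ((L + 1) * (L * ((R + C) * (2 * x * R * C / (L * (R + C)) + 1))))"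
      unfolding ch by (simp only: mult_ac)
    also have "L * ((R + C) * (2 * x * R * C / (L * (R + C)) + 1)) = 2 * x * R * C + L * (R + C)"
    proof -
      define d where "d = L * (R + C)"
      have "d \<noteq> 0" unfolding d_def using rc L by simp
      then have "d * (2 * x * R * C / d + 1) = 2 * x * R * C + d" by (simp add: distrib_left)
      then show ?thesis unfolding d_def by (simp only: mult.assoc)
    qed
    finally show ?thesis by (simp add: algebra_simps)
  qed
  finally have "?G = ?F * (of_nat ((l + 1) choose 2) * (2 * x * R * C / (L * (R + C)) + 1))"
    using rc by simp
  then show ?thesis
    using F0 unfolding R_def C_def L_def by simp
qed

end
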